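(* There exist $N,M\in\mathbb{N}$ such that for every odd prime power $p$ and every $k\ge1$, the following hold (for a suitable choice of alias words). 1. Every pure-degree Steinberg relation in $U_{B_3}^{\mathrm{sm}}(\mathbb{F}_{p^k}[x]_{\le1})$ can be derived in at most $N$ steps from (i) in-subgroup relations of length at most $M$ and (ii) lifts of relations in $U_{B_3}^{\mathrm{sm}}(\mathbb{F}_p)$ of length at most $M$. 2. Every pure-degree Steinberg relation in $U_{B_3}^{\mathrm{lg}}(\mathbb{F}_{p^k}[x]_{\le1})$ can be derived in at most $N$ steps from (i) in-subgroup relations of length at most $M$ and (ii) lifts of relations in $U_{B_3}^{\mathrm{lg}}(\mathbb{F}_p)$ of length at most $M$.
   Context: **Groups.** The root system $\Phi=B_3$ consists of all integer vectors in $\mathbb{R}^3$ of length $1$ or $\sqrt2$. Put $\alpha=(1,-1,0)$, $\beta=(0,1,-1)$, $\psi=(0,0,1)$, $\omega=-(\alpha+\beta+\psi)$; $I_{\mathrm{sm}}=\{\beta,\psi,\omega\}$, $I_{\mathrm{lg}}=\{\alpha,\beta,\psi\}$. For a linearly independent $I\subset\Phi$, $I^+$ is the set of roots that are nonnegative integer combinations of $I$, and $\mathrm{ht}_I(\zeta)$ is the sum of the coefficients of $\zeta\in I^+$ in terms of $I$. For a finite field $K$ of odd characteristic, the universal Chevalley group $B_3(K)$ has root elements $x_\zeta(t)$ with $x_\zeta(t)x_\zeta(u)=x_\zeta(t+u)$ and, for $\eta\ne-\zeta$, $[x_\zeta(t),x_\eta(u)]=\prod_{a,b\ge1,\ a\zeta+b\eta\in\Phi}x_{a\zeta+b\eta}(C^{\zeta,\eta}_{a,b}t^au^b)$,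 where $[x,y]=xyx^{-1}y^{-1}$, the product is in a fixed order on roots, and $C^{\zeta,\eta}_{a,b}\in\mathbb{Z}$ are the fixed Chevalley structure constants (the same for all fields). $U_I(K)$ is the subgroup of $B_3(K)$ generated by $x_\zeta(t)$, $\zeta\in I$, $t\in K$. $U_I(K[x]_{\le1})$ is the subgroup of $B_3(K[x]/(f))$, with $f\in K[x]$ irreducible of degree $m\ge6$, generated by $x_\zeta(a+bx)$, $\zeta\in I$, $a,b\in K$ (up to isomorphism independent of $m,f$). $U_{B_3}^{\mathrm{sm}}$ and $U_{B_3}^{\mathrm{lg}}$ denote $U_I$ for $I=I_{\mathrm{sm}}$ and $I=I_{\mathrm{lg}}$. Here $\mathbb{F}_{p^k}\supseteq\mathbb{F}_p$ is the degree-$k$ extension of the field with $p$ elements. **Symbols.** Fix $I\in\{I_{\mathrm{sm}},I_{\mathrm{lg}}\}$ and $K=\mathbb{F}_{p^k}$. Let $J\subset I^+$ be the set of roots lying in $\{\eta,\theta\}^+$ for some two-element subset $\{\eta,\theta\}\subset I$. The generating symbols are the pure-degree symbols $[\zeta,t,i]$ with $\zeta\in J$, $t\in K$, $0\le i\le\mathrm{ht}_I(\zeta)$, representing the element $x_\zeta(tx^i)\in U_I(K[x]_{\le1})$. For $\zeta\in I^+\setminus J$, $[\zeta,t,i]$ is an alias standing for one fixed word in the generating symbols whose value in $U_I(K[x]_{\le1})$ is $x_\zeta(tx^i)$. The formal inverse of the generating symbol $[\zeta,t,i]$ is $[\zeta,-t,i]$; the inverse of a word is obtained by reversing it and inverting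 each symbol. A relation $y=z$ is identified with the word $yz^{-1}$. **Pure-degree Steinberg relations.** These are, after expanding aliases, the relations $[\zeta,t,i][\zeta,u,i]=[\zeta,t+u,i]$ ($\zeta\in I^+$, $0\le i\le\mathrm{ht}_I(\zeta)$, $t,u\in K$) and $\bigl[[\zeta,t,i],[\eta,u,j]\bigr]=\prod_{a,b\ge1,\ a\zeta+b\eta\in\Phi}[a\zeta+b\eta,\,C^{\zeta,\eta}_{a,b}t^au^b,\,ai+bj]$ ($\zeta,\eta\in I^+$, possibly equal, $0\le i\le\mathrm{ht}_I(\zeta)$, $0\le j\le\mathrm{ht}_I(\eta)$, $t,u\in K$). **In-subgroup relations.** Words in generating symbols whose types all lie in $\{\eta,\theta\}^+$ for a single two-element $\{\eta,\theta\}\subset I$ and whose value is the identity. **Lifts.** Take a word in symbols $[\eta,u]$ ($\eta\in J$, $u\in\mathbb{F}_p$, representing $x_\eta(u)$) whose value in $U_I(\mathbb{F}_p)$ is the identity, and elements $t_{\zeta,0},t_{\zeta,1}\in K$ for $\zeta\in I$. The lift of the word is obtained by replacing each $[\eta,u]$, with $\eta=\sum_{\zeta\in I}c_\zeta\zeta$, by $\prod_{i=0}^{\mathrm{ht}_I(\eta)}[\eta,a_i,i]$, where $\sum_ia_ix^i=u\prod_{\zeta\in I}(t_{\zeta,1}x+t_{\zeta,0})^{c_\zeta}$. (The "length at most $M$" in (ii) refers to the word over $\mathbb{F}_p$ before lifting.) **Derivation.** For words write $v\sim u$ if $v$ is a cyclic shift of $u$ or of $u^{-1}$. A word $w'$ is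 derived from $w$ in one step via a relator $r$ if there are words $a,b,u,v$ with $w\sim aub$, $w'\sim avb$, $r\sim uv^{-1}$. A relation (word) is derived in at most $N$ steps from a set of relators if it can be transformed to the trivial word by at most $N$ such steps. *)

theory Defs
  imports
    "HOL-Algebra.Algebra"
    "HOL-Number_Theory.Prime_Powers"
    "HOL-Library.Product_Plus"
    "HOL-Library.Product_Lexorder"
begin

section \<open>The root system $B_3$\<close>

type_synonym root = "int \<times> int \<times> int"

definition Phi :: "root set"
  where "Phi = {(a, b, c). a\<^sup>2 + b\<^sup>2 + c\<^sup>2 = 1 \<or> a\<^sup>2 + b\<^sup>2 + c\<^sup>2 = 2}"

fun scal :: "nat \<Rightarrow> root \<Rightarrow> root"  (infixr \<open>\<bullet>\<close> 75)
  where "n \<bullet> (a, b, c) = (int n * a, int n * b, int n * c)"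

definition alpha :: root where "alpha = (1, -1, 0)"
definition beta :: root where "beta = (0, 1, -1)"
definition psi :: root where "psi = (0, 0, 1)"
definition omega :: root where "omega = - (alpha + beta + psi)"

definition I_sm :: "root set" where "I_sm = {beta, psi, omega}"
definition I_lg :: "root set" where "I_lg = {alpha, beta, psi}"

definition pos_roots :: "root set \<Rightarrow> root set"
  where "pos_roots I = {\<zeta> \<in> Phi. \<exists>c :: root \<Rightarrow> nat. \<zeta> = (\<Sum>\<eta>\<in>I. c \<eta> \<bullet> \<eta>)}"

text \<open>The coefficient function of \<open>\<zeta> \<in> pos_roots I\<close>; it is unique (being set to zero
  outside \<open>I\<close>) when \<open>I\<close> is linearly independent.\<close>

definition root_coeff :: "root set \<Rightarrow> root \<Rightarrow> root \<Rightarrow> nat"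
  where "root_coeff I \<zeta> = (THE c. (\<forall>\<eta>. \<eta> \<notin> I \<longrightarrow> c \<eta> = 0) \<and> \<zeta> = (\<Sum>\<eta>\<in>I. c \<eta> \<bullet> \<eta>))"

definition ht :: "root set \<Rightarrow> root \<Rightarrow> nat"
  where "ht I \<zeta> = (\<Sum>\<eta>\<in>I. root_coeff I \<zeta> \<eta>)"

definition pairs :: "root set \<Rightarrow> root set set"
  where "pairs I = {{\<eta>, \<theta>} | \<eta> \<theta>. \<eta> \<in> I \<and> \<theta> \<in> I \<and> \<eta> \<noteq> \<theta>}"

definition rank2_roots :: "root set \<Rightarrow> root set"
  where "rank2_roots I = (\<Union>S\<in>pairs I. pos_roots S)"


section \<open>A Chevalley basis in the spin representation\<close>

text \<open>
  The universal Chevalley group of type $B_3$ is constructed from its 8-dimensional spin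
  representation, whose weights $(\pm\frac12,\pm\frac12,\pm\frac12)$ generate the full weight
  lattice.  We realise it on the Fock space with basis indexed by occupation numbers (the
  basis vector \<open>s\<close> has weight $+\frac12$ at the occupied and $-\frac12$ at the empty places).
  With $c_i$ the creation operators and $d_i$ (the transpose of $c_i$) the annihilation
  operators, the root vectors are
  $X_{e_i} = c_i$, $X_{-e_i} = d_i$, $X_{e_i-e_j} = c_i d_j$ for $i \ne j$, and
  $X_{e_i+e_j} = c_i c_j$, $X_{-e_i-e_j} = d_j d_i$ for $i < j$.
  They satisfy $[X_\zeta, X_{-\zeta}] = H_\zeta$ (the coroot) and belong to a Chevalley basis.
  An entry \<open>A s s'\<close> of a matrix is the coefficient of the basis vector \<open>s\<close> in the image
  of \<open>s'\<close>.
\<close>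

type_synonym fock = "bool \<times> bool \<times> bool"
type_synonym 'a mat = "fock \<Rightarrow> fock \<Rightarrow> 'a"

definition imul :: "int mat \<Rightarrow> int mat \<Rightarrow> int mat"  (infixl \<open>\<star>\<close> 70)
  where "A \<star> B = (\<lambda>i j. \<Sum>k\<in>UNIV. A i k * B k j)"

definition ione :: "int mat"
  where "ione = (\<lambda>i j. of_bool (i = j))"

definition transpose_mat :: "int mat \<Rightarrow> int mat"
  where "transpose_mat A = (\<lambda>i j. A j i)"

fun cre1 :: "int mat"
  where "cre1 (a, b, c) (a', b', c') = of_bool (a \<and> \<not> a' \<and> b = b' \<and> c = c')"

fun cre2 :: "int mat"
  where "cre2 (a, b, c) (a', b', c') =
    (if a' then - 1 else 1) * of_bool (b \<and> \<not> b' \<and> a = a' \<and> c = c')"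

fun cre3 :: "int mat"
  where "cre3 (a, b, c) (a', b', c') =
    (if a' \<noteq> b' then - 1 else 1) * of_bool (c \<and> \<not> c' \<and> a = a' \<and> b = b')"

definition raise :: "int \<Rightarrow> int mat \<Rightarrow> int mat"
  where "raise z A = (if z = 1 then A else ione)"

definition lower :: "int \<Rightarrow> int mat \<Rightarrow> int mat"
  where "lower z A = (if z = - 1 then transpose_mat A else ione)"

fun root_vec :: "root \<Rightarrow> int mat"
  where "root_vec (a, b, c) =
    raise a cre1 \<star> raise b cre2 \<star> raise c cre3 \<star> lower c cre3 \<star> lower b cre2 \<star> lower a cre1"

text \<open>The constant $N_{\zeta,\eta}$ in $[X_\zeta, X_\eta] = N_{\zeta,\eta} X_{\zeta+\eta}$.\<close>

definition lie_const :: "root \<Rightarrow> root \<Rightarrow> int"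
  where "lie_const \<zeta> \<eta> =
    (THE n. \<forall>i j. (root_vec \<zeta> \<star> root_vec \<eta>) i j - (root_vec \<eta> \<star> root_vec \<zeta>) i j
       = n * root_vec (\<zeta> + \<eta>) i j)"

text \<open>
  The structure constants of the commutator formula for $[x,y] = xyx^{-1}y^{-1}$.  Expanding
  $x_\zeta(t)\, x_\eta(u)\, x_\zeta(t)^{-1} = \exp(u \exp(t\,\mathrm{ad} X_\zeta) X_\eta)$ gives
  $C_{1,1} = N_{\zeta,\eta}$ and $C_{2,1} = \frac12 N_{\zeta,\eta} N_{\zeta,\zeta+\eta}$;
  inverting the formula for $[x_\eta(u), x_\zeta(t)]$ gives
  $C_{1,2} = -\frac12 N_{\eta,\zeta} N_{\eta,\zeta+\eta}$.  In $B_3$ no other $(a,b)$ with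
  $a, b \ge 1$ makes $a\zeta + b\eta$ a root (for roots $\eta \ne -\zeta$), and when there are two
  factors they commute, so that the constants do not depend on the order of the factors.
\<close>

definition struct_const :: "root \<Rightarrow> root \<Rightarrow> nat \<Rightarrow> nat \<Rightarrow> int"
  where "struct_const \<zeta> \<eta> a b =
    (if (a, b) = (1, 1) then lie_const \<zeta> \<eta>
     else if (a, b) = (2, 1) then lie_const \<zeta> \<eta> * lie_const \<zeta> (\<zeta> + \<eta>) div 2
     else if (a, b) = (1, 2) then - (lie_const \<eta> \<zeta> * lie_const \<eta> (\<zeta> + \<eta>) div 2)
     else 0)"

text \<open>The index pairs of the commutator formula; the fixed order on roots is the
  lexicographic one.\<close>

definition comm_idx :: "root \<Rightarrow> root \<Rightarrow> (nat \<times> nat) list"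
  where "comm_idx \<zeta> \<eta> = sorted_key_list_of_set (\<lambda>(a, b). a \<bullet> \<zeta> + b \<bullet> \<eta>)
    {(a, b). a \<ge> 1 \<and> b \<ge> 1 \<and> a \<bullet> \<zeta> + b \<bullet> \<eta> \<in> Phi}"


section \<open>The universal Chevalley group and its subgroups\<close>

definition mat_monoid :: "('a, 'm) ring_scheme \<Rightarrow> 'a mat monoid"
  where "mat_monoid R =
    \<lparr>carrier = {A. \<forall>i j. A i j \<in> carrier R},
     monoid.mult = (\<lambda>A B i j. \<Oplus>\<^bsub>R\<^esub>k\<in>UNIV. A i k \<otimes>\<^bsub>R\<^esub> B k j),
     monoid.one = (\<lambda>i j. if i = j then \<one>\<^bsub>R\<^esub> else \<zero>\<^bsub>R\<^esub>)\<rparr>"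

text \<open>Since all weights of the spin representation are minuscule, $X_\zeta^2 = 0$ and
  $x_\zeta(t) = \exp(t X_\zeta) = 1 + t X_\zeta$.\<close>

definition x_root :: "('a, 'm) ring_scheme \<Rightarrow> root \<Rightarrow> 'a \<Rightarrow> 'a mat"
  where "x_root R \<zeta> t =
    (\<lambda>i j. (if i = j then \<one>\<^bsub>R\<^esub> else \<zero>\<^bsub>R\<^esub>) \<oplus>\<^bsub>R\<^esub> [root_vec \<zeta> i j] \<cdot>\<^bsub>R\<^esub> t)"

definition B3 :: "('a, 'm) ring_scheme \<Rightarrow> 'a mat monoid"
  where "B3 R = (units_of (mat_monoid R))
    \<lparr>carrier := generate (units_of (mat_monoid R)) {x_root R \<zeta> t | \<zeta> t. \<zeta> \<in> Phi \<and> t \<in> carrier R}\<rparr>"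

definition U_gen :: "root set \<Rightarrow> ('a, 'm) ring_scheme \<Rightarrow> 'a set \<Rightarrow> 'a mat monoid"
  where "U_gen I R T = (B3 R)
    \<lparr>carrier := generate (B3 R) {x_root R \<zeta> t | \<zeta> t. \<zeta> \<in> I \<and> t \<in> T}\<rparr>"

definition U_field :: "root set \<Rightarrow> ('a, 'm) ring_scheme \<Rightarrow> 'a mat monoid"
  where "U_field I K = U_gen I K (carrier K)"

definition poly_quot :: "('a, 'm) ring_scheme \<Rightarrow> (nat \<Rightarrow> 'a) \<Rightarrow> (nat \<Rightarrow> 'a) set ring"
  where "poly_quot K f = UP K Quot (PIdl\<^bsub>UP K\<^esub> f)"

definition poly_class :: "('a, 'm) ring_scheme \<Rightarrow> (nat \<Rightarrow> 'a) \<Rightarrow> (nat \<Rightarrow> 'a) \<Rightarrow> (nat \<Rightarrow> 'a) set"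
  where "poly_class K f p = (PIdl\<^bsub>UP K\<^esub> f) +>\<^bsub>UP K\<^esub> p"

definition linpoly :: "('a, 'm) ring_scheme \<Rightarrow> 'a \<Rightarrow> 'a \<Rightarrow> nat \<Rightarrow> 'a"
  where "linpoly K a b = monom (UP K) a 0 \<oplus>\<^bsub>UP K\<^esub> monom (UP K) b 1"

definition U_poly :: "root set \<Rightarrow> ('a, 'm) ring_scheme \<Rightarrow> (nat \<Rightarrow> 'a) \<Rightarrow> (nat \<Rightarrow> 'a) set mat monoid"
  where "U_poly I K f = U_gen I (poly_quot K f)
    {poly_class K f (linpoly K a b) | a b. a \<in> carrier K \<and> b \<in> carrier K}"

text \<open>The element $x_\zeta(t x^i)$ over $K[x]/(f)$; here $f$ is irreducible of degree at least 6
  in the statement, and all occurring degrees are at most 5.\<close>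

definition x_deg :: "('a, 'm) ring_scheme \<Rightarrow> (nat \<Rightarrow> 'a) \<Rightarrow> root \<Rightarrow> 'a \<Rightarrow> nat \<Rightarrow> (nat \<Rightarrow> 'a) set mat"
  where "x_deg K f \<zeta> t i = x_root (poly_quot K f) \<zeta> (poly_class K f (monom (UP K) t i))"


section \<open>Words\<close>

type_synonym 'a symb = "root \<times> 'a \<times> nat"
type_synonym 'a word = "'a symb list"

definition gens :: "root set \<Rightarrow> ('a, 'm) ring_scheme \<Rightarrow> 'a symb set"
  where "gens I K = {(\<zeta>, t, i). \<zeta> \<in> rank2_roots I \<and> t \<in> carrier K \<and> i \<le> ht I \<zeta>}"

definition word_inv :: "('a, 'm) ring_scheme \<Rightarrow> 'a word \<Rightarrow> 'a word"
  where "word_inv K w = rev (map (\<lambda>(\<zeta>, t, i). (\<zeta>, \<ominus>\<^bsub>K\<^esub> t, i)) w)"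

definition list_prod :: "('g, 'n) monoid_scheme \<Rightarrow> 'g list \<Rightarrow> 'g"
  where "list_prod G gs = foldr (\<otimes>\<^bsub>G\<^esub>) gs \<one>\<^bsub>G\<^esub>"

definition word_val :: "root set \<Rightarrow> ('a, 'm) ring_scheme \<Rightarrow> (nat \<Rightarrow> 'a) \<Rightarrow> 'a word \<Rightarrow> (nat \<Rightarrow> 'a) set mat"
  where "word_val I K f w = list_prod (U_poly I K f) (map (\<lambda>(\<zeta>, t, i). x_deg K f \<zeta> t i) w)"

definition is_alias ::
  "root set \<Rightarrow> ('a, 'm) ring_scheme \<Rightarrow> (nat \<Rightarrow> 'a) \<Rightarrow> ('a symb \<Rightarrow> 'a word) \<Rightarrow> bool"
  where "is_alias I K f A \<longleftrightarrow>
    (\<forall>\<zeta> \<in> pos_roots I - rank2_roots I. \<forall>t \<in> carrier K. \<forall>i \<le> ht I \<zeta>.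
       A (\<zeta>, t, i) \<in> lists (gens I K) \<and> word_val I K f (A (\<zeta>, t, i)) = x_deg K f \<zeta> t i)"

text \<open>For an alias, the formal inverse is the inverse of the word it stands for
  (so relations are formed after expansion).\<close>

definition expand :: "root set \<Rightarrow> ('a symb \<Rightarrow> 'a word) \<Rightarrow> 'a symb \<Rightarrow> 'a word"
  where "expand I A s = (if fst s \<in> rank2_roots I then [s] else A s)"


section \<open>Relations, each identified with a word\<close>

definition steinberg_add ::
  "root set \<Rightarrow> ('a, 'm) ring_scheme \<Rightarrow> ('a symb \<Rightarrow> 'a word) \<Rightarrow> 'a word set"
  where "steinberg_add I K A =
    {expand I A (\<zeta>, t, i) @ expand I A (\<zeta>, u, i) @ word_inv K (expand I A (\<zeta>, t \<oplus>\<^bsub>K\<^esub> u, i))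
     | \<zeta> t u i. \<zeta> \<in> pos_roots I \<and> i \<le> ht I \<zeta> \<and> t \<in> carrier K \<and> u \<in> carrier K}"

definition steinberg_comm ::
  "root set \<Rightarrow> ('a, 'm) ring_scheme \<Rightarrow> ('a symb \<Rightarrow> 'a word) \<Rightarrow> 'a word set"
  where "steinberg_comm I K A =
    {expand I A (\<zeta>, t, i) @ expand I A (\<eta>, u, j)
       @ word_inv K (expand I A (\<zeta>, t, i)) @ word_inv K (expand I A (\<eta>, u, j))
       @ word_inv K (concat (map
           (\<lambda>(a, b). expand I A
              (a \<bullet> \<zeta> + b \<bullet> \<eta>, [struct_const \<zeta> \<eta> a b] \<cdot>\<^bsub>K\<^esub> (t [^]\<^bsub>K\<^esub> a \<otimes>\<^bsub>K\<^esub> u [^]\<^bsub>K\<^esub> b), a * i + b * j))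
           (comm_idx \<zeta> \<eta>)))
     | \<zeta> \<eta> t u i j. \<zeta> \<in> pos_roots I \<and> \<eta> \<in> pos_roots I \<and> i \<le> ht I \<zeta> \<and> j \<le> ht I \<eta>
         \<and> t \<in> carrier K \<and> u \<in> carrier K}"

definition pure_degree_steinberg ::
  "root set \<Rightarrow> ('a, 'm) ring_scheme \<Rightarrow> ('a symb \<Rightarrow> 'a word) \<Rightarrow> 'a word set"
  where "pure_degree_steinberg I K A = steinberg_add I K A \<union> steinberg_comm I K A"

definition in_subgroup_rels ::
  "root set \<Rightarrow> ('a, 'm) ring_scheme \<Rightarrow> (nat \<Rightarrow> 'a) \<Rightarrow> nat \<Rightarrow> 'a word set"
  where "in_subgroup_rels I K f M =
    {w \<in> lists (gens I K). (\<exists>S \<in> pairs I. fst ` set w \<subseteq> pos_roots S)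
       \<and> word_val I K f w = \<one>\<^bsub>U_poly I K f\<^esub> \<and> length w \<le> M}"

text \<open>For a subfield \<open>F\<close> of \<open>K\<close>: relations among the symbols $[\eta,u]$ in $U_I(F)$.\<close>

definition base_rels ::
  "root set \<Rightarrow> ('a, 'm) ring_scheme \<Rightarrow> 'a set \<Rightarrow> nat \<Rightarrow> (root \<times> 'a) list set"
  where "base_rels I K F M =
    {w \<in> lists (rank2_roots I \<times> F).
       list_prod (U_field I (K\<lparr>carrier := F\<rparr>)) (map (\<lambda>(\<eta>, u). x_root (K\<lparr>carrier := F\<rparr>) \<eta> u) w)
         = \<one>\<^bsub>U_field I (K\<lparr>carrier := F\<rparr>)\<^esub>
       \<and> length w \<le> M}"

definition lift_poly ::
  "root set \<Rightarrow> ('a, 'm) ring_scheme \<Rightarrow> (root \<Rightarrow> 'a) \<Rightarrow> (root \<Rightarrow> 'a) \<Rightarrow> root \<times> 'a \<Rightarrow> nat \<Rightarrow> 'a"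
  where "lift_poly I K t0 t1 = (\<lambda>(\<eta>, u). monom (UP K) u 0 \<otimes>\<^bsub>UP K\<^esub>
    (\<Otimes>\<^bsub>UP K\<^esub>\<zeta>\<in>I. linpoly K (t0 \<zeta>) (t1 \<zeta>) [^]\<^bsub>UP K\<^esub> root_coeff I \<eta> \<zeta>))"

definition lift_word ::
  "root set \<Rightarrow> ('a, 'm) ring_scheme \<Rightarrow> (root \<Rightarrow> 'a) \<Rightarrow> (root \<Rightarrow> 'a) \<Rightarrow> (root \<times> 'a) list \<Rightarrow> 'a word"
  where "lift_word I K t0 t1 w = concat (map
    (\<lambda>(\<eta>, u). map (\<lambda>i. (\<eta>, coeff (UP K) (lift_poly I K t0 t1 (\<eta>, u)) i, i)) [0..<Suc (ht I \<eta>)]) w)"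

definition lifted_rels ::
  "root set \<Rightarrow> ('a, 'm) ring_scheme \<Rightarrow> 'a set \<Rightarrow> nat \<Rightarrow> 'a word set"
  where "lifted_rels I K F M =
    {lift_word I K t0 t1 w | t0 t1 w.
       w \<in> base_rels I K F M \<and> t0 ` I \<subseteq> carrier K \<and> t1 ` I \<subseteq> carrier K}"


section \<open>Derivations\<close>

definition cyc_equiv :: "('a, 'm) ring_scheme \<Rightarrow> 'a word \<Rightarrow> 'a word \<Rightarrow> bool"
  where "cyc_equiv K v u \<longleftrightarrow> (\<exists>n. v = rotate n u \<or> v = rotate n (word_inv K u))"

definition derive_step ::
  "root set \<Rightarrow> ('a, 'm) ring_scheme \<Rightarrow> 'a word set \<Rightarrow> 'a word \<Rightarrow> 'a word \<Rightarrow> bool"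
  where "derive_step I K \<R> w w' \<longleftrightarrow>
    w' \<in> lists (gens I K) \<and>
    (\<exists>r \<in> \<R>. \<exists>a b u v. {a, b, u, v} \<subseteq> lists (gens I K) \<and>
       cyc_equiv K w (a @ u @ b) \<and> cyc_equiv K w' (a @ v @ b) \<and>
       cyc_equiv K r (u @ word_inv K v))"

definition derivable_within ::
  "root set \<Rightarrow> ('a, 'm) ring_scheme \<Rightarrow> 'a word set \<Rightarrow> nat \<Rightarrow> 'a word \<Rightarrow> bool"
  where "derivable_within I K \<R> N w \<longleftrightarrow> (\<exists>n \<le> N. (derive_step I K \<R> ^^ n) w [])"

end

theory Submission imports Defs begin

text \<open>
  Consider families of words whose letters have coefficients depending on the field \<open>K\<close>, the subfield
  \<open>F\<close>, the polynomial \<open>f\<close> and some parameters in \<open>K\<close>.  Two families are identified if they can be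
  transformed into each other by a number of derivation steps that is bounded uniformly in the
  index.  This gives a group, and an equation between two words in it is a family of derivations of
  uniformly bounded length.

  In this group the letters are additive in the coefficient and satisfy the commutator formula inside
  the rank two subgroups.  Lifts of eight short relations with integer coefficients give further
  identities, which are polynomial in the coefficients of the linear polynomials
  \<open>t\<^sub>0 + t\<^sub>1 x\<close>.  If each of these polynomials is a monomial, the lift is a Steinberg relation for
  certain degrees \<open>(i, j)\<close>; the missing degrees are the other terms of general lifts.  Since 2 is
  invertible, relations for squares can be polarized.  As all lengths of words are bounded and the
  coefficients are generic, the result is a finite list of uniform derivations.
\<close>

text \<open>The obstacle is \<alpha> + \<beta> + 2\<psi> in the large basis. The polynomial at
  \<psi> enters \<beta> + 2\<psi> squared, so monomials of degrees i, j, k at \<alpha>, \<beta>,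
  \<psi> give the commutator of \<alpha> in degree i with \<beta> + 2\<psi> in degree j + 2k, and
  show only that it depends on i + j and k. In degree 2 two candidates remain, \<open>(1, 1)\<close>
  and \<open>(0, 2)\<close>. A lift with 1 + x at \<psi> compares them, but expanding its
  commutators requires that \<beta> + 2\<psi> commutes with every candidate; this is won degree by
  degree from \<beta> + \<psi> and lifts with 1 + x and 1 - x. Afterwards \<alpha> + 2\<beta> +
  2\<psi> arises by conjugation with \<beta>, and \<alpha> + \<beta> + \<psi> from a lift equating
  its two presentations as a commutator. Derivations have no free cancellation: removing a symbol
  next to its inverse is itself a step. Uniform bounds on steps therefore need uniform bounds on
  lengths. Coefficients are elements of one type-class ring of families, so that ordinary
  simplification treats all fields and all parameters at once.\<close>

declare One_nat_def [simp del] One_nat_def [symmetric, simp] numeral_2_eq_2 [symmetric, simp]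

section \<open>Commutators in groups\<close>

text \<open>\<open>group_add\<close> does not assume commutativity: + is the product of an arbitrary
  group, and x + y - x is the conjugate of y by x.\<close>

definition cm :: "'g::group_add \<Rightarrow> 'g \<Rightarrow> bool"
  where "cm x y \<longleftrightarrow> x + y = y + x"

definition cmt :: "'g::group_add \<Rightarrow> 'g \<Rightarrow> 'g"
  where "cmt x y = x + y - x - y"

lemma cm_sym: "cm x y \<Longrightarrow> cm y x"
  by (simp add: cm_def)

lemma cm_zero [simp]: "cm x 0" "cm 0 x"
  by (simp_all add: cm_def)

lemma cm_iff: "cm x y \<longleftrightarrow> x + y - x = y"
  by (simp add: cm_def diff_eq_eq)

lemma conj_add: "x + (y + z) - x = (x + y - x) + (x + z - (x::'g::group_add))"
  by (simp add: diff_conv_add_uminus add.assoc del: add_uminus_conv_diff)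

lemma conj_uminus: "x + (- y) - x = - (x + y - (x::'g::group_add))"
  by (simp add: diff_conv_add_uminus add.assoc minus_add del: add_uminus_conv_diff)

lemma conj_cmt: "x + cmt y z - x = cmt (x + y - x) (x + z - (x::'g::group_add))"
  by (simp add: cmt_def diff_conv_add_uminus minus_add add.assoc del: add_uminus_conv_diff)

lemma cm_add_right: "cm x y \<Longrightarrow> cm x z \<Longrightarrow> cm x (y + z)" for x y z :: "'g::group_add"
  unfolding cm_iff conj_add by simp

lemma cm_add:
  "cm x y \<Longrightarrow> cm x z \<Longrightarrow> cm x (y + z)"
  "cm y x \<Longrightarrow> cm z x \<Longrightarrow> cm (y + z) x"
  using cm_add_right[of x y z] by (auto dest: cm_sym)

lemma cm_uminus_right: "cm x y \<Longrightarrow> cm x (- y)" for x y :: "'g::group_add"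
  unfolding cm_iff conj_uminus by simp

lemma cm_uminus [simp]: "cm x (- y) \<longleftrightarrow> cm x y" "cm (- x) y \<longleftrightarrow> cm x y"
  using cm_uminus_right[of x y] cm_uminus_right[of x "- y"] cm_uminus_right[of y x]
    cm_uminus_right[of y "- x"]
  by (auto dest: cm_sym)

lemma cm_diff: "cm x y \<Longrightarrow> cm x z \<Longrightarrow> cm x (y - z)"
  using cm_add(1)[of x y "- z"] by simp

lemma cm_cmt: "cm x y \<Longrightarrow> cm x z \<Longrightarrow> cm x (cmt y z)"
  unfolding cmt_def by (intro cm_diff cm_add)

lemma cm_add_iff:
  "cm x y \<Longrightarrow> cm x (y + z) \<longleftrightarrow> cm x z"
  "cm x z \<Longrightarrow> cm x (y + z) \<longleftrightarrow> cm x y"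
  "cm x y \<Longrightarrow> cm (x + z) y \<longleftrightarrow> cm z y"
  "cm z y \<Longrightarrow> cm (x + z) y \<longleftrightarrow> cm x y"
proof -
  show 1: "cm x y \<Longrightarrow> cm x (y + z) \<longleftrightarrow> cm x z" for x y z :: 'a
    using cm_add(1)[of x "- y" "y + z"] cm_add(1)[of x y z] by auto
  show 2: "cm x z \<Longrightarrow> cm x (y + z) \<longleftrightarrow> cm x y" for x y z :: 'a
    using cm_add(1)[of x "y + z" "- z"] cm_add(1)[of x y z] by auto
  show "cm x y \<Longrightarrow> cm (x + z) y \<longleftrightarrow> cm z y" "cm z y \<Longrightarrow> cm (x + z) y \<longleftrightarrow> cm x y"
    using 1[of y x z] 2[of y z x] by (auto dest: cm_sym)
qed

lemma cm_conj_iff: "cm x y \<Longrightarrow> cm x (y + z - y) \<longleftrightarrow> cm x z"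
  using cm_add_iff(1)[of x y "z - y"] cm_add_iff(2)[of x "- y" z] by (simp add: add_diff_eq)

lemma cmt_eq_0: "cmt x y = 0 \<longleftrightarrow> cm x y"
  by (simp add: cmt_def cm_def diff_eq_eq)

lemma cmt_0: "cm x y \<Longrightarrow> cmt x y = 0"
  by (simp add: cmt_eq_0)

lemma diff_uminus_add: "x - (- y + x) = (y::'g::group_add)"
  by (simp add: diff_conv_add_uminus minus_add del: add_uminus_conv_diff)

lemma cmt_swap: "cmt y x = - cmt x y"
  by (simp add: cmt_def diff_conv_add_uminus minus_add add.assoc del: add_uminus_conv_diff)

lemma cmt_zero [simp]: "cmt 0 x = 0" "cmt x 0 = 0"
  by (simp_all add: cmt_eq_0)

lemma cmt_add_left: "cmt (x + y) z = (x + cmt y z - x) + cmt x z"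
  by (simp add: cmt_def diff_conv_add_uminus minus_add add.assoc del: add_uminus_conv_diff)

lemma cmt_add_right: "cmt x (y + z) = cmt x y + (y + cmt x z - y)"
  by (simp add: cmt_def diff_conv_add_uminus minus_add add.assoc del: add_uminus_conv_diff)

lemma cm_conj: "cm x y \<Longrightarrow> x + y - x = y"
  by (simp add: cm_iff)

lemma cmt_conj: "cmt x y = x + y - x - y" "cmt x y = x - (y + x - y)"
  by (simp_all add: cmt_def diff_conv_add_uminus minus_add add.assoc del: add_uminus_conv_diff)

lemma conj_eq:
  "x + y - x = cmt x y + y" "y + x - y = - cmt x y + x"
  by (simp_all add: cmt_def diff_conv_add_uminus minus_add add.assoc del: add_uminus_conv_diff)

lemma additive_zero:
  fixes f :: "'r::comm_ring_1 \<Rightarrow> 'g::group_add"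
  assumes "\<And>p q. f (p + q) = f p + f q"
  shows "f 0 = 0"
  using assms[of 0 0] add_left_cancel[of "f 0" "f 0" 0] by simp

lemma additive_uminus:
  fixes f :: "'r::comm_ring_1 \<Rightarrow> 'g::group_add"
  assumes "\<And>p q. f (p + q) = f p + f q"
  shows "f (- p) = - f p"
  using assms[of "- p" p] additive_zero[of f, OF assms] by (simp add: eq_neg_iff_add_eq_0)

text \<open>Replacing p by p + 1 creates the cross terms f p with Y s and f 1 with Y (p * s). The
  latter commute by the hypothesis at 1, which isolates the former.\<close>

lemma polarize:
  fixes f Y :: "'r::comm_ring_1 \<Rightarrow> 'g::group_add"
  assumes f: "\<And>p q. f (p + q) = f p + f q" and Y: "\<And>p q. Y (p + q) = Y p + Y q"
    and "\<And>p s. cm (f p) (Y (p * s))"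
  shows "cm (f p) (Y s)"
proof -
  have "cm (f p + f 1) (Y (p * s) + Y s)"
    using assms(3)[of "p + 1" s] by (simp add: f Y distrib_right)
  moreover have 1: "cm (f 1) (Y q)" for q
    using assms(3)[of 1 q] by simp
  ultimately show ?thesis
    by (simp add: cm_add_iff 1 cm_add assms(3))
qed

text \<open>The substitution u = h s + 1 linearises the square: p (h s + 1)^2 = p (h s)^2 + p s + p,
  where the outer two terms are again of the form p u^2.\<close>

lemma polarize_sq:
  fixes f Y :: "'r::comm_ring_1 \<Rightarrow> 'g::group_add"
  assumes f: "\<And>p q. f (p + q) = f p + f q" and Y: "\<And>p q. Y (p + q) = Y p + Y q"
    and sq: "\<And>p u. cm (f p) (Y (p * u^2))" and half: "2 * h = (1::'r)"
  shows "cm (f p) (Y s)"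
proof (rule polarize[of f Y, OF f Y])
  fix p s
  have "p * (h * s + 1)^2 = p * (h * s)^2 + (p * s + p)"
  proof -
    have "p * (h * s + 1)^2 = p * (h * s)^2 + ((2 * h) * (p * s) + p)"
      by (simp add: power2_eq_square algebra_simps)
    then show ?thesis by (simp add: half)
  qed
  then have "cm (f p) (Y (p * (h * s)^2) + (Y (p * s) + Y p))"
    using sq[of p "h * s + 1"] by (simp add: Y)
  then show "cm (f p) (Y (p * s))"
    using sq[of p 1] sq[of p "h * s"] by (simp add: cm_add_iff)
qed

section \<open>Consequences of the lifted relations for the large basis\<close>

text \<open>\<open>lin\<close>, \<open>quad\<close> and \<open>cub\<close> are what a lift puts at a
  root of height 1, 2 and 3: one letter for each degree, in increasing order.\<close>

definition lin :: "(nat \<Rightarrow> 'r \<Rightarrow> 'g::group_add) \<Rightarrow> 'r \<Rightarrow> 'r \<Rightarrow> 'g"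
  where "lin f p q = f 0 p + f 1 q"

definition quad :: "(nat \<Rightarrow> 'r \<Rightarrow> 'g::group_add) \<Rightarrow> 'r \<Rightarrow> 'r \<Rightarrow> 'r \<Rightarrow> 'g"
  where "quad f p q r = f 0 p + f 1 q + f 2 r"

definition cub :: "(nat \<Rightarrow> 'r \<Rightarrow> 'g::group_add) \<Rightarrow> 'r \<Rightarrow> 'r \<Rightarrow> 'r \<Rightarrow> 'r \<Rightarrow> 'g"
  where "cub f p q r s = f 0 p + f 1 q + f 2 r + f 3 s"

lemma nat_le_simps:
  "(i::nat) \<le> 1 \<longleftrightarrow> i = 0 \<or> i = 1"
  "(i::nat) \<le> 2 \<longleftrightarrow> i = 0 \<or> i = 1 \<or> i = 2"
  "(i::nat) \<le> 3 \<longleftrightarrow> i = 0 \<or> i = 1 \<or> i = 2 \<or> i = 3"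
  "(i::nat) \<le> 4 \<longleftrightarrow> i = 0 \<or> i = 1 \<or> i = 2 \<or> i = 3 \<or> i = 4"
  "(i::nat) \<le> 5 \<longleftrightarrow> i = 0 \<or> i = 1 \<or> i = 2 \<or> i = 3 \<or> i = 4 \<or> i = 5"
  by auto

text \<open>
  The letters \<open>a\<close>, \<open>b\<close>, \<open>c\<close> belong to the simple roots $\alpha$, $\beta$, $\psi$ and \<open>ab\<close>, \<open>bcc\<close>, \dots to
  $\alpha+\beta$, $\beta+2\psi$, \dots; the index is the degree in $x$.  The last five assumptions are lifts of
  relations, where $t_0 + t_1 x$ is \<open>A0 + A1 x\<close> at $\alpha$, \<open>B0 + B1 x\<close> at $\beta$ and \<open>C0 + C1 x\<close> at $\psi$.
\<close>

locale large =
  fixes h :: "'r::comm_ring_1" and a b c ab bc bcc :: "nat \<Rightarrow> 'r \<Rightarrow> 'g::group_add"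
  assumes half: "2 * h = 1"
    and a_add: "a i (s + t) = a i s + a i t"
    and b_add: "b i (s + t) = b i s + b i t"
    and c_add: "c i (s + t) = c i s + c i t"
    and ab_add: "ab i (s + t) = ab i s + ab i t"
    and bc_add: "bc i (s + t) = bc i s + bc i t"
    and bcc_add: "bcc i (s + t) = bcc i s + bcc i t"
    and a_a: "cm (a i s) (a j t)"
    and b_b: "cm (b i s) (b j t)"
    and c_c: "cm (c i s) (c j t)"
    and ab_ab: "cm (ab i s) (ab j t)"
    and bc_bc: "cm (bc i s) (bc j t)"
    and bcc_bcc: "cm (bcc i s) (bcc j t)"
    and a_ab: "cm (a i s) (ab j t)"
    and b_ab: "cm (b i s) (ab j t)"
    and a_c: "cm (a i s) (c j t)"
    and b_bc: "cm (b i s) (bc j t)"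
    and b_bcc: "cm (b i s) (bcc j t)"
    and c_bcc: "cm (c i s) (bcc j t)"
    and bc_bcc: "cm (bc i s) (bcc j t)"
    and cmt_a_b: "i \<le> 1 \<Longrightarrow> j \<le> 1 \<Longrightarrow> cmt (a i s) (b j t) = ab (i + j) (s * t)"
    and cmt_b_c: "i \<le> 1 \<Longrightarrow> j \<le> 1 \<Longrightarrow>
      cmt (b i s) (c j t) = bc (i + j) (s * t) + bcc (i + 2 * j) (- (s * t\<^sup>2))"
    and cmt_bc_c: "i \<le> 2 \<Longrightarrow> j \<le> 1 \<Longrightarrow> cmt (bc i s) (c j t) = bcc (i + j) (2 * (s * t))"
    and lift_ab_bc: "cm (quad ab (A0 * B0) (A0 * B1 + A1 * B0) (A1 * B1))
      (quad bc (B0 * C0) (B0 * C1 + B1 * C0) (B1 * C1))"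
    and lift_ab_c: "cmt (quad ab (A0 * B0) (A0 * B1 + A1 * B0) (A1 * B1)) (lin c C0 C1)
      + cmt (quad ab (A0 * B0) (A0 * B1 + A1 * B0) (A1 * B1)) (- lin c C0 C1)
      = cmt (lin a A0 A1) (cub bcc (- (2 * (B0 * C0\<^sup>2)))
          (- (2 * (B1 * C0\<^sup>2 + 2 * (B0 * (C0 * C1)))))
          (- (2 * (2 * (B1 * (C0 * C1)) + B0 * C1\<^sup>2))) (- (2 * (B1 * C1\<^sup>2))))"
    and lift_bc_a_bcc: "cm (quad bc (B0 * C0) (B0 * C1 + B1 * C0) (B1 * C1))
      (cmt (lin a A0 A1) (cub bcc (B0 * C0\<^sup>2) (B1 * C0\<^sup>2 + 2 * (B0 * (C0 * C1)))
          (2 * (B1 * (C0 * C1)) + B0 * C1\<^sup>2) (B1 * C1\<^sup>2)))"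
    and lift_ab_a_bcc: "cm (quad ab (A0 * B0) (A0 * B1 + A1 * B0) (A1 * B1))
      (cmt (lin a A0 A1) (cub bcc (B0 * C0\<^sup>2) (B1 * C0\<^sup>2 + 2 * (B0 * (C0 * C1)))
          (2 * (B1 * (C0 * C1)) + B0 * C1\<^sup>2) (B1 * C1\<^sup>2)))"
    and lift_abc: "cmt (quad ab (A0 * B0) (A0 * B1 + A1 * B0) (A1 * B1)) (lin c C0 C1)
      + cmt (lin a A0 A1) (cub bcc (B0 * C0\<^sup>2) (B1 * C0\<^sup>2 + 2 * (B0 * (C0 * C1)))
          (2 * (B1 * (C0 * C1)) + B0 * C1\<^sup>2) (B1 * C1\<^sup>2))
      = cmt (lin a A0 A1) (quad bc (B0 * C0) (B0 * C1 + B1 * C0) (B1 * C1))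
      + cmt (quad ab (A0 * B0) (A0 * B1 + A1 * B0) (A1 * B1))
          (- cub bcc (B0 * C0\<^sup>2) (B1 * C0\<^sup>2 + 2 * (B0 * (C0 * C1)))
          (2 * (B1 * (C0 * C1)) + B0 * C1\<^sup>2) (B1 * C1\<^sup>2))"
begin

lemma half_mult: "2 * (h * x) = x" "h * (2 * x) = x"
  using half by (simp_all add: mult.assoc[symmetric] mult.commute[of h 2])

lemma half_ac: "s * (2 * (h * p)) = s * p" "(2 * s) * (h * p) = s * p" "h * (h * s) * (2 * p) = h * (s * p)"
  "h * s + h * s = s"
proof -
  have 1: "x * (2 * h) = x" for x using half by simp
  from 1[of "s * p"] show "s * (2 * (h * p)) = s * p" "(2 * s) * (h * p) = s * p"
    by (simp_all add: mult_ac)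
  from 1[of "h * (s * p)"] show "h * (h * s) * (2 * p) = h * (s * p)" by (simp add: mult_ac)
  from 1[of s] show "h * s + h * s = s" by (simp add: mult_ac flip: mult_2)
qed

lemma zeros [simp]: "a i 0 = 0" "b i 0 = 0" "c i 0 = 0" "ab i 0 = 0" "bc i 0 = 0" "bcc i 0 = 0"
  by (rule additive_zero, rule a_add b_add c_add ab_add bc_add bcc_add)+

lemma uminuses: "a i (- s) = - a i s" "b i (- s) = - b i s" "c i (- s) = - c i s"
  "ab i (- s) = - ab i s" "bc i (- s) = - bc i s" "bcc i (- s) = - bcc i s"
  by (rule additive_uminus, rule a_add b_add c_add ab_add bc_add bcc_add)+

lemmas forms = lin_def quad_def cub_def

lemmas basic = a_a b_b c_c ab_ab bc_bc bcc_bcc a_ab b_ab a_c b_bc b_bcc c_bcc bc_bcc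
lemmas basic_sym = basic[THEN cm_sym]

text \<open>The polynomial at \<beta> occurs in both roots, so monomials of degrees i, j, k reach
  exactly the pairs (i + j, j + k). Of all pairs up to 2, only (0, 2) and (2, 0) are
  missing.\<close>

lemma ab_bc_monomial: "cm (ab 0 s) (bc 0 t)" "cm (ab 0 s) (bc 1 t)" "cm (ab 1 s) (bc 0 t)"
  "cm (ab 1 s) (bc 1 t)" "cm (ab 1 s) (bc 2 t)" "cm (ab 2 s) (bc 1 t)" "cm (ab 2 s) (bc 2 t)"
  using lift_ab_bc[of s 1 0 0 t 0] lift_ab_bc[of s 1 0 0 0 t] lift_ab_bc[of 0 1 0 s t 0]
    lift_ab_bc[of 0 1 0 s 0 t] lift_ab_bc[of s 0 1 0 t 0] lift_ab_bc[of s 0 1 0 0 t]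
    lift_ab_bc[of 0 0 1 s t 0] lift_ab_bc[of 0 0 1 s 0 t]
  by (simp_all add: forms)

lemma ab_bc: "i \<le> 2 \<Longrightarrow> j \<le> 2 \<Longrightarrow> cm (ab i s) (bc j t)"
proof -
  \<comment> \<open>Here the polynomials are s, 1 + x and t x. Among the four pairs of terms, (0, 2)
    is the only one not reached by monomials.\<close>
  have "cm (ab 0 s) (bc 2 t)"
    using lift_ab_bc[of s 1 1 0 0 t] by (simp add: forms ab_bc_monomial cm_add_iff cm_add)
  moreover have "cm (ab 2 s) (bc 0 t)"
    using lift_ab_bc[of 0 1 1 s t 0] by (simp add: forms ab_bc_monomial cm_add_iff cm_add)
  ultimately show "i \<le> 2 \<Longrightarrow> j \<le> 2 \<Longrightarrow> cm (ab i s) (bc j t)"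
    by (auto simp: nat_le_simps ab_bc_monomial)
qed

section \<open>The root \<alpha> + \<beta> + 2\<psi> and its commutator presentations\<close>

definition W :: "nat \<Rightarrow> nat \<Rightarrow> 'r \<Rightarrow> 'g"
  where "W i k v = cmt (ab i (- (h * v))) (c k 1) + cmt (ab i (- (h * v))) (- c k 1)"

text \<open>The left side of \<open>lift_ab_c\<close> sees \<alpha> and \<beta> only through the
  product of their polynomials. In \<open>W\<close> the commutators with \<open>c k 1\<close> and
  its inverse cancel the factor at \<alpha> + \<beta> + \<psi> and double the one at \<alpha> +
  \<beta> + 2\<psi>; h undoes the doubling.\<close>

lemma a_bcc_W:
  assumes "i \<le> 1" "j \<le> 1" "k \<le> 1"
  shows "cmt (a i s) (bcc (j + 2 * k) t) = W (i + j) k (s * t)"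
proof -
  have 1: "s * - (h * t) = - (h * (s * t))" "- (h * t) * s = - (h * (s * t))"
    by (simp_all add: mult_ac)
  have 2: "- (2 * - (h * t)) = t"
    by (simp add: half_mult)
  show ?thesis
    using assms
      lift_ab_c[of "if i = 0 then s else 0" "if j = 0 then - (h * t) else 0"
        "if j = 0 then 0 else - (h * t)" "if i = 0 then 0 else s"
        "if k = 0 then 1 else 0" "if k = 0 then 0 else 1"]
    unfolding nat_le_simps
    by (elim disjE) (simp_all add: forms W_def 1 2 del: mult_minus_right mult_minus_left)
qed

text \<open>The commutator giving the root $\alpha+\beta+2\psi$; that it depends only on \<open>i + j\<close> is the main
  difficulty for the large basis.\<close>

definition D :: "nat \<Rightarrow> nat \<Rightarrow> 'r \<Rightarrow> 'g"
  where "D i j v = cmt (a i v) (bcc j 1)"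

lemma le3_cases: "j \<le> 3 \<Longrightarrow> \<exists>j'\<le>1. \<exists>k\<le>1. j = j' + 2 * (k::nat)"
  by (intro exI[of _ "j mod 2"] exI[of _ "j div 2"] conjI) auto

lemma cmt_a_bcc: "i \<le> 1 \<Longrightarrow> j \<le> 3 \<Longrightarrow> cmt (a i s) (bcc j t) = D i j (s * t)"
  using le3_cases[of j] by (auto simp: D_def a_bcc_W)

lemma D_W: "i \<le> 1 \<Longrightarrow> j \<le> 1 \<Longrightarrow> k \<le> 1 \<Longrightarrow> D i (j + 2 * k) v = W (i + j) k v"
  by (auto simp: D_def a_bcc_W)

text \<open>These are the coincidences with the same k in j + 2k. The remaining one,
  \<open>D 1 1 = D 0 2\<close>, has k = 0 on one side and k = 1 on the other, so that monomial lifts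
  do not give it.\<close>

lemma D_swap: "D 1 0 = D 0 1" "D 1 2 = D 0 3"
  using D_W[of 1 0 0] D_W[of 0 1 0] D_W[of 1 0 1] D_W[of 0 1 1] by (auto simp: fun_eq_iff)

lemma c_D: "cm (c k u) (D i j v)"
  unfolding D_def by (intro cm_cmt basic basic_sym)

text \<open>Although \<alpha> does not commute with \<beta> + 2\<psi>, it commutes with \<alpha> +
  \<beta> and \<psi>, from which the other presentation \<open>W\<close> is built.\<close>

lemma a_D: "i \<le> 1 \<Longrightarrow> j \<le> 3 \<Longrightarrow> cm (a k u) (D i j v)"
proof -
  have "cm (a k u) (W i' j' v)" for i' j'
    unfolding W_def by (intro cm_cmt cm_add_right basic basic_sym cm_uminus_right)
  then show "i \<le> 1 \<Longrightarrow> j \<le> 3 \<Longrightarrow> cm (a k u) (D i j v)"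
    using le3_cases[of j] by (auto simp: D_W)
qed

lemma D_add:
  assumes "i \<le> 1" "j \<le> 3"
  shows "D i j (s + t) = D i j s + D i j t"
proof -
  have "D i j (t + s) = D i j s + D i j t"
    unfolding D_def a_add cmt_add_left using a_D[OF assms] by (simp add: D_def cm_conj)
  then show ?thesis by (simp add: add.commute)
qed

text \<open>The monomial at \<beta> puts the same coefficient p on both sides of the lift;
  \<open>polarize\<close> makes the two coefficients independent.\<close>

lemma bc_D_monomial:
  assumes "i \<le> 1" "j \<le> 1" "k \<le> 1"
  shows "cm (bc (j + k) t) (D i (j + 2 * k) s)"
proof (rule polarize[of "bc (j + k)" "D i (j + 2 * k)"])
  have j: "j + 2 * k \<le> 3" using assms by simp
  show "D i (j + 2 * k) (p + q) = D i (j + 2 * k) p + D i (j + 2 * k) q" for p q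
    using assms(1) j by (rule D_add)
  show "cm (bc (j + k) p) (D i (j + 2 * k) (p * s))" for p s
    using assms lift_bc_a_bcc[of "if j = 0 then p else 0" "if k = 0 then 1 else 0"
        "if k = 0 then 0 else 1" "if j = 0 then 0 else p"
        "if i = 0 then s else 0" "if i = 0 then 0 else s"]
    unfolding nat_le_simps
    by (elim disjE) (simp_all add: forms cmt_a_bcc mult.commute)
qed (rule bc_add)

lemma bc_D_0:
  "cm (bc 0 t) (D 0 0 s)" "cm (bc 0 t) (D 0 1 s)"
  "cm (bc 1 t) (D 0 1 s)" "cm (bc 1 t) (D 0 2 s)" "cm (bc 1 t) (D 1 1 s)" "cm (bc 1 t) (D 0 3 s)"
  "cm (bc 2 t) (D 0 3 s)" "cm (bc 2 t) (D 1 3 s)"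
  using bc_D_monomial[of 0 0 0] bc_D_monomial[of 1 0 0] bc_D_monomial[of 0 1 0]
    bc_D_monomial[of 0 0 1] bc_D_monomial[of 1 1 0] bc_D_monomial[of 1 0 1]
    bc_D_monomial[of 0 1 1] bc_D_monomial[of 1 1 1]
  by (auto simp: D_swap)

text \<open>Since 2 is invertible, each letter of \<beta> + 2\<psi> is a commutator of \<beta> +
  \<psi> with \<psi>, and \<psi> commutes with \<open>D\<close>. All the work thus goes into \<beta>
  + \<psi>.\<close>

lemma bcc_D_if_bc_D:
  assumes "m \<le> 2" "n \<le> 1" "\<And>t. cm (bc m t) (D i j s)"
  shows "cm (bcc (m + n) t) (D i j s)"
proof -
  have "bcc (m + n) t = cmt (bc m (h * t)) (c n 1)"
    using cmt_bc_c[OF assms(1,2)] by (simp add: half_mult)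
  then show ?thesis
    by (auto intro!: cm_sym[OF cm_cmt] assms(3)[THEN cm_sym] c_D[THEN cm_sym])
qed

lemma bcc_D_0:
  "cm (bcc 0 t) (D 0 0 s)" "cm (bcc 1 t) (D 0 0 s)"
  "cm (bcc 0 t) (D 0 1 s)" "cm (bcc 1 t) (D 0 1 s)" "cm (bcc 2 t) (D 0 1 s)"
  "cm (bcc 1 t) (D 0 2 s)" "cm (bcc 2 t) (D 0 2 s)"
  "cm (bcc 1 t) (D 1 1 s)" "cm (bcc 2 t) (D 1 1 s)"
  "cm (bcc 1 t) (D 0 3 s)" "cm (bcc 2 t) (D 0 3 s)" "cm (bcc 3 t) (D 0 3 s)"
  "cm (bcc 2 t) (D 1 3 s)" "cm (bcc 3 t) (D 1 3 s)"
  using bcc_D_if_bc_D[of 0 0] bcc_D_if_bc_D[of 0 1] bcc_D_if_bc_D[of 1 0]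
    bcc_D_if_bc_D[of 1 1] bcc_D_if_bc_D[of 2 0] bcc_D_if_bc_D[of 2 1]
  by (simp_all add: bc_D_0)

lemma D_uminus: "i \<le> 1 \<Longrightarrow> j \<le> 3 \<Longrightarrow> D i j (- s) = - D i j s"
  using additive_uminus[of "D i j"] D_add by blast

lemma cm_sum_diff:
  assumes "cm (x + y) z" "cm (x - y) z" "cm x y"
  shows "cm (x + x) z" "cm (y + y) z"
proof -
  have "x + x = (x + y) + (x - y)"
    using assms(3) by (metis cm_def add.assoc add_diff_eq add_diff_cancel)
  then show "cm (x + x) z" using assms by (metis cm_add(2))
  have "y + y = - (x - y) + (x + y)"
    by (simp add: diff_conv_add_uminus minus_add add.assoc del: add_uminus_conv_diff)
  then show "cm (y + y) z" using assms by (metis cm_add(2) cm_uminus(2))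
qed

text \<open>The lift has s at \<alpha>, p at \<beta> and 1 + x or 1 - x at \<psi>; adding and
  subtracting the two signs separates \<open>bc 0\<close> from \<open>bc 1\<close>. As
  \<open>bcc 0\<close> is not yet known to commute with \<open>D 0 2\<close>, the expansion
  \<open>Z\<close> keeps a conjugate.\<close>

lemma bc_D_1: "cm (bc 0 t) (D 0 2 s)" "cm (bc 1 t) (D 0 0 s)"
proof -
  define Z where "Z p s = D 0 0 (s * p) + (bcc 0 p + D 0 2 (s * p) - bcc 0 p)" for p s
  have exp: "cmt (a 0 s) (bcc 0 p + bcc 1 q + bcc 2 p) = D 0 1 (s * q) + Z p s" for p q s
  proof -
    have "bcc 0 p + bcc 1 q + bcc 2 p = bcc 1 q + (bcc 0 p + bcc 2 p)"
      using bcc_bcc[of 0 p 1 q] by (simp add: cm_def add.assoc)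
    moreover have "cmt (a 0 s) (bcc 0 p + bcc 2 p) = Z p s"
      by (simp add: cmt_add_right cmt_a_bcc Z_def)
    moreover have "cm (bcc 1 q) (Z p s)"
      unfolding Z_def by (intro cm_add_right cm_diff bcc_D_0 bcc_bcc)
    ultimately show ?thesis by (simp add: cmt_add_right cmt_a_bcc cm_conj)
  qed
  have "cm (bc 0 p + bc 1 p) (D 0 1 (s * (2 * p)) + Z p s)" for p s
    using lift_bc_a_bcc[of p 1 1 0 s 0] by (simp add: forms exp mult.commute[of p 2])
  moreover have "cm (bc 0 p - bc 1 p) (D 0 1 (s * (- (2 * p))) + Z p s)" for p s
    using lift_bc_a_bcc[of p 1 "-1" 0 s 0] exp[of s p "- (2 * p)"] by (simp add: forms uminuses)
  ultimately have "cm (bc 0 p + bc 1 p) (Z p s)" "cm (bc 0 p - bc 1 p) (Z p s)" for p s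
    by (simp_all add: cm_add_iff cm_add bc_D_0 diff_conv_add_uminus del: add_uminus_conv_diff)
  from cm_sum_diff[OF this bc_bc] have Z: "cm (bc 0 (p + p)) (Z p s)" "cm (bc 1 (p + p)) (Z p s)" for p s
    unfolding bc_add .
  have 0: "cm (bc 0 t) (D 0 2 (s * (h * t)))" for t s
    using Z(1)[of "h * t" s] by (simp add: Z_def cm_add_iff bc_D_0 cm_conj_iff bc_bcc half_mult flip: mult_2)
  have 0: "cm (bc 0 p) (D 0 2 (p * s))" for p s
    using 0[of p "2 * s"] by (simp add: half_ac mult.commute[of p s])
  show "cm (bc 0 t) (D 0 2 s)"
    by (rule polarize[of "bc 0" "D 0 2"]) (use 0 in \<open>simp_all add: bc_add D_add\<close>)
  have 0: "cm (bc 1 t) (D 0 0 (s * (h * t)))" for t s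
    using Z(2)[of "h * t" s] by (simp add: Z_def cm_add_iff bc_D_0 cm_diff cm_add bc_bcc half_mult flip: mult_2)
  have 0: "cm (bc 1 p) (D 0 0 (p * s))" for p s
    using 0[of p "2 * s"] by (simp add: half_ac mult.commute[of p s])
  show "cm (bc 1 t) (D 0 0 s)"
    by (rule polarize[of "bc 1" "D 0 0"]) (use 0 in \<open>simp_all add: bc_add D_add\<close>)
qed

lemma bcc_02: "cm (bcc 0 t) (D 0 2 s)"
  using bcc_D_if_bc_D[of 0 0] by (simp add: bc_D_1)

text \<open>As in \<open>bc_D_1\<close>, but with s x at \<alpha>. Now \<open>bc 1\<close> commutes
  with all terms, so both signs give conditions on \<open>bc 0\<close> alone, and the two values of
  \<open>Z\<close> differ by an element of \<open>D 1 1\<close>.\<close>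

lemma bc_D_2: "cm (bc 0 t) (D 1 1 s)" "cm (bc 0 t) (D 0 3 s)"
proof -
  define Z where "Z q p s = D 0 3 (s * p) + D 1 1 (s * q)" for q p s
  have exp: "cmt (a 1 s) (bcc 0 p + bcc 1 q + bcc 2 p) = Z q p s + D 0 1 (s * p)" for p q s
  proof -
    have "bcc 0 p + bcc 1 q + bcc 2 p = bcc 2 p + (bcc 1 q + bcc 0 p)"
      using bcc_bcc[of 0 p 1 q] cm_add_right[OF bcc_bcc bcc_bcc, of 2 p 0 p 1 q] by (simp add: cm_def)
    then show ?thesis
      by (simp add: cmt_add_right cmt_a_bcc cm_conj cm_add bcc_D_0 D_swap Z_def add.assoc)
  qed
  have "cm (bc 0 p + bc 1 p) (Z (2 * p) p s + D 0 1 (s * p))" for p s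
    using lift_bc_a_bcc[of p 1 1 0 0 s] by (simp add: forms exp mult.commute[of p 2])
  moreover have "cm (bc 0 p - bc 1 p) (Z (- (2 * p)) p s + D 0 1 (s * p))" for p s
    using lift_bc_a_bcc[of p 1 "-1" 0 0 s] exp[of s p "- (2 * p)"] by (simp add: forms uminuses)
  moreover have "cm (bc 1 p) (Z q p s)" for p q s
    unfolding Z_def by (intro cm_add_right bc_D_0)
  ultimately have Z: "cm (bc 0 p) (Z (2 * p) p s)" "cm (bc 0 p) (Z (- (2 * p)) p s)" for p s
    by (simp_all add: cm_add_iff cm_add bc_D_0 diff_conv_add_uminus del: add_uminus_conv_diff)
  then have "cm (bc 0 p) (- Z (- (2 * p)) p s + Z (2 * p) p s)" for p s
    by (intro cm_add_right) simp_all
  moreover have "- Z (- (2 * p)) p s + Z (2 * p) p s = D 1 1 (s * (2 * p)) + D 1 1 (s * (2 * p))"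
    for p s
    by (simp add: Z_def D_uminus minus_add add.assoc diff_conv_add_uminus
        del: add_uminus_conv_diff)
  moreover have "D 1 1 (h * (h * s) * (2 * p)) + D 1 1 (h * (h * s) * (2 * p)) = D 1 1 (s * p)"
    for p s
    by (simp add: half_ac flip: D_add)
  ultimately have 0: "cm (bc 0 p) (D 1 1 (s * p))" for p s
    by metis
  have 11: "cm (bc 0 t) (D 1 1 s)" for t s
    by (rule polarize[of "bc 0" "D 1 1"]) (use 0 in \<open>simp_all add: bc_add D_add mult_ac\<close>)
  then show "cm (bc 0 t) (D 1 1 s)" .
  have 0: "cm (bc 0 p) (D 0 3 (s * p))" for p s
    using Z[of p s] by (simp add: Z_def cm_add_iff 11)
  show "cm (bc 0 t) (D 0 3 s)"
    by (rule polarize[of "bc 0" "D 0 3"]) (use 0 in \<open>simp_all add: bc_add D_add mult_ac\<close>)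
qed

text \<open>The mirror image of \<open>bc_D_1\<close> under reversal of degrees: i becomes 1 - i at
  \<alpha>, 2 - i at \<beta> + \<psi> and 3 - i at \<beta> + 2\<psi>.\<close>

lemma bc_D_1': "cm (bc 2 t) (D 1 1 s)" "cm (bc 1 t) (D 1 3 s)"
proof -
  define Z where "Z p s = D 1 3 (s * p) + (bcc 3 p + D 1 1 (s * p) - bcc 3 p)" for p s
  have exp: "cmt (a 1 s) (bcc 1 p + bcc 2 q + bcc 3 p) = D 0 3 (s * q) + Z p s" for p q s
  proof -
    have "bcc 1 p + bcc 2 q + bcc 3 p = bcc 2 q + (bcc 3 p + bcc 1 p)"
      using bcc_bcc[of 1 p 2 q] bcc_bcc[of 1 p 3 p] by (simp add: cm_def add.assoc)
    moreover have "cmt (a 1 s) (bcc 3 p + bcc 1 p) = Z p s"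
      by (simp add: cmt_add_right cmt_a_bcc Z_def)
    moreover have "cm (bcc 2 q) (Z p s)"
      unfolding Z_def by (intro cm_add_right cm_diff bcc_D_0 bcc_bcc)
    ultimately show ?thesis by (simp add: cmt_add_right cmt_a_bcc cm_conj D_swap)
  qed
  have "cm (bc 2 p + bc 1 p) (D 0 3 (s * (2 * p)) + Z p s)" for p s
    using lift_bc_a_bcc[of 0 1 1 p 0 s] bc_bc[of 1 p 2 p] by (simp add: forms exp cm_def)
  moreover have "cm (bc 2 p - bc 1 p) (D 0 3 (s * (- (2 * p))) + Z p s)" for p s
    using lift_bc_a_bcc[of 0 "-1" 1 p 0 s] exp[of s p "- (2 * p)"] bc_bc[of 1 "- p" 2 p]
    by (simp add: forms uminuses cm_def)
  ultimately have "cm (bc 2 p + bc 1 p) (Z p s)" "cm (bc 2 p - bc 1 p) (Z p s)" for p s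
    by (simp_all add: cm_add_iff cm_add bc_D_0 diff_conv_add_uminus del: add_uminus_conv_diff)
  from cm_sum_diff[OF this bc_bc] have Z: "cm (bc 2 (p + p)) (Z p s)" "cm (bc 1 (p + p)) (Z p s)" for p s
    unfolding bc_add .
  have 0: "cm (bc 2 t) (D 1 1 (s * (h * t)))" for t s
    using Z(1)[of "h * t" s] by (simp add: Z_def cm_add_iff bc_D_0 cm_conj_iff bc_bcc half_mult flip: mult_2)
  have 0: "cm (bc 2 p) (D 1 1 (p * s))" for p s
    using 0[of p "2 * s"] by (simp add: half_ac mult.commute[of p s])
  show "cm (bc 2 t) (D 1 1 s)"
    by (rule polarize[of "bc 2" "D 1 1"]) (use 0 in \<open>simp_all add: bc_add D_add\<close>)
  have 0: "cm (bc 1 t) (D 1 3 (s * (h * t)))" for t s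
    using Z(2)[of "h * t" s] by (simp add: Z_def cm_add_iff bc_D_0 cm_diff cm_add bc_bcc half_mult flip: mult_2)
  have 0: "cm (bc 1 p) (D 1 3 (p * s))" for p s
    using 0[of p "2 * s"] by (simp add: half_ac mult.commute[of p s])
  show "cm (bc 1 t) (D 1 3 s)"
    by (rule polarize[of "bc 1" "D 1 3"]) (use 0 in \<open>simp_all add: bc_add D_add\<close>)
qed

lemma bcc_11: "cm (bcc 3 t) (D 1 1 s)"
  using bcc_D_if_bc_D[of 2 1] by (simp add: bc_D_1')

text \<open>The mirror image of \<open>bc_D_2\<close>; the image \<open>D 1 0\<close> of
  \<open>D 0 3\<close> is \<open>D 0 1\<close>.\<close>

lemma bc_D_2': "cm (bc 2 t) (D 0 2 s)" "cm (bc 2 t) (D 0 1 s)"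
proof -
  define Z where "Z q p s = D 0 1 (s * p) + D 0 2 (s * q)" for q p s
  have exp: "cmt (a 0 s) (bcc 1 p + bcc 2 q + bcc 3 p) = Z q p s + D 0 3 (s * p)" for p q s
    by (simp add: cmt_add_right cmt_a_bcc cm_conj cm_add bcc_D_0 Z_def add.assoc)
  have "cm (bc 1 p + bc 2 p) (Z (2 * p) p s + D 0 3 (s * p))" for p s
    using lift_bc_a_bcc[of 0 1 1 p s 0] by (simp add: forms exp)
  moreover have "cm (- bc 1 p + bc 2 p) (Z (- (2 * p)) p s + D 0 3 (s * p))" for p s
    using lift_bc_a_bcc[of 0 "-1" 1 p s 0] exp[of s p "- (2 * p)"] by (simp add: forms uminuses)
  moreover have "cm (bc 1 p) (Z q p s)" for p q s
    unfolding Z_def by (intro cm_add_right bc_D_0)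
  ultimately have Z: "cm (bc 2 p) (Z (2 * p) p s)" "cm (bc 2 p) (Z (- (2 * p)) p s)" for p s
    by (simp_all add: cm_add_iff cm_add bc_D_0)
  then have "cm (bc 2 p) (- Z (- (2 * p)) p s + Z (2 * p) p s)" for p s
    by (intro cm_add_right) simp_all
  moreover have "- Z (- (2 * p)) p s + Z (2 * p) p s = D 0 2 (s * (2 * p)) + D 0 2 (s * (2 * p))"
    for p s
    by (simp add: Z_def D_uminus minus_add add.assoc diff_conv_add_uminus
        del: add_uminus_conv_diff)
  moreover have "D 0 2 (h * (h * s) * (2 * p)) + D 0 2 (h * (h * s) * (2 * p)) = D 0 2 (s * p)"
    for p s
    by (simp add: half_ac flip: D_add)
  ultimately have 0: "cm (bc 2 p) (D 0 2 (s * p))" for p s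
    by metis
  have 11: "cm (bc 2 t) (D 0 2 s)" for t s
    by (rule polarize[of "bc 2" "D 0 2"]) (use 0 in \<open>simp_all add: bc_add D_add mult_ac\<close>)
  then show "cm (bc 2 t) (D 0 2 s)" .
  have 0: "cm (bc 2 p) (D 0 1 (s * p))" for p s
    using Z[of p s] by (simp add: Z_def cm_add_iff 11)
  show "cm (bc 2 t) (D 0 1 s)"
    by (rule polarize[of "bc 2" "D 0 1"]) (use 0 in \<open>simp_all add: bc_add D_add mult_ac\<close>)
qed

lemmas bc_D_3 = bc_D_0 bc_D_1 bc_D_2 bc_D_1' bc_D_2'

lemma bcc_D_3: "cm (bcc 2 t) (D 0 0 s)" "cm (bcc 3 t) (D 0 1 s)" "cm (bcc 3 t) (D 0 2 s)"
  "cm (bcc 0 t) (D 1 1 s)" "cm (bcc 0 t) (D 0 3 s)" "cm (bcc 1 t) (D 1 3 s)"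
  using bcc_D_if_bc_D[of 0 0] bcc_D_if_bc_D[of 0 1] bcc_D_if_bc_D[of 1 0]
    bcc_D_if_bc_D[of 1 1] bcc_D_if_bc_D[of 2 0] bcc_D_if_bc_D[of 2 1]
  by (simp_all add: bc_D_3)

lemmas bcc_D_4 = bcc_D_0 bcc_02 bcc_11 bcc_D_3

text \<open>With 1 + x at \<psi> and p (1 + x) at \<beta> the lift contains p (1 + x)^2 and p (1 +
  x)^3. All pairs of terms are known to commute except the two at opposite ends.\<close>

lemma bc_D_4: "cm (bc 2 t) (D 0 0 s)" "cm (bc 0 t) (D 1 3 s)"
proof -
  have "cm (bc 0 p + bc 1 (2 * p) + bc 2 p)
    (D 0 0 (s * p) + (D 0 1 (s * (3 * p)) + D 0 2 (s * (3 * p)) + D 0 3 (s * p)))" for p s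
  proof -
    have "cmt (a 0 s) (bcc 0 p + (bcc 1 (3 * p) + bcc 2 (3 * p) + bcc 3 p))
      = D 0 0 (s * p) + (D 0 1 (s * (3 * p)) + D 0 2 (s * (3 * p)) + D 0 3 (s * p))"
      by (simp add: cmt_add_right cmt_a_bcc cm_conj cm_add bcc_D_4)
    then show ?thesis
      using lift_bc_a_bcc[of p 1 1 p s 0] by (simp add: forms add.assoc mult_2[symmetric])
  qed
  then have 0: "cm (bc 2 p) (D 0 0 (s * p))" for p s
    by (simp add: cm_add_iff cm_add bc_D_3)
  show "cm (bc 2 t) (D 0 0 s)"
    by (rule polarize[of "bc 2" "D 0 0"]) (use 0 in \<open>simp_all add: bc_add D_add mult_ac\<close>)
  have "cm (bc 0 p + bc 1 (2 * p) + bc 2 p)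
    (D 1 3 (s * p) + (D 0 1 (s * p) + D 1 1 (s * (3 * p)) + D 0 3 (s * (3 * p))))" for p s
  proof -
    have "cmt (a 1 s) (bcc 3 p + (bcc 0 p + bcc 1 (3 * p) + bcc 2 (3 * p)))
      = D 1 3 (s * p) + (D 0 1 (s * p) + D 1 1 (s * (3 * p)) + D 0 3 (s * (3 * p)))"
      by (simp add: cmt_add_right cmt_a_bcc cm_conj cm_add bcc_D_4 D_swap)
    moreover have "bcc 3 p + (bcc 0 p + bcc 1 (3 * p) + bcc 2 (3 * p))
      = bcc 0 p + bcc 1 (3 * p) + bcc 2 (3 * p) + bcc 3 p"
      using cm_add_right[OF cm_add_right[OF bcc_bcc bcc_bcc] bcc_bcc,
          of 3 p 0 p 1 "3 * p" 2 "3 * p"] by (simp add: cm_def)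
    ultimately show ?thesis
      using lift_bc_a_bcc[of p 1 1 p 0 s] by (simp add: forms add.assoc mult_2[symmetric])
  qed
  then have 0: "cm (bc 0 p) (D 1 3 (s * p))" for p s
    by (simp add: cm_add_iff cm_add bc_D_3)
  show "cm (bc 0 t) (D 1 3 s)"
    by (rule polarize[of "bc 0" "D 1 3"]) (use 0 in \<open>simp_all add: bc_add D_add mult_ac\<close>)
qed

lemma bcc_D_5: "cm (bcc 3 t) (D 0 0 s)" "cm (bcc 0 t) (D 1 3 s)"
  using bcc_D_if_bc_D[of 2 1] bcc_D_if_bc_D[of 0 0] by (simp_all add: bc_D_4)

text \<open>With 1 + x at \<psi>, the product t x of the polynomials at \<alpha> and \<beta> is
  factored as 1 times t x and as x times t. The left side of \<open>lift_ab_c\<close> is the same in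
  both cases. The right sides have equal terms in degrees 1 and 3, and in degree 2 they show
  \<open>D 0 2\<close> and \<open>D 1 1\<close>.\<close>

lemma D_11: "D 1 1 = D 0 2"
proof
  fix v
  have x: "cmt (a 0 1) (cub bcc 0 p q r) = D 0 1 p + D 0 2 q + D 0 3 r" for p q r
    by (simp add: forms cmt_add_right cmt_a_bcc cm_conj cm_add bcc_D_4)
  have y: "cmt (a 1 1) (cub bcc p q r 0) = D 0 1 p + D 1 1 q + D 0 3 r" for p q r
    by (simp add: forms cmt_add_right cmt_a_bcc cm_conj cm_add bcc_D_4 D_swap)
  have "cmt (lin a 1 0) (cub bcc 0 (- (2 * t)) (- (2 * (2 * t))) (- (2 * t)))
    = cmt (lin a 0 1) (cub bcc (- (2 * t)) (- (2 * (2 * t))) (- (2 * t)) 0)" for t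
    using lift_ab_c[of 1 0 t 0 1 1] lift_ab_c[of 0 t 0 1 1 1] by (simp add: mult_ac)
  then have "cmt (a 0 1) (cub bcc 0 (- (2 * t)) (- (2 * (2 * t))) (- (2 * t)))
    = cmt (a 1 1) (cub bcc (- (2 * t)) (- (2 * (2 * t))) (- (2 * t)) 0)" for t
    by (simp add: lin_def)
  \<comment> \<open>The middle coefficient is -4 t, so t is minus a quarter of v.\<close>
  from this[unfolded x y, of "- (h * (h * v))"] show "D 1 1 v = D 0 2 v"
    by (simp add: half_mult)
qed

lemma bc_D: "m \<le> 2 \<Longrightarrow> i \<le> 1 \<Longrightarrow> j \<le> 3 \<Longrightarrow> cm (bc m t) (D i j s)"
  by (auto simp: nat_le_simps bc_D_3 bc_D_4 D_swap D_11)

lemma bcc_D: "m \<le> 3 \<Longrightarrow> i \<le> 1 \<Longrightarrow> j \<le> 3 \<Longrightarrow> cm (bcc m t) (D i j s)"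
  by (auto simp: nat_le_simps bcc_D_4 bcc_D_5 D_swap D_11)

text \<open>Truncated subtraction splits d as (d - 3) + min d 3: \<alpha> stays in degree 0 as long
  as \<beta> + 2\<psi> can carry the whole degree.\<close>

definition abcc :: "nat \<Rightarrow> 'r \<Rightarrow> 'g"
  where "abcc d v = cmt (a (d - 3) v) (bcc (min d 3) 1)"

lemma D_abcc: "i \<le> 1 \<Longrightarrow> j \<le> 3 \<Longrightarrow> D i j = abcc (i + j)"
  by (auto simp: nat_le_simps abcc_def D_swap D_11 fun_eq_iff simp flip: D_def)

lemma abcc_D: "d \<le> 4 \<Longrightarrow> \<exists>i\<le>1. \<exists>j\<le>3. abcc d = D i j"
  by (intro exI[of _ "d - 3"] exI[of _ "min d 3"] conjI) (auto simp: D_def abcc_def fun_eq_iff)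

lemma cmt_a_bcc_abcc:
  "i \<le> 1 \<Longrightarrow> j \<le> 3 \<Longrightarrow> cmt (a i s) (bcc j t) = abcc (i + j) (s * t)"
  by (simp add: cmt_a_bcc D_abcc)

lemma abcc_add: "d \<le> 4 \<Longrightarrow> abcc d (s + t) = abcc d s + abcc d t"
  using abcc_D[of d] by (auto simp: D_add)

lemma abcc_zero [simp]: "abcc d 0 = 0"
  by (simp add: abcc_def)

lemma abcc_uminus: "d \<le> 4 \<Longrightarrow> abcc d (- s) = - abcc d s"
  using additive_uminus[of "abcc d"] abcc_add by blast

lemma a_abcc: "d \<le> 4 \<Longrightarrow> cm (a i s) (abcc d t)"
  and c_abcc: "d \<le> 4 \<Longrightarrow> cm (c k s) (abcc d t)"
  and bc_abcc: "m \<le> 2 \<Longrightarrow> d \<le> 4 \<Longrightarrow> cm (bc m s) (abcc d t)"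
  and bcc_abcc: "n \<le> 3 \<Longrightarrow> d \<le> 4 \<Longrightarrow> cm (bcc n s) (abcc d t)"
  using abcc_D[of d] by (auto simp: a_D c_D bc_D bcc_D)

lemma abcc_abcc: "d \<le> 4 \<Longrightarrow> e \<le> 4 \<Longrightarrow> cm (abcc d s) (abcc e t)"
proof -
  assume "d \<le> 4" "e \<le> 4"
  then have "cm (abcc e t) (abcc d s)"
    unfolding abcc_def[of d] by (intro cm_cmt a_abcc[THEN cm_sym] bcc_abcc[THEN cm_sym]) auto
  then show ?thesis by (rule cm_sym)
qed

lemma cmt_lin_cub:
  "cmt (lin a p0 p1) (cub bcc q0 q1 q2 q3)
    = abcc 0 (p0 * q0) + abcc 1 (p1 * q0 + p0 * q1) + abcc 2 (p1 * q1 + p0 * q2)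
      + abcc 3 (p1 * q2 + p0 * q3) + abcc 4 (p1 * q3)"
proof -
  have sw: "abcc i s + (abcc j t + x) = abcc j t + (abcc i s + x)"
    "abcc i s + abcc j t = abcc j t + abcc i s" if "i \<le> 4" "j \<le> 4" for i j s t x
    using abcc_abcc[OF that, of s t] by (simp_all add: cm_def flip: add.assoc)
  have "cmt (a i p) (cub bcc q0 q1 q2 q3) = abcc i (p * q0) + abcc (i + 1) (p * q1)
    + abcc (i + 2) (p * q2) + abcc (i + 3) (p * q3)" if "i \<le> 1" for i p
    using that by (auto simp: nat_le_simps cub_def cmt_add_right cmt_a_bcc_abcc cm_conj cm_add bcc_abcc add.assoc)
  then show ?thesis
    by (simp add: lin_def cmt_add_left cm_conj cm_add a_abcc abcc_add add.assoc
        sw[of 1 0] sw[of 2 0] sw[of 3 0] sw[of 4 0] sw[of 2 1] sw[of 3 1] sw[of 4 1]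
        sw[of 3 2] sw[of 4 2] sw[of 4 3])
qed

section \<open>Commutation of \<alpha> + \<beta> with \<alpha> + \<beta> + 2\<psi>\<close>

lemmas lift_ab_abcc = lift_ab_a_bcc[unfolded cmt_lin_cub]

lemma ab_abcc_sq:
  assumes "i \<le> 2" "d \<le> 4" "\<And>p u. cm (ab i p) (abcc d (p * u\<^sup>2))"
  shows "cm (ab i s) (abcc d t)"
  by (rule polarize_sq[of "ab i" "abcc d", OF _ _ _ half]) (use assms in \<open>simp_all add: ab_add abcc_add\<close>)

lemma ab_abcc_sq2:
  assumes "i \<le> 2" "d \<le> 4" "\<And>p u. cm (ab i p) (abcc d (2 * (p * u\<^sup>2)))"
  shows "cm (ab i s) (abcc d t)"
proof -
  have "cm (ab i s) (abcc d (2 * (h * t)))" for s t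
    by (rule polarize_sq[of "ab i" "\<lambda>x. abcc d (2 * x)", OF _ _ _ half])
      (use assms in \<open>simp_all add: ab_add abcc_add distrib_left\<close>)
  then show ?thesis by (simp add: half_mult)
qed

text \<open>A monomial at \<psi> contributes an even degree and a square, so these lifts reach
  degrees that differ by 0 or 2, with the coefficients p and p u^2.\<close>

lemma ab_abcc_0: "cm (ab 0 s) (abcc 0 t)" "cm (ab 0 s) (abcc 2 t)" "cm (ab 1 s) (abcc 1 t)"
  "cm (ab 1 s) (abcc 3 t)" "cm (ab 2 s) (abcc 2 t)" "cm (ab 2 s) (abcc 4 t)"
proof -
  have "cm (ab 0 p) (abcc 0 (p * u\<^sup>2))" "cm (ab 0 p) (abcc 2 (p * u\<^sup>2))"
    "cm (ab 1 p) (abcc 1 (p * u\<^sup>2))" "cm (ab 1 p) (abcc 3 (p * u\<^sup>2))"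
    "cm (ab 2 p) (abcc 2 (p * u\<^sup>2))" "cm (ab 2 p) (abcc 4 (p * u\<^sup>2))" for p u
    using lift_ab_abcc[of p 1 0 0 u 0] lift_ab_abcc[of p 1 0 0 0 u]
      lift_ab_abcc[of p 0 1 0 u 0] lift_ab_abcc[of p 0 1 0 0 u]
      lift_ab_abcc[of 0 0 1 p u 0] lift_ab_abcc[of 0 0 1 p 0 u] by (simp_all add: forms)
  from this[THEN ab_abcc_sq[rotated 2]] show "cm (ab 0 s) (abcc 0 t)" "cm (ab 0 s) (abcc 2 t)"
    "cm (ab 1 s) (abcc 1 t)" "cm (ab 1 s) (abcc 3 t)" "cm (ab 2 s) (abcc 2 t)" "cm (ab 2 s) (abcc 4 t)"
    by simp_all
qed

text \<open>For u (1 + x) at \<psi> the middle term 2 u^2 of the square reaches the difference 1;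
  the outer terms are already covered.\<close>

lemma ab_abcc_1: "cm (ab 0 s) (abcc 1 t)" "cm (ab 1 s) (abcc 2 t)" "cm (ab 2 s) (abcc 3 t)"
proof -
  have "p * (2 * (u * u)) = 2 * (p * u\<^sup>2)" for p u :: 'r
    by (simp add: power2_eq_square mult_ac)
  then have "cm (ab 0 p) (abcc 1 (2 * (p * u\<^sup>2)))" "cm (ab 1 p) (abcc 2 (2 * (p * u\<^sup>2)))"
    "cm (ab 2 p) (abcc 3 (2 * (p * u\<^sup>2)))" for p u
    using lift_ab_abcc[of p 1 0 0 u u] lift_ab_abcc[of p 0 1 0 u u] lift_ab_abcc[of 0 0 1 p u u]
    by (simp_all add: forms cm_add_iff ab_abcc_0)
  from this[THEN ab_abcc_sq2[rotated 2]] show "cm (ab 0 s) (abcc 1 t)" "cm (ab 1 s) (abcc 2 t)"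
    "cm (ab 2 s) (abcc 3 t)"
    by simp_all
qed

text \<open>With p (1 + x) at \<alpha> both roots receive two consecutive degrees, and only one of
  the four pairs is new.\<close>

lemma ab_abcc_2: "cm (ab 1 s) (abcc 0 t)" "cm (ab 0 s) (abcc 3 t)" "cm (ab 2 s) (abcc 1 t)"
  "cm (ab 1 s) (abcc 4 t)"
proof -
  have "cm (ab 1 p) (abcc 0 (p * u\<^sup>2))" "cm (ab 0 p) (abcc 3 (p * u\<^sup>2))"
    "cm (ab 2 p) (abcc 1 (p * u\<^sup>2))" "cm (ab 1 p) (abcc 4 (p * u\<^sup>2))" for p u
    using lift_ab_abcc[of p 1 0 p u 0] lift_ab_abcc[of p 1 0 p 0 u]
      lift_ab_abcc[of p 0 1 p u 0] lift_ab_abcc[of p 0 1 p 0 u]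
    by (simp_all add: forms cm_add_iff cm_add ab_abcc_0 ab_abcc_1)
  from this[THEN ab_abcc_sq[rotated 2]] show "cm (ab 1 s) (abcc 0 t)" "cm (ab 0 s) (abcc 3 t)"
    "cm (ab 2 s) (abcc 1 t)" "cm (ab 1 s) (abcc 4 t)"
    by simp_all
qed

text \<open>The product p (1 + x) (1 - x) has no term in the middle degree, which leaves one new
  pair, at distance 2 or 4.\<close>

lemma ab_abcc_3: "cm (ab 2 s) (abcc 0 t)" "cm (ab 0 s) (abcc 4 t)"
proof -
  have "cm (ab 2 p) (abcc 0 (p * u\<^sup>2))" "cm (ab 0 p) (abcc 4 (p * u\<^sup>2))" for p u
    using lift_ab_abcc[of p 1 "-1" p u 0] lift_ab_abcc[of p 1 "-1" p 0 u]
    by (simp_all add: forms uminuses abcc_uminus diff_conv_add_uminus cm_add_iff cm_add ab_abcc_0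
        del: add_uminus_conv_diff)
  from this[THEN ab_abcc_sq[rotated 2]] show "cm (ab 2 s) (abcc 0 t)" "cm (ab 0 s) (abcc 4 t)"
    by simp_all
qed

lemma ab_abcc: "i \<le> 2 \<Longrightarrow> d \<le> 4 \<Longrightarrow> cm (ab i s) (abcc d t)"
  by (auto simp: nat_le_simps ab_abcc_0 ab_abcc_1 ab_abcc_2 ab_abcc_3)

section \<open>The root \<alpha> + 2\<beta> + 2\<psi>\<close>

lemma conj_b_a: "i \<le> 1 \<Longrightarrow> m \<le> 1 \<Longrightarrow> b m r + a i s - b m r = ab (i + m) (- (r * s)) + a i s"
  by (simp add: conj_eq(2) cmt_a_b uminuses mult.commute)

text \<open>Conjugation by \<beta> fixes \<beta> + 2\<psi> and multiplies \<alpha> by a letter of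
  \<alpha> + \<beta>; it is applied to \<alpha> + \<beta> + 2\<psi> written as the commutator of
  \<alpha> and \<beta> + 2\<psi>.\<close>

lemma cmt_b_abcc_0:
  assumes "i \<le> 1" "j \<le> 3" "m \<le> 1"
  shows "cmt (b m r) (abcc (i + j) (s * t)) = cmt (ab (i + m) (- (r * s))) (bcc j t)"
proof -
  let ?D = "abcc (i + j) (s * t)" and ?y = "ab (i + m) (- (r * s))"
  have D: "?D = cmt (a i s) (bcc j t)"
    using cmt_a_bcc_abcc[OF assms(1,2)] by simp
  have y: "cm ?y ?D" "cm ?D (cmt ?y (bcc j t))"
    using assms by (auto intro!: cm_cmt ab_abcc cm_sym[OF ab_abcc] cm_sym[OF bcc_abcc])
  have "b m r + ?D - b m r = cmt (b m r + a i s - b m r) (b m r + bcc j t - b m r)"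
    unfolding D conj_cmt ..
  also have "\<dots> = cmt (?y + a i s) (bcc j t)"
    using assms by (simp add: conj_b_a cm_conj[OF b_bcc])
  also have "\<dots> = ?D + cmt ?y (bcc j t)"
    unfolding cmt_add_left D[symmetric] cm_conj[OF y(1)] ..
  also have "\<dots> = cmt ?y (bcc j t) + ?D"
    using y(2) by (simp add: cm_def)
  finally show ?thesis
    by (simp add: cmt_conj(1))
qed

text \<open>The argument -1 compensates the structure constant -1 of \<alpha> + \<beta> and \<beta>
  + 2\<psi>.\<close>

definition abbcc :: "nat \<Rightarrow> 'r \<Rightarrow> 'g"
  where "abbcc d v = cmt (ab (d - 3) v) (bcc (min d 3) (- 1))"

definition V :: "nat \<Rightarrow> nat \<Rightarrow> 'r \<Rightarrow> 'g"
  where "V m e v = cmt (b m 1) (abcc e v)"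

lemma cmt_ab_bcc_V:
  "m \<le> 1 \<Longrightarrow> i \<le> 1 \<Longrightarrow> j \<le> 3 \<Longrightarrow> cmt (ab (i + m) p) (bcc j t) = V m (i + j) (- (p * t))"
  using cmt_b_abcc_0[of i j m 1 "- p" t] by (simp add: V_def)

lemma abbcc_V: "abbcc 0 = V 0 0" "abbcc 1 = V 0 1" "abbcc 2 = V 0 2" "abbcc 3 = V 0 3"
  "abbcc 4 = V 0 4" "abbcc 5 = V 1 4"
  using cmt_ab_bcc_V[of 0 0 0 _ "- 1"] cmt_ab_bcc_V[of 0 0 1 _ "- 1"] cmt_ab_bcc_V[of 0 0 2 _ "- 1"]
    cmt_ab_bcc_V[of 0 0 3 _ "- 1"] cmt_ab_bcc_V[of 0 1 3 _ "- 1"] cmt_ab_bcc_V[of 1 1 3 _ "- 1"]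
  by (simp_all add: abbcc_def fun_eq_iff)

text \<open>Degree 1 at \<alpha> + \<beta> can come from \<alpha> or from \<beta>, so a factor x
  moves freely between \<beta> and \<alpha> + \<beta> + 2\<psi>. Unlike for \<alpha> + \<beta> +
  2\<psi>, this suffices to make only the total degree matter.\<close>

lemma V_shift: "j \<le> 3 \<Longrightarrow> V 1 j = V 0 (1 + j)"
proof
  show "V 1 j v = V 0 (1 + j) v" if "j \<le> 3" for v
    using cmt_ab_bcc_V[of 1 0 j v "- 1"] cmt_ab_bcc_V[of 0 1 j v "- 1"] that by simp
qed

lemma V_abbcc: "m \<le> 1 \<Longrightarrow> e \<le> 4 \<Longrightarrow> V m e = abbcc (m + e)"
  using V_shift[of 0] V_shift[of 1] V_shift[of 2] V_shift[of 3]
  by (auto simp: nat_le_simps abbcc_V)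

lemma cmt_ab_bcc:
  "n \<le> 2 \<Longrightarrow> j \<le> 3 \<Longrightarrow> cmt (ab n p) (bcc j t) = abbcc (n + j) (- (p * t))"
  using cmt_ab_bcc_V[of 0 n j p t] cmt_ab_bcc_V[of 1 1 j p t]
  by (cases "n = 2") (auto simp: V_abbcc simp flip: add.assoc)

lemma cmt_b_abcc:
  assumes "m \<le> 1" "e \<le> 4"
  shows "cmt (b m r) (abcc e v) = abbcc (m + e) (r * v)"
proof -
  have "cmt (b m r) (abcc (i + j) v) = abbcc (m + (i + j)) (r * v)" if "i \<le> 1" "j \<le> 3" for i j
    using cmt_b_abcc_0[OF that assms(1), of r 1 v] that assms(1)
    by (simp add: cmt_ab_bcc add_ac)
  from this[of "e - 3" "min e 3"] show ?thesis
    using assms(2) by (cases "e \<le> 3") (auto simp: min_def)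
qed

lemma abbcc_eq:
  assumes "d \<le> 5"
  obtains n j where "n \<le> 2" "j \<le> 3" "abbcc d t = cmt (ab n t) (bcc j (- 1))"
  using assms by (intro that[of "d - 3" "min d 3"]) (auto simp: abbcc_def)

lemma abbcc_eq':
  assumes "d \<le> 5"
  obtains m e where "m \<le> 1" "e \<le> 4" "abbcc d t = cmt (b m 1) (abcc e t)"
proof -
  have "d - 4 \<le> 1" "min d 4 \<le> 4" "abbcc d = V (d - 4) (min d 4)"
    using assms by (auto simp: nat_le_simps abbcc_V)
  then show ?thesis using that[of "d - 4" "min d 4"] by (simp add: V_def)
qed

lemma abcc_abbcc: "d \<le> 5 \<Longrightarrow> e \<le> 4 \<Longrightarrow> cm (abcc e s) (abbcc d t)"
  by (erule abbcc_eq[of d t]) (auto intro!: cm_cmt cm_sym[OF ab_abcc] cm_sym[OF bcc_abcc])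

lemma b_abbcc: "d \<le> 5 \<Longrightarrow> cm (b m s) (abbcc d t)"
  by (erule abbcc_eq[of d t]) (auto intro!: cm_cmt b_ab b_bcc)

lemma bc_abbcc: "d \<le> 5 \<Longrightarrow> m \<le> 2 \<Longrightarrow> cm (bc m s) (abbcc d t)"
  by (erule abbcc_eq[of d t]) (auto intro!: cm_cmt cm_sym[OF ab_bc] bc_bcc)

lemma bcc_abbcc: "d \<le> 5 \<Longrightarrow> m \<le> 3 \<Longrightarrow> cm (bcc m s) (abbcc d t)"
  by (erule abbcc_eq'[of d t]) (auto intro!: cm_cmt cm_sym[OF b_bcc] bcc_abcc)

text \<open>This argument recurs below: a presentation as a commutator is conjugated, each factor
  changes by letters already under control, and those letters drop out of the commutator.\<close>

lemma a_abbcc: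
  assumes "d \<le> 5" "m \<le> 1"
  shows "cm (a m s) (abbcc d t)"
proof -
  obtain n j where nj: "n \<le> 2" "j \<le> 3" "abbcc d t = cmt (ab n t) (bcc j (- 1))"
    using abbcc_eq[OF assms(1)] .
  let ?D = "abcc (m + j) (s * (- 1))"
  have D: "cm (ab n t) ?D" "cm ?D (abbcc d t)"
    using assms nj(1,2) by (auto intro!: ab_abcc abcc_abbcc)
  have "a m s + abbcc d t - a m s = cmt (a m s + ab n t - a m s) (a m s + bcc j (- 1) - a m s)"
    unfolding nj(3) conj_cmt ..
  also have "\<dots> = cmt (ab n t) (?D + bcc j (- 1))"
    using assms nj cm_conj[OF a_ab] by (simp add: conj_eq(1)[of "a m s" "bcc j _"] cmt_a_bcc_abcc)
  also have "\<dots> = abbcc d t"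
    using D by (simp add: cmt_add_right cm_conj flip: nj(3) cmt_eq_0)
  finally show ?thesis by (simp add: cm_iff)
qed

lemma ab_abbcc:
  assumes "d \<le> 5" "n \<le> 2"
  shows "cm (ab n s) (abbcc d t)"
proof -
  have "ab n s = cmt (a (n - 1) s) (b (min n 1) 1)"
    using assms(2) cmt_a_b[of "n - 1" "min n 1" s 1] by (auto simp: nat_le_simps)
  then show ?thesis
    using assms by (auto intro!: cm_sym[OF cm_cmt] cm_sym[OF a_abbcc] cm_sym[OF b_abbcc])
qed

text \<open>The presentation by \<beta> and \<alpha> + \<beta> + 2\<psi> is used, because \<psi>
  fixes the second factor and changes the first only by letters of \<beta> + \<psi> and \<beta> +
  2\<psi>.\<close>

lemma c_abbcc:
  assumes "d \<le> 5" "k \<le> 1"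
  shows "cm (c k s) (abbcc d t)"
proof -
  obtain m e where me: "m \<le> 1" "e \<le> 4" "abbcc d t = cmt (b m 1) (abcc e t)"
    using abbcc_eq'[OF assms(1)] .
  define y where "y = - cmt (b m 1) (c k s)"
  have y: "cm y (abbcc d t)" "cm y (abcc e t)"
    using me(1,2) assms unfolding y_def by (auto simp: cmt_b_c intro!: cm_add bc_abbcc bcc_abbcc bc_abcc bcc_abcc)
  have "c k s + abbcc d t - c k s = cmt (c k s + b m 1 - c k s) (c k s + abcc e t - c k s)"
    unfolding me(3) conj_cmt ..
  also have "\<dots> = cmt (y + b m 1) (abcc e t)"
    using me by (simp add: conj_eq(2)[of _ "b m 1"] y_def cm_conj c_abcc)
  also have "\<dots> = abbcc d t"
    using y by (simp add: cmt_add_left cm_conj flip: me(3) cmt_eq_0)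
  finally show ?thesis by (simp add: cm_iff)
qed

lemma abbcc_abbcc: "d \<le> 5 \<Longrightarrow> e \<le> 5 \<Longrightarrow> cm (abbcc e s) (abbcc d t)"
  by (erule abbcc_eq[of d t]) (auto intro!: cm_cmt cm_sym[OF ab_abbcc] cm_sym[OF bcc_abbcc])

lemma abbcc_add:
  assumes "d \<le> 5"
  shows "abbcc d (s + t) = abbcc d s + abbcc d t"
proof -
  have "abbcc d (t + s) = abbcc d s + abbcc d t"
    using cm_conj[OF ab_abbcc[OF assms, of "d - 3" t s]] assms
    unfolding abbcc_def by (simp add: ab_add cmt_add_left)
  then show ?thesis by (simp add: add.commute)
qed

lemma abbcc_uminus: "d \<le> 5 \<Longrightarrow> abbcc d (- s) = - abbcc d s"
  using additive_uminus[of "abbcc d"] abbcc_add by blast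

section \<open>The root \<alpha> + \<beta> + \<psi>\<close>

definition abc :: "nat \<Rightarrow> 'r \<Rightarrow> 'g"
  where "abc d v = cmt (ab (min d 2) v) (c (d - 2) 1) + abcc (min d 2 + 2 * (d - 2)) v"

text \<open>\<open>P\<close> and \<open>Q\<close> present \<alpha> + \<beta> + \<psi> as (\<alpha> +
  \<beta>) + \<psi> and as \<alpha> + (\<beta> + \<psi>). The second summand cancels the long root
  that the commutator formula adds.\<close>

definition P :: "nat \<Rightarrow> nat \<Rightarrow> 'r \<Rightarrow> 'r \<Rightarrow> 'g"
  where "P n k p u = cmt (ab n p) (c k u) + abcc (n + 2 * k) (p * u\<^sup>2)"

definition Q :: "nat \<Rightarrow> nat \<Rightarrow> 'r \<Rightarrow> 'r \<Rightarrow> 'g"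
  where "Q m n s v = cmt (a m s) (bc n v) + abbcc (m + 2 * n) (s * v\<^sup>2)"

text \<open>The monomial cases of \<open>lift_abc\<close>. Regrouping s, t, u in this way is what
  lets coefficients and degrees travel between the factors.\<close>

lemma P_Q:
  assumes "i \<le> 1" "j \<le> 1" "k \<le> 1"
  shows "P (i + j) k (s * t) u = Q i (j + k) s (t * u)"
proof -
  have "s * t * - (t * u\<^sup>2) = - (s * (t * u)\<^sup>2)"
    by (simp add: power2_eq_square mult_ac)
  then have "cmt (ab (i + j) (s * t)) (bcc (j + 2 * k) (- (t * u\<^sup>2)))
    = abbcc (i + 2 * (j + k)) (s * (t * u)\<^sup>2)"
    using assms by (simp add: cmt_ab_bcc add_ac)
  then show ?thesis
    using assms
      lift_abc[of "if i = 0 then s else 0" "if j = 0 then t else 0"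
        "if j = 0 then 0 else t" "if i = 0 then 0 else s"
        "if k = 0 then u else 0" "if k = 0 then 0 else u"]
    unfolding nat_le_simps P_def Q_def
    by (elim disjE) (simp_all add: forms cmt_a_bcc_abcc uminuses mult.assoc)
qed

lemma P_1: "i \<le> 1 \<Longrightarrow> j \<le> 1 \<Longrightarrow> k \<le> 1 \<Longrightarrow> P (i + j) k p u = P (i + j) k (p * u) 1"
  using P_Q[of i j k 1 p u] P_Q[of i j k 1 "p * u" 1] by simp

lemma Q_P_1: "i \<le> 1 \<Longrightarrow> j \<le> 1 \<Longrightarrow> k \<le> 1 \<Longrightarrow> Q i (j + k) s v = P (i + j) k (s * v) 1"
  using P_Q[of i j k s v 1] by simp

text \<open>\<open>Q\<close> sees j and k only through j + k, so a factor x may move from \<beta> to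
  \<psi>.\<close>

lemma P_shift: "P 1 0 v 1 = P 0 1 v 1" "P 2 0 v 1 = P 1 1 v 1"
  using Q_P_1[of 0 1 0 1 v] Q_P_1[of 0 0 1 1 v] Q_P_1[of 1 1 0 1 v] Q_P_1[of 1 0 1 1 v]
  by simp_all

lemma P_abc: "n \<le> 2 \<Longrightarrow> k \<le> 1 \<Longrightarrow> P n k p u = abc (n + k) (p * u)"
  using P_1[of 0 0 0 p u] P_1[of 0 1 0 p u] P_1[of 1 1 0 p u]
    P_1[of 0 0 1 p u] P_1[of 0 1 1 p u] P_1[of 1 1 1 p u]
  by (auto simp: nat_le_simps P_shift) (simp_all add: P_shift[symmetric], simp_all add: abc_def P_def)

lemma Q_abc:
  assumes "m \<le> 1" "n \<le> 2"
  shows "Q m n s v = abc (m + n) (s * v)"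
proof -
  obtain n1 n2 where "n = n1 + n2" "n1 \<le> 1" "n2 \<le> 1"
    using assms(2) by (intro that[of "min n 1" "n - 1"]) auto
  then show ?thesis
    using assms Q_P_1[of m n1 n2 s v] P_abc[of "m + n1" n2 "s * v" 1] by (simp add: add.assoc)
qed

lemma abc_P: "d \<le> 3 \<Longrightarrow> abc d v = cmt (ab (min d 2) v) (c (d - 2) 1) + abcc (min d 2 + 2 * (d - 2)) v"
  by (simp add: abc_def)

lemma abc_Q: "d \<le> 3 \<Longrightarrow> abc d v = cmt (a (d - 2) v) (bc (min d 2) 1) + abbcc (d - 2 + 2 * min d 2) v"
  using Q_abc[of "d - 2" "min d 2" v 1] by (auto simp: nat_le_simps Q_def)

lemma cmt_ab_c:
  assumes "n \<le> 2" "k \<le> 1"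
  shows "cmt (ab n p) (c k u) = abc (n + k) (p * u) + abcc (n + 2 * k) (- (p * u\<^sup>2))"
  using P_abc[OF assms, of p u] assms by (simp add: P_def abcc_uminus algebra_simps eq_diff_eq)

lemma cmt_a_bc:
  assumes "m \<le> 1" "n \<le> 2"
  shows "cmt (a m s) (bc n v) = abc (m + n) (s * v) + abbcc (m + 2 * n) (- (s * v\<^sup>2))"
  using Q_abc[OF assms, of s v] assms by (simp add: Q_def abbcc_uminus algebra_simps eq_diff_eq)

lemma a_abc: "d \<le> 3 \<Longrightarrow> cm (a m s) (abc d v)"
  unfolding abc_P by (intro cm_add_right cm_cmt a_ab a_c a_abcc) auto

lemma ab_abc: "d \<le> 3 \<Longrightarrow> n \<le> 2 \<Longrightarrow> cm (ab n s) (abc d v)"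
  unfolding abc_Q by (intro cm_add_right cm_cmt a_ab[THEN cm_sym] ab_bc ab_abbcc) auto

lemma abcc_abc: "d \<le> 3 \<Longrightarrow> e \<le> 4 \<Longrightarrow> cm (abcc e s) (abc d v)"
  unfolding abc_P by (intro cm_add_right cm_cmt ab_abcc[THEN cm_sym] c_abcc[THEN cm_sym] abcc_abcc) auto

lemma abbcc_abc: "d \<le> 3 \<Longrightarrow> e \<le> 5 \<Longrightarrow> cm (abbcc e s) (abc d v)"
  unfolding abc_P
  by (intro cm_add_right cm_cmt ab_abbcc[THEN cm_sym] c_abbcc[THEN cm_sym] abcc_abbcc[THEN cm_sym]) auto

lemma b_abc:
  assumes "d \<le> 3" "m \<le> 1"
  shows "cm (b m s) (abc d v)"
proof -
  let ?y = "ab (d - 2 + m) (- (s * v))" and ?x = "a (d - 2) v" and ?z = "bc (min d 2) 1"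
  have y: "cm ?y ?z" "cm ?y (cmt ?x ?z)"
    using assms by (auto intro!: ab_bc cm_cmt a_ab[THEN cm_sym])
  have "b m s + cmt ?x ?z - b m s = cmt (b m s + ?x - b m s) (b m s + ?z - b m s)"
    by (rule conj_cmt)
  also have "\<dots> = cmt (?y + ?x) ?z"
    using assms by (simp add: conj_b_a cm_conj[OF b_bc])
  also have "\<dots> = cmt ?x ?z"
    using y by (simp add: cmt_add_left cm_conj cmt_0)
  finally have "cm (b m s) (cmt ?x ?z)"
    by (simp add: cm_iff)
  then show ?thesis
    using assms by (simp add: abc_Q cm_add_right b_abbcc)
qed

lemma bcc_abc:
  assumes "d \<le> 3" "m \<le> 3"
  shows "cm (bcc m s) (abc d v)"
proof -
  let ?x = "a (d - 2) v" and ?z = "bc (min d 2) 1"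
  let ?y = "- abcc (d - 2 + m) (v * s)"
  have y: "cm ?y ?z" "cm ?y (cmt ?x ?z)"
    using assms by (auto intro!: cm_cmt a_abcc[THEN cm_sym] bc_abcc[THEN cm_sym])
  have "bcc m s + cmt ?x ?z - bcc m s = cmt (bcc m s + ?x - bcc m s) (bcc m s + ?z - bcc m s)"
    by (rule conj_cmt)
  also have "\<dots> = cmt (?y + ?x) ?z"
    using assms by (simp add: conj_eq(2)[of _ ?x] cmt_a_bcc_abcc cm_conj[OF bc_bcc[THEN cm_sym]])
  also have "\<dots> = cmt ?x ?z"
    using y cm_conj[OF y(2)] by (simp add: cmt_add_left cmt_0)
  finally have "cm (bcc m s) (cmt ?x ?z)"
    by (simp add: cm_iff)
  then show ?thesis
    using assms by (simp add: abc_Q cm_add_right bcc_abbcc)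
qed

text \<open>Conjugation by \<psi> fixes \<alpha> and multiplies \<beta> + \<psi> by a letter of
  \<beta> + 2\<psi>, whose commutator with \<alpha> is the claimed value.\<close>

lemma cmt_abc_c:
  assumes "d \<le> 3" "k \<le> 1"
  shows "cmt (abc d v) (c k u) = abcc (d + k) (2 * (v * u))"
proof -
  let ?x = "a (d - 2) v" and ?z = "bc (min d 2) 1" and ?B = "bcc (min d 2 + k) (2 * u)"
  have B: "cmt ?z (c k u) = ?B"
    using assms by (simp add: cmt_bc_c)
  have "cmt ?x ?z = abc d v - abbcc (d - 2 + 2 * min d 2) v"
    using assms by (simp add: abc_Q)
  then have y: "cm ?B (cmt ?x ?z)"
    using assms by (auto intro!: cm_diff bcc_abc bcc_abbcc)
  have "c k u + cmt ?x ?z - c k u = cmt (c k u + ?x - c k u) (c k u + ?z - c k u)"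
    by (rule conj_cmt)
  also have "\<dots> = cmt ?x (- ?B + ?z)"
    by (simp add: conj_eq(2)[of _ ?z] B cm_conj[OF a_c[THEN cm_sym]])
  also have "\<dots> = cmt ?x (- ?B) + cmt ?x ?z"
    using y cm_conj[of "- ?B" "cmt ?x ?z"] by (simp add: cmt_add_right)
  also have "cmt ?x (- ?B) = - abcc (d + k) (2 * (v * u))"
    using assms cmt_a_bcc_abcc[of "d - 2" "min d 2 + k" v "- (2 * u)"]
    by (auto simp: uminuses abcc_uminus nat_le_simps mult_ac)
  finally have "c k u + abc d v - c k u = - abcc (d + k) (2 * (v * u)) + abc d v"
    using assms by (simp add: abc_Q conj_add cm_conj[OF c_abbcc] add.assoc)
  then show ?thesis
    using assms by (simp add: cmt_conj(2) diff_uminus_add)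
qed

text \<open>The other presentation is used here: \<beta> + \<psi> fixes \<alpha> + \<beta> and
  multiplies \<psi> by a letter of \<beta> + 2\<psi>.\<close>

lemma cmt_abc_bc:
  assumes "d \<le> 3" "n \<le> 2"
  shows "cmt (abc d v) (bc n u) = abbcc (d + n) (2 * (v * u))"
proof -
  let ?x = "ab (min d 2) v" and ?z = "c (d - 2) 1" and ?B = "bcc (n + (d - 2)) (2 * u)"
  have B: "cmt (bc n u) ?z = ?B"
    using assms by (simp add: cmt_bc_c)
  have "cmt ?x ?z = abc d v - abcc (min d 2 + 2 * (d - 2)) v"
    using assms by (simp add: abc_P)
  then have y: "cm ?B (cmt ?x ?z)"
    using assms by (auto intro!: cm_diff bcc_abc bcc_abcc)
  have "bc n u + cmt ?x ?z - bc n u = cmt (bc n u + ?x - bc n u) (bc n u + ?z - bc n u)"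
    by (rule conj_cmt)
  also have "\<dots> = cmt ?x (?B + ?z)"
    using assms by (simp add: conj_eq(1)[of _ ?z] B cm_conj[OF ab_bc[THEN cm_sym]])
  also have "\<dots> = cmt ?x ?B + cmt ?x ?z"
    using y by (simp add: cmt_add_right cm_conj)
  also have "cmt ?x ?B = - abbcc (d + n) (2 * (v * u))"
    using assms cmt_ab_bcc[of "min d 2" "n + (d - 2)" v "2 * u"]
    by (auto simp: abbcc_uminus nat_le_simps mult_ac)
  finally have "bc n u + abc d v - bc n u = - abbcc (d + n) (2 * (v * u)) + abc d v"
    using assms by (simp add: abc_P conj_add cm_conj[OF bc_abcc] add.assoc)
  then show ?thesis
    using assms by (simp add: cmt_conj(2) diff_uminus_add)
qed

lemma abc_abc:
  assumes "d \<le> 3" "e \<le> 3"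
  shows "cm (abc e s) (abc d v)"
proof -
  let ?x = "ab (min d 2) v" and ?z = "c (d - 2) 1"
  let ?y = "abcc (e + (d - 2)) (2 * s)"
  have y: "cm ?y ?z" "cm ?x ?y" "cm ?y (cmt ?x ?z)"
    using assms by (auto intro!: cm_cmt ab_abcc[THEN cm_sym] c_abcc[THEN cm_sym] ab_abcc)
  have "abc e s + cmt ?x ?z - abc e s = cmt (abc e s + ?x - abc e s) (abc e s + ?z - abc e s)"
    by (rule conj_cmt)
  also have "\<dots> = cmt ?x (?y + ?z)"
    using assms by (simp add: conj_eq(1)[of _ ?z] cmt_abc_c cm_conj[OF ab_abc[THEN cm_sym]])
  also have "\<dots> = cmt ?x ?z"
    using y by (simp add: cmt_add_right cm_conj cmt_0)
  finally have "cm (abc e s) (cmt ?x ?z)"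
    by (simp add: cm_iff)
  then show ?thesis
    using assms unfolding abc_P[of d v, OF assms(1)]
    by (intro cm_add_right) (auto intro!: abcc_abc[THEN cm_sym])
qed

text \<open>\<open>P\<close> mixes a commutator with a letter of \<alpha> + \<beta> + 2\<psi>. Both
  parts are additive, and the parts for s and t can be interchanged.\<close>

lemma abc_add:
  assumes "d \<le> 3"
  shows "abc d (s + t) = abc d s + abc d t"
proof -
  let ?C = "\<lambda>v. cmt (ab (min d 2) v) (c (d - 2) 1)" and ?D = "abcc (min d 2 + 2 * (d - 2))"
  have "?C v = abc d v - ?D v" for v
    using assms by (simp add: abc_P)
  then have "cm (ab (min d 2) s) (?C t)"
    using assms by (auto intro!: cm_diff ab_abc ab_abcc)
  then have "?C (s + t) = ?C t + ?C s"
    by (simp add: ab_add cmt_add_left cm_conj)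
  moreover have "?D (s + t) = ?D t + ?D s"
    using assms abcc_add[of _ t s] by (simp add: add.commute)
  moreover have "cm (?D t) (?C s)"
    using assms by (intro cm_cmt cm_sym[OF ab_abcc] cm_sym[OF c_abcc]) auto
  ultimately have "abc d (s + t) = abc d t + abc d s"
    using assms by (simp add: abc_P cm_def add.assoc) (simp add: cm_def flip: add.assoc)
  also have "\<dots> = abc d s + abc d t"
    using abc_abc[OF assms assms, of t s] by (simp add: cm_def)
  finally show ?thesis .
qed

end

section \<open>Consequences of the lifted relations for the small basis\<close>

text \<open>The letters \<open>b\<close>, \<open>p\<close>, \<open>q\<close> belong to $\beta$, $\psi$, $\omega$.\<close>

locale small =
  fixes b p q bp bpp pq :: "nat \<Rightarrow> 'r::comm_ring_1 \<Rightarrow> 'g::group_add" and h :: 'r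
  assumes half: "2 * h = 1"
    and b_add: "b i (s + t) = b i s + b i t"
    and p_add: "p i (s + t) = p i s + p i t"
    and q_add: "q i (s + t) = q i s + q i t"
    and bp_add: "bp i (s + t) = bp i s + bp i t"
    and bpp_add: "bpp i (s + t) = bpp i s + bpp i t"
    and pq_add: "pq i (s + t) = pq i s + pq i t"
    and b_bp: "cm (b i s) (bp j t)"
    and b_q: "cm (b i s) (q j t)"
    and bp_bpp: "cm (bp i s) (bpp j t)"
    and q_pq: "cm (q i s) (pq j t)"
    and cmt_bp_p: "i \<le> 2 \<Longrightarrow> j \<le> 1 \<Longrightarrow> cmt (bp i s) (p j t) = bpp (i + j) (2 * (s * t))"
    and cmt_p_q: "i \<le> 1 \<Longrightarrow> j \<le> 1 \<Longrightarrow> cmt (p i s) (q j t) = pq (i + j) (2 * (s * t))"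
    and lift_bp_q: "cmt (quad bp (B0 * P0) (B0 * P1 + B1 * P0) (B1 * P1)) (lin q Q0 Q1)
      = cmt (lin b B0 B1) (quad pq (2 * (P0 * Q0)) (2 * (P0 * Q1 + P1 * Q0)) (2 * (P1 * Q1)))"
    and lift_bpp_q: "cm (cub bpp (B0 * P0\<^sup>2) (B1 * P0\<^sup>2 + 2 * (B0 * (P0 * P1)))
          (2 * (B1 * (P0 * P1)) + B0 * P1\<^sup>2) (B1 * P1\<^sup>2)) (lin q Q0 Q1)"
    and lift_bp_pq: "cm (quad bp (B0 * P0) (B0 * P1 + B1 * P0) (B1 * P1))
      (quad pq (P0 * Q0) (P0 * Q1 + P1 * Q0) (P1 * Q1))"
    and p_bpp: "cm (p i s) (bpp j t)"
begin

lemma half_mult: "2 * (h * x) = x"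
  using half by (simp add: mult.assoc[symmetric])

lemma zeros [simp]: "b i 0 = 0" "p i 0 = 0" "q i 0 = 0" "bp i 0 = 0" "bpp i 0 = 0" "pq i 0 = 0"
  by (rule additive_zero, rule b_add p_add q_add bp_add bpp_add pq_add)+

lemmas forms = lin_def quad_def cub_def

text \<open>The degrees i + 2j with i and j at most 1 exhaust 0 to 3, so monomials suffice.\<close>

lemma bpp_q: "i \<le> 3 \<Longrightarrow> j \<le> 1 \<Longrightarrow> cm (bpp i s) (q j t)"
  using lift_bpp_q[of s 1 0 0 t 0] lift_bpp_q[of s 1 0 0 0 t]
    lift_bpp_q[of 0 1 s 0 t 0] lift_bpp_q[of 0 1 s 0 0 t]
    lift_bpp_q[of s 0 0 1 t 0] lift_bpp_q[of s 0 0 1 0 t]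
    lift_bpp_q[of 0 0 s 1 t 0] lift_bpp_q[of 0 0 s 1 0 t]
  by (auto simp: forms nat_le_simps)

lemma pq_cmt: "i \<le> 2 \<Longrightarrow> pq i s = cmt (p (i - 1) (h * s)) (q (min i 1) 1)"
  using cmt_p_q[of "i - 1" "min i 1" "h * s" 1] by (auto simp: nat_le_simps half_mult)

lemma bpp_pq: "i \<le> 3 \<Longrightarrow> j \<le> 2 \<Longrightarrow> cm (bpp i s) (pq j t)"
  by (auto simp: pq_cmt intro!: cm_cmt cm_sym[OF p_bpp] bpp_q)

lemma bp_pq_monomial: "cm (bp 0 s) (pq 0 t)" "cm (bp 0 s) (pq 1 t)" "cm (bp 1 s) (pq 0 t)"
  "cm (bp 1 s) (pq 1 t)" "cm (bp 1 s) (pq 2 t)" "cm (bp 2 s) (pq 1 t)" "cm (bp 2 s) (pq 2 t)"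
  using lift_bp_pq[of s 1 0 0 t 0] lift_bp_pq[of s 1 0 0 0 t] lift_bp_pq[of 0 1 0 s t 0]
    lift_bp_pq[of 0 1 s 0 t 0] lift_bp_pq[of s 0 1 0 t 0] lift_bp_pq[of s 0 1 0 0 t]
    lift_bp_pq[of s 0 0 1 t 0] lift_bp_pq[of s 0 0 1 0 t]
    lift_bp_pq[of 0 1 s 0 0 t] lift_bp_pq[of 0 0 1 s t 0] lift_bp_pq[of 0 0 1 s 0 t]
  by (simp_all add: forms)

lemma bp_pq: "i \<le> 2 \<Longrightarrow> j \<le> 2 \<Longrightarrow> cm (bp i s) (pq j t)"
proof -
  have "cm (bp 0 s) (pq 2 t)"
    using lift_bp_pq[of s 1 1 0 0 t] by (simp add: forms bp_pq_monomial cm_add_iff cm_add)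
  moreover have "cm (bp 2 s) (pq 0 t)"
    using lift_bp_pq[of 0 1 1 s t 0] by (simp add: forms bp_pq_monomial cm_add_iff cm_add)
  ultimately show "i \<le> 2 \<Longrightarrow> j \<le> 2 \<Longrightarrow> cm (bp i s) (pq j t)"
    by (auto simp: nat_le_simps bp_pq_monomial)
qed

section \<open>The root \<beta> + \<psi> + \<omega>\<close>

definition bpq :: "nat \<Rightarrow> 'r \<Rightarrow> 'g"
  where "bpq d v = cmt (b (d - 2) v) (pq (min d 2) 1)"

text \<open>Each of the three polynomials enters \<beta> + \<psi> + \<omega> linearly. For this
  reason monomial lifts determine the root, without polarization.\<close>

lemma monomial_bp_q:
  assumes "i \<le> 1" "j \<le> 1" "k \<le> 1"
  shows "cmt (bp (i + j) (s * t)) (q k u) = cmt (b i s) (pq (j + k) (2 * (t * u)))"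
  using assms
    lift_bp_q[of "if i = 0 then s else 0" "if j = 0 then t else 0"
      "if j = 0 then 0 else t" "if i = 0 then 0 else s"
      "if k = 0 then u else 0" "if k = 0 then 0 else u"]
  unfolding nat_le_simps by (elim disjE) (simp_all add: forms)

text \<open>Three instances of \<open>monomial_bp_q\<close> carry both coefficients through
  \<open>pq\<close> to \<open>b\<close>; the middle coefficient h makes the one left at
  \<open>pq\<close> equal to 1.\<close>

lemma cmt_bp_q_1:
  assumes "i \<le> 1" "j \<le> 1" "k \<le> 1"
  shows "cmt (bp (i + j) s) (q k t) = cmt (b i (2 * (s * t))) (pq (j + k) 1)"
proof -
  have "2 * (s * t) * h = s * t"
    using half_mult[of "s * t"] by (simp add: mult_ac)
  then show ?thesis
    using monomial_bp_q[OF assms, of 1 s t] monomial_bp_q[OF assms, of "2 * (s * t)" h 1]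
      monomial_bp_q[OF assms, of 1 "s * t" 1]
    by (simp add: half)
qed

lemma cmt_b_pq_1:
  assumes "i \<le> 1" "j \<le> 1" "k \<le> 1"
  shows "cmt (b i s) (pq (j + k) t) = cmt (b i (s * t)) (pq (j + k) 1)"
proof -
  have "2 * (s * (h * t)) = s * t"
    using half_mult[of "s * t"] by (simp add: mult_ac)
  then show ?thesis
    using monomial_bp_q[OF assms, of s "h * t" 1] cmt_bp_q_1[OF assms, of "s * (h * t)" 1]
    by (simp add: half_mult)
qed

text \<open>Degree 1 at \<beta> + \<psi> is 1 + 0 or 0 + 1, which moves a factor x from \<beta> to
  \<psi> + \<omega>.\<close>

lemma bpq_shift: "cmt (b 1 v) (pq 0 1) = cmt (b 0 v) (pq 1 1)"
  "cmt (b 1 v) (pq 1 1) = cmt (b 0 v) (pq 2 1)"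
  using cmt_bp_q_1[of 1 0 0 "h * v" 1] cmt_bp_q_1[of 0 1 0 "h * v" 1]
    cmt_bp_q_1[of 1 0 1 "h * v" 1] cmt_bp_q_1[of 0 1 1 "h * v" 1]
  by (simp_all add: half_mult)

lemma cmt_b_pq: "i \<le> 1 \<Longrightarrow> j \<le> 2 \<Longrightarrow> cmt (b i s) (pq j t) = bpq (i + j) (s * t)"
  using cmt_b_pq_1[of i 0 0 s t] cmt_b_pq_1[of i 1 0 s t] cmt_b_pq_1[of i 1 1 s t]
  by (auto simp: nat_le_simps bpq_def bpq_shift)

lemma cmt_bp_q: "i \<le> 2 \<Longrightarrow> j \<le> 1 \<Longrightarrow> cmt (bp i s) (q j t) = bpq (i + j) (2 * (s * t))"
  using cmt_bp_q_1[of "i - 1" "min i 1" j s t] cmt_b_pq[of "i - 1" "min i 1 + j" "2 * (s * t)" 1]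
  by (auto simp: nat_le_simps)

lemma bpq_b_pq: "d \<le> 3 \<Longrightarrow> bpq d v = cmt (b (d - 2) v) (pq (min d 2) 1)"
  by (simp add: bpq_def)

lemma bpq_bp_q: "d \<le> 3 \<Longrightarrow> bpq d v = cmt (bp (min d 2) (h * v)) (q (d - 2) 1)"
  using cmt_bp_q[of "min d 2" "d - 2" "h * v" 1] by (auto simp: nat_le_simps half_mult)

lemma b_bpq: "d \<le> 3 \<Longrightarrow> cm (b i s) (bpq d t)"
  unfolding bpq_bp_q by (intro cm_cmt b_bp b_q)

lemma q_bpq: "d \<le> 3 \<Longrightarrow> cm (q i s) (bpq d t)"
  unfolding bpq_b_pq by (intro cm_cmt b_q[THEN cm_sym] q_pq)

lemma bp_bpq: "d \<le> 3 \<Longrightarrow> i \<le> 2 \<Longrightarrow> cm (bp i s) (bpq d t)"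
  unfolding bpq_b_pq by (intro cm_cmt b_bp[THEN cm_sym] bp_pq) auto

lemma bpp_bpq: "d \<le> 3 \<Longrightarrow> i \<le> 3 \<Longrightarrow> cm (bpp i s) (bpq d t)"
  unfolding bpq_bp_q by (intro cm_cmt bp_bpp[THEN cm_sym] bpp_q) auto

lemma pq_bpq: "d \<le> 3 \<Longrightarrow> i \<le> 2 \<Longrightarrow> cm (pq i s) (bpq d t)"
  unfolding bpq_bp_q by (intro cm_cmt bp_pq[THEN cm_sym] q_pq[THEN cm_sym]) auto

text \<open>Here both factors move: \<psi> changes \<beta> + \<psi> by a letter of \<beta> +
  2\<psi>, and \<omega> by a letter of \<psi> + \<omega>. These letters commute with what remains
  and drop out one after the other.\<close>

lemma p_bpq:
  assumes "d \<le> 3" "i \<le> 1"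
  shows "cm (p i s) (bpq d t)"
proof -
  let ?x = "bp (min d 2) (h * t)" and ?z = "q (d - 2) 1"
  let ?y = "- bpp (min d 2 + i) (t * s)" and ?w = "pq (i + (d - 2)) (2 * s)"
  have e: "2 * (h * t * s) = t * s" by (simp add: half_mult mult.assoc)
  have c: "cm ?y x" if "cm (bpp (min d 2 + i) (t * s)) x" for x using that by simp
  have y: "cm ?y (cmt ?x (?w + ?z))" "cm ?y (?w + ?z)" "cm ?x ?w" "cm ?w (cmt ?x ?z)"
    using assms by (auto intro!: cm_cmt cm_add_right bp_bpp[THEN cm_sym] bpp_q bpp_pq bp_pq
        bp_pq[THEN cm_sym] q_pq[THEN cm_sym])
  have "p i s + cmt ?x ?z - p i s = cmt (p i s + ?x - p i s) (p i s + ?z - p i s)"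
    by (rule conj_cmt)
  also have "\<dots> = cmt (?y + ?x) (?w + ?z)"
    using assms by (simp add: conj_eq(2)[of _ ?x] conj_eq(1)[of _ ?z] cmt_bp_p cmt_p_q e)
  also have "\<dots> = cmt ?x (?w + ?z)"
    using cm_conj[OF y(1)] y(2) by (simp add: cmt_add_left cmt_0)
  also have "\<dots> = cmt ?x ?z"
    using y by (simp add: cmt_add_right cm_conj cmt_0)
  finally show ?thesis
    using assms by (simp add: cm_iff bpq_bp_q)
qed

lemma bpq_bpq: "d \<le> 3 \<Longrightarrow> e \<le> 3 \<Longrightarrow> cm (bpq e s) (bpq d t)"
  unfolding bpq_b_pq[of d] by (intro cm_cmt b_bpq[THEN cm_sym] pq_bpq[THEN cm_sym]) auto

lemma bpq_add: "d \<le> 3 \<Longrightarrow> bpq d (s + t) = bpq d s + bpq d t"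
  using b_bpq[of d "d - 2" s t] bpq_bpq[of d d s t]
  by (simp add: bpq_b_pq b_add cmt_add_left cm_conj cm_def)

end

section \<open>Roots\<close>

lemma square_le_2: "(x::int)\<^sup>2 \<le> 2 \<longleftrightarrow> x = -1 \<or> x = 0 \<or> x = 1"
proof
  assume "x\<^sup>2 \<le> 2"
  then have "\<bar>x\<bar>\<^sup>2 < 2\<^sup>2" by simp
  then have "\<bar>x\<bar> < 2" by (rule power_less_imp_less_base) simp
  then show "x = -1 \<or> x = 0 \<or> x = 1" by linarith
qed auto

lemma Phi_iff: "(x, y, z) \<in> Phi \<longleftrightarrow>
  (x = -1 \<or> x = 0 \<or> x = 1) \<and> (y = -1 \<or> y = 0 \<or> y = 1) \<and> (z = -1 \<or> z = 0 \<or> z = 1) \<and>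
  (x = 0 \<or> y = 0 \<or> z = 0) \<and> (x \<noteq> 0 \<or> y \<noteq> 0 \<or> z \<noteq> 0)"
proof
  assume "(x, y, z) \<in> Phi"
  moreover from this have "x\<^sup>2 \<le> 2" "y\<^sup>2 \<le> 2" "z\<^sup>2 \<le> 2"
    using zero_le_power2[of x] zero_le_power2[of y] zero_le_power2[of z]
    unfolding Phi_def by (auto simp only: mem_Collect_eq case_prod_conv)
  ultimately show "(x = -1 \<or> x = 0 \<or> x = 1) \<and> (y = -1 \<or> y = 0 \<or> y = 1) \<and> (z = -1 \<or> z = 0 \<or> z = 1) \<and>
    (x = 0 \<or> y = 0 \<or> z = 0) \<and> (x \<noteq> 0 \<or> y \<noteq> 0 \<or> z \<noteq> 0)"
    unfolding square_le_2 Phi_def by auto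
qed (auto simp: Phi_def)

lemmas root_names = alpha_def beta_def psi_def

lemma omega_eq: "omega = (-1, 0, 0)"
  by (simp add: omega_def root_names)

lemma sum_three: "r1 \<noteq> r2 \<Longrightarrow> r1 \<noteq> r3 \<Longrightarrow> r2 \<noteq> r3 \<Longrightarrow>
  (\<Sum>\<eta>\<in>{r1, r2, r3}. c \<eta> \<bullet> \<eta>) = c r1 \<bullet> r1 + (c r2 \<bullet> r2 + c r3 \<bullet> r3)"
  by simp

lemma pos_roots_three:
  assumes "r1 \<noteq> r2" "r1 \<noteq> r3" "r2 \<noteq> r3"
  shows "pos_roots {r1, r2, r3} = {\<zeta> \<in> Phi. \<exists>x y z. \<zeta> = x \<bullet> r1 + (y \<bullet> r2 + z \<bullet> r3)}"
proof -
  have "(\<exists>c :: root \<Rightarrow> nat. \<zeta> = (\<Sum>\<eta>\<in>{r1, r2, r3}. c \<eta> \<bullet> \<eta>))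
    \<longleftrightarrow> (\<exists>x y z. \<zeta> = x \<bullet> r1 + (y \<bullet> r2 + z \<bullet> r3))" for \<zeta>
    unfolding sum_three[OF assms]
  proof
    assume "\<exists>x y z. \<zeta> = x \<bullet> r1 + (y \<bullet> r2 + z \<bullet> r3)"
    then obtain x y z where "\<zeta> = x \<bullet> r1 + (y \<bullet> r2 + z \<bullet> r3)" by blast
    then show "\<exists>c. \<zeta> = c r1 \<bullet> r1 + (c r2 \<bullet> r2 + c r3 \<bullet> r3)"
      using assms by (intro exI[of _ "\<lambda>r. if r = r1 then x else if r = r2 then y else z"]) auto
  qed blast
  then show ?thesis by (simp add: pos_roots_def)
qed

lemma pos_roots_two:
  assumes "r1 \<noteq> r2"
  shows "pos_roots {r1, r2} = {\<zeta> \<in> Phi. \<exists>x y. \<zeta> = x \<bullet> r1 + y \<bullet> r2}"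
proof -
  have "(\<exists>c :: root \<Rightarrow> nat. \<zeta> = (\<Sum>\<eta>\<in>{r1, r2}. c \<eta> \<bullet> \<eta>))
    \<longleftrightarrow> (\<exists>x y. \<zeta> = x \<bullet> r1 + y \<bullet> r2)" for \<zeta>
  proof
    assume "\<exists>x y. \<zeta> = x \<bullet> r1 + y \<bullet> r2"
    then obtain x y where "\<zeta> = x \<bullet> r1 + y \<bullet> r2" by blast
    then show "\<exists>c. \<zeta> = (\<Sum>\<eta>\<in>{r1, r2}. c \<eta> \<bullet> \<eta>)"
      using assms by (intro exI[of _ "\<lambda>r. if r = r1 then x else y"]) auto
  qed (use assms in auto)
  then show ?thesis by (simp add: pos_roots_def)
qed

lemma I_lg_eq: "I_lg = {(1, -1, 0), (0, 1, -1), (0, 0, 1)}"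
  by (simp add: I_lg_def root_names)

lemma I_sm_eq: "I_sm = {(0, 1, -1), (0, 0, 1), (-1, 0, 0)}"
  by (simp add: I_sm_def root_names omega_eq)

text \<open>Linear inequalities replace the search for natural coefficients; what is left is a
  finite comparison on a cube that contains all roots.\<close>

lemma Phi_set_eqI:
  assumes "\<And>p q r. (p, q, r) \<in> A \<longleftrightarrow> (p, q, r) \<in> Phi \<and> P p q r"
    and "\<forall>p\<in>{-1,0,1}. \<forall>q\<in>{-1,0,1}. \<forall>r\<in>{-1,0,1}. (p, q, r) \<in> Phi \<and> P p q r \<longleftrightarrow> (p, q, r) \<in> B"
    and "B \<subseteq> {-1,0,1} \<times> {-1,0,1} \<times> {-1,0,1}"
  shows "A = B"
proof (rule Set.set_eqI)
  fix \<zeta> :: root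
  obtain p q r where \<zeta>: "\<zeta> = (p, q, r)" by (cases \<zeta>)
  have "{p, q, r} \<subseteq> {-1,0,1}" if "(p, q, r) \<in> Phi \<or> (p, q, r) \<in> B"
    using that assms(3) unfolding Phi_iff by blast
  then show "\<zeta> \<in> A \<longleftrightarrow> \<zeta> \<in> B"
    unfolding \<zeta> assms(1) using assms(2) by blast
qed

lemma pos_roots_lg: "pos_roots I_lg = {(1,-1,0), (0,1,-1), (0,0,1), (1,0,-1), (0,1,0), (0,1,1), (1,0,0),
    (1,0,1), (1,1,0)}"
proof (rule Phi_set_eqI)
  show "(p, q, r) \<in> pos_roots I_lg \<longleftrightarrow> (p, q, r) \<in> Phi \<and> 0 \<le> p \<and> 0 \<le> p + q \<and> 0 \<le> p + q + r" for p q r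
  proof -
    have "(\<exists>x y z. (p, q, r) = (int x, int y - int x, int z - int y))
      \<longleftrightarrow> 0 \<le> p \<and> 0 \<le> p + q \<and> 0 \<le> p + q + r"
    proof safe
      assume "0 \<le> p" "0 \<le> p + q" "0 \<le> p + q + r"
      then show "\<exists>x y z. (p, q, r) = (int x, int y - int x, int z - int y)"
        by (intro exI[of _ "nat p"] exI[of _ "nat (p + q)"] exI[of _ "nat (p + q + r)"]) simp
    qed auto
    then show ?thesis
      unfolding I_lg_eq by (subst pos_roots_three) (simp_all add: plus_prod_def)
  qed
qed (simp_all add: Phi_iff)

lemma pos_roots_sm: "pos_roots I_sm = {(0,1,-1), (0,0,1), (-1,0,0), (0,1,0), (0,1,1), (-1,0,1), (-1,1,0)}"
proof (rule Phi_set_eqI)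
  show "(p, q, r) \<in> pos_roots I_sm \<longleftrightarrow> (p, q, r) \<in> Phi \<and> p \<le> 0 \<and> 0 \<le> q \<and> 0 \<le> q + r" for p q r
  proof -
    have "(\<exists>x y z. (p, q, r) = (- int z, int x, int y - int x)) \<longleftrightarrow> p \<le> 0 \<and> 0 \<le> q \<and> 0 \<le> q + r"
    proof safe
      assume "p \<le> 0" "0 \<le> q" "0 \<le> q + r"
      then show "\<exists>x y z. (p, q, r) = (- int z, int x, int y - int x)"
        by (intro exI[of _ "nat q"] exI[of _ "nat (q + r)"] exI[of _ "nat (- p)"]) simp
    qed auto
    then show ?thesis
      unfolding I_sm_eq by (subst pos_roots_three) (simp_all add: plus_prod_def)
  qed
qed (simp_all add: Phi_iff)

lemma pos_roots_ab: "pos_roots {(1,-1,0), (0,1,-1)} = {(1,-1,0), (0,1,-1), (1,0,-1)}"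
proof (rule Phi_set_eqI)
  show "(p, q, r) \<in> pos_roots {(1,-1,0), (0,1,-1)} \<longleftrightarrow> (p, q, r) \<in> Phi \<and> 0 \<le> p \<and> r \<le> 0 \<and> q = - p - r" for p q r
  proof -
    have "(\<exists>x y. (p, q, r) = (int x, int y - int x, - int y)) \<longleftrightarrow> 0 \<le> p \<and> r \<le> 0 \<and> q = - p - r"
    proof (rule iffI, force)
      assume "0 \<le> p \<and> r \<le> 0 \<and> q = - p - r"
      then show "\<exists>x y. (p, q, r) = (int x, int y - int x, - int y)"
        by (intro exI[of _ "nat (p)"] exI[of _ "nat (- r)"]) simp
    qed
    then show ?thesis
      by (subst pos_roots_two) (simp_all add: plus_prod_def)
  qed
qed (simp_all add: Phi_iff)

lemma pos_roots_bc: "pos_roots {(0,1,-1), (0,0,1)} = {(0,1,-1), (0,0,1), (0,1,0), (0,1,1)}"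
proof (rule Phi_set_eqI)
  show "(p, q, r) \<in> pos_roots {(0,1,-1), (0,0,1)} \<longleftrightarrow> (p, q, r) \<in> Phi \<and> p = 0 \<and> 0 \<le> q \<and> 0 \<le> q + r" for p q r
  proof -
    have "(\<exists>x y. (p, q, r) = (0, int x, int y - int x)) \<longleftrightarrow> p = 0 \<and> 0 \<le> q \<and> 0 \<le> q + r"
    proof (rule iffI, force)
      assume "p = 0 \<and> 0 \<le> q \<and> 0 \<le> q + r"
      then show "\<exists>x y. (p, q, r) = (0, int x, int y - int x)"
        by (intro exI[of _ "nat (q)"] exI[of _ "nat (q + r)"]) simp
    qed
    then show ?thesis
      by (subst pos_roots_two) (simp_all add: plus_prod_def)
  qed
qed (simp_all add: Phi_iff)

lemma pos_roots_ac: "pos_roots {(1,-1,0), (0,0,1)} = {(1,-1,0), (0,0,1)}"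
proof (rule Phi_set_eqI)
  show "(p, q, r) \<in> pos_roots {(1,-1,0), (0,0,1)} \<longleftrightarrow> (p, q, r) \<in> Phi \<and> 0 \<le> p \<and> 0 \<le> r \<and> q = - p" for p q r
  proof -
    have "(\<exists>x y. (p, q, r) = (int x, - int x, int y)) \<longleftrightarrow> 0 \<le> p \<and> 0 \<le> r \<and> q = - p"
    proof (rule iffI, force)
      assume "0 \<le> p \<and> 0 \<le> r \<and> q = - p"
      then show "\<exists>x y. (p, q, r) = (int x, - int x, int y)"
        by (intro exI[of _ "nat (p)"] exI[of _ "nat (r)"]) simp
    qed
    then show ?thesis
      by (subst pos_roots_two) (simp_all add: plus_prod_def)
  qed
qed (simp_all add: Phi_iff)

lemma pos_roots_co: "pos_roots {(0,0,1), (-1,0,0)} = {(0,0,1), (-1,0,0), (-1,0,1)}"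
proof (rule Phi_set_eqI)
  show "(p, q, r) \<in> pos_roots {(0,0,1), (-1,0,0)} \<longleftrightarrow> (p, q, r) \<in> Phi \<and> p \<le> 0 \<and> 0 \<le> r \<and> q = 0" for p q r
  proof -
    have "(\<exists>x y. (p, q, r) = (- int y, 0, int x)) \<longleftrightarrow> p \<le> 0 \<and> 0 \<le> r \<and> q = 0"
    proof (rule iffI, force)
      assume "p \<le> 0 \<and> 0 \<le> r \<and> q = 0"
      then show "\<exists>x y. (p, q, r) = (- int y, 0, int x)"
        by (intro exI[of _ "nat (r)"] exI[of _ "nat (- p)"]) simp
    qed
    then show ?thesis
      by (subst pos_roots_two) (simp_all add: plus_prod_def)
  qed
qed (simp_all add: Phi_iff)

lemma pos_roots_bo: "pos_roots {(0,1,-1), (-1,0,0)} = {(0,1,-1), (-1,0,0)}"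
proof (rule Phi_set_eqI)
  show "(p, q, r) \<in> pos_roots {(0,1,-1), (-1,0,0)} \<longleftrightarrow> (p, q, r) \<in> Phi \<and> p \<le> 0 \<and> 0 \<le> q \<and> r = - q" for p q r
  proof -
    have "(\<exists>x y. (p, q, r) = (- int y, int x, - int x)) \<longleftrightarrow> p \<le> 0 \<and> 0 \<le> q \<and> r = - q"
    proof (rule iffI, force)
      assume "p \<le> 0 \<and> 0 \<le> q \<and> r = - q"
      then show "\<exists>x y. (p, q, r) = (- int y, int x, - int x)"
        by (intro exI[of _ "nat (q)"] exI[of _ "nat (- p)"]) simp
    qed
    then show ?thesis
      by (subst pos_roots_two) (simp_all add: plus_prod_def)
  qed
qed (simp_all add: Phi_iff)

lemma pairs_three:
  assumes "r1 \<noteq> r2" "r1 \<noteq> r3" "r2 \<noteq> r3"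
  shows "pairs {r1, r2, r3} = {{r1, r2}, {r2, r3}, {r1, r3}}"
proof (rule equalityI)
  show "pairs {r1, r2, r3} \<subseteq> {{r1, r2}, {r2, r3}, {r1, r3}}"
    unfolding pairs_def by (auto simp: insert_commute)
  have "{x, y} \<in> pairs {r1, r2, r3}" if "x \<in> {r1, r2, r3}" "y \<in> {r1, r2, r3}" "x \<noteq> y" for x y
    using that unfolding pairs_def by blast
  then show "{{r1, r2}, {r2, r3}, {r1, r3}} \<subseteq> pairs {r1, r2, r3}"
    using assms by blast
qed

lemma pairs_lg: "pairs I_lg = {{(1,-1,0), (0,1,-1)}, {(0,1,-1), (0,0,1)}, {(1,-1,0), (0,0,1)}}"
  unfolding I_lg_eq by (rule pairs_three) simp_all

lemma pairs_sm: "pairs I_sm = {{(0,1,-1), (0,0,1)}, {(0,0,1), (-1,0,0)}, {(0,1,-1), (-1,0,0)}}"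
  unfolding I_sm_eq by (rule pairs_three) simp_all

lemma rank2_roots_lg: "rank2_roots I_lg = {(1,-1,0), (0,1,-1), (1,0,-1), (0,0,1), (0,1,0), (0,1,1)}"
  unfolding rank2_roots_def pairs_lg by (auto simp: pos_roots_ab pos_roots_bc pos_roots_ac)

lemma rank2_roots_sm: "rank2_roots I_sm = {(0,1,-1), (0,0,1), (0,1,0), (0,1,1), (-1,0,0), (-1,0,1)}"
  unfolding rank2_roots_def pairs_sm by (auto simp: pos_roots_bc pos_roots_co pos_roots_bo)

section \<open>Coefficients and heights\<close>

definition coeff3 :: "root \<Rightarrow> root \<Rightarrow> root \<Rightarrow> nat \<Rightarrow> nat \<Rightarrow> nat \<Rightarrow> root \<Rightarrow> nat"
  where "coeff3 r1 r2 r3 x y z = (\<lambda>r. if r = r1 then x else if r = r2 then y else if r = r3 then z else 0)"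

lemma root_coeff_three:
  assumes "r1 \<noteq> r2" "r1 \<noteq> r3" "r2 \<noteq> r3"
    and "\<And>x' y' z'. x \<bullet> r1 + (y \<bullet> r2 + z \<bullet> r3) = x' \<bullet> r1 + (y' \<bullet> r2 + z' \<bullet> r3)
      \<Longrightarrow> x = x' \<and> y = y' \<and> z = z'"
  shows "root_coeff {r1, r2, r3} (x \<bullet> r1 + (y \<bullet> r2 + z \<bullet> r3)) = coeff3 r1 r2 r3 x y z"
  unfolding root_coeff_def sum_three[OF assms(1-3)]
proof (rule the_equality)
  show "(\<forall>\<eta>. \<eta> \<notin> {r1, r2, r3} \<longrightarrow> coeff3 r1 r2 r3 x y z \<eta> = 0) \<and> x \<bullet> r1 + (y \<bullet> r2 + z \<bullet> r3) =
    coeff3 r1 r2 r3 x y z r1 \<bullet> r1 + (coeff3 r1 r2 r3 x y z r2 \<bullet> r2 + coeff3 r1 r2 r3 x y z r3 \<bullet> r3)"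
    using assms(1-3) by (auto simp: coeff3_def)
  fix c assume c: "(\<forall>\<eta>. \<eta> \<notin> {r1, r2, r3} \<longrightarrow> c \<eta> = 0) \<and>
    x \<bullet> r1 + (y \<bullet> r2 + z \<bullet> r3) = c r1 \<bullet> r1 + (c r2 \<bullet> r2 + c r3 \<bullet> r3)"
  then have "x = c r1 \<and> y = c r2 \<and> z = c r3"
    by (intro assms(4)) blast
  with c show "c = coeff3 r1 r2 r3 x y z"
    by (auto simp: coeff3_def fun_eq_iff)
qed

lemma root_coeff_lg: "root_coeff I_lg (int x, int y - int x, int z - int y)
    = coeff3 (1,-1,0) (0,1,-1) (0,0,1) x y z"
  using root_coeff_three[of "(1,-1,0)" "(0,1,-1)" "(0,0,1)" x y z]
  by (simp add: I_lg_eq plus_prod_def)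

lemma root_coeff_sm: "root_coeff I_sm (- int z, int x, int y - int x)
    = coeff3 (0,1,-1) (0,0,1) (-1,0,0) x y z"
  using root_coeff_three[of "(0,1,-1)" "(0,0,1)" "(-1,0,0)" x y z]
  by (simp add: I_sm_eq plus_prod_def)

lemma ht_lg: "ht I_lg (int x, int y - int x, int z - int y) = x + y + z"
  by (simp add: ht_def root_coeff_lg) (simp add: I_lg_eq coeff3_def)

lemma ht_sm: "ht I_sm (- int z, int x, int y - int x) = x + y + z"
  by (simp add: ht_def root_coeff_sm) (simp add: I_sm_eq coeff3_def)

lemma ht_lg_simps [simp]:
  "ht I_lg (1,-1,0) = 1" "ht I_lg (0,1,-1) = 1" "ht I_lg (0,0,1) = 1" "ht I_lg (1,0,-1) = 2" "ht I_lg (0,1,0) =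
      2" "ht I_lg (0,1,1) = 3" "ht I_lg (1,0,0) = 3" "ht I_lg (1,0,1) = 4" "ht I_lg (1,1,0) = 5"
  using ht_lg[of 1 0 0] ht_lg[of 0 1 0] ht_lg[of 0 0 1] ht_lg[of 1 1 0] ht_lg[of 0 1 1] ht_lg[of 0 1 2] ht_lg[of
      1 1 1] ht_lg[of 1 1 2] ht_lg[of 1 2 2] by simp_all

lemma root_coeff_lg_simps:
  "root_coeff I_lg (1,-1,0) = coeff3 (1,-1,0) (0,1,-1) (0,0,1) 1 0 0"
  "root_coeff I_lg (0,1,-1) = coeff3 (1,-1,0) (0,1,-1) (0,0,1) 0 1 0"
  "root_coeff I_lg (0,0,1) = coeff3 (1,-1,0) (0,1,-1) (0,0,1) 0 0 1"
  "root_coeff I_lg (1,0,-1) = coeff3 (1,-1,0) (0,1,-1) (0,0,1) 1 1 0"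
  "root_coeff I_lg (0,1,0) = coeff3 (1,-1,0) (0,1,-1) (0,0,1) 0 1 1"
  "root_coeff I_lg (0,1,1) = coeff3 (1,-1,0) (0,1,-1) (0,0,1) 0 1 2"
  "root_coeff I_lg (1,0,0) = coeff3 (1,-1,0) (0,1,-1) (0,0,1) 1 1 1"
  "root_coeff I_lg (1,0,1) = coeff3 (1,-1,0) (0,1,-1) (0,0,1) 1 1 2"
  "root_coeff I_lg (1,1,0) = coeff3 (1,-1,0) (0,1,-1) (0,0,1) 1 2 2"
  using root_coeff_lg[of 1 0 0] root_coeff_lg[of 0 1 0] root_coeff_lg[of 0 0 1] root_coeff_lg[of 1 1 0]
      root_coeff_lg[of 0 1 1] root_coeff_lg[of 0 1 2] root_coeff_lg[of 1 1 1] root_coeff_lg[of 1 1 2]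
      root_coeff_lg[of 1 2 2] by simp_all

lemma ht_sm_simps [simp]:
  "ht I_sm (0,1,-1) = 1" "ht I_sm (0,0,1) = 1" "ht I_sm (-1,0,0) = 1" "ht I_sm (0,1,0) = 2" "ht I_sm (0,1,1) =
      3" "ht I_sm (-1,0,1) = 2" "ht I_sm (-1,1,0) = 3"
  using ht_sm[of 0 1 0] ht_sm[of 0 0 1] ht_sm[of 1 0 0] ht_sm[of 0 1 1] ht_sm[of 0 1 2] ht_sm[of 1 0 1] ht_sm[of
      1 1 1] by simp_all

lemma root_coeff_sm_simps:
  "root_coeff I_sm (0,1,-1) = coeff3 (0,1,-1) (0,0,1) (-1,0,0) 1 0 0"
  "root_coeff I_sm (0,0,1) = coeff3 (0,1,-1) (0,0,1) (-1,0,0) 0 1 0"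
  "root_coeff I_sm (-1,0,0) = coeff3 (0,1,-1) (0,0,1) (-1,0,0) 0 0 1"
  "root_coeff I_sm (0,1,0) = coeff3 (0,1,-1) (0,0,1) (-1,0,0) 1 1 0"
  "root_coeff I_sm (0,1,1) = coeff3 (0,1,-1) (0,0,1) (-1,0,0) 1 2 0"
  "root_coeff I_sm (-1,0,1) = coeff3 (0,1,-1) (0,0,1) (-1,0,0) 0 1 1"
  "root_coeff I_sm (-1,1,0) = coeff3 (0,1,-1) (0,0,1) (-1,0,0) 1 1 1"
  using root_coeff_sm[of 0 1 0] root_coeff_sm[of 0 0 1] root_coeff_sm[of 1 0 0] root_coeff_sm[of 0 1 1]
      root_coeff_sm[of 0 1 2] root_coeff_sm[of 1 0 1] root_coeff_sm[of 1 1 1] by simp_all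

section \<open>Index pairs of the commutator formula\<close>

lemma (in linorder) sorted_key_list_of_set_eq:
  assumes "sorted_wrt (<) (map f xs)"
  shows "sorted_key_list_of_set f (set xs) = xs"
proof -
  have d: "distinct (map f xs)"
    using assms by (simp add: strict_sorted_iff)
  then interpret folding_insort_key "(\<le>)" "(<)" "set xs" f
    by unfold_locales (simp add: distinct_map)
  show ?thesis
    using sorted_key_list_of_set_unique[of "set xs" xs] assms d
    by (simp add: distinct_map distinct_card)
qed

lemma comm_idxI:
  assumes "{(a, b). a \<ge> 1 \<and> b \<ge> 1 \<and> a \<bullet> \<zeta> + b \<bullet> \<eta> \<in> Phi} = set xs"
    and "sorted_wrt (<) (map (\<lambda>(a, b). a \<bullet> \<zeta> + b \<bullet> \<eta>) xs)"
  shows "comm_idx \<zeta> \<eta> = xs"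
  unfolding comm_idx_def assms(1) by (rule sorted_key_list_of_set_eq[OF assms(2)])

text \<open>A computable form of \<open>comm_idx\<close>: between positive roots only these three
  pairs can occur, and this order of the list agrees with the lexicographic order of the resulting
  roots.\<close>

definition idx :: "root \<Rightarrow> root \<Rightarrow> (nat \<times> nat) list"
  where "idx \<zeta> \<eta> = filter (\<lambda>(a, b). a \<bullet> \<zeta> + b \<bullet> \<eta> \<in> Phi) [(1, 1), (1, 2), (2, 1)]"

lemma comm_idx_eq_idx:
  assumes "\<And>a b. a \<ge> 1 \<Longrightarrow> b \<ge> 1 \<Longrightarrow> a \<bullet> \<zeta> + b \<bullet> \<eta> \<in> Phi \<Longrightarrow> a + b \<le> 3"
    and "sorted_wrt (<) (map (\<lambda>(a, b). a \<bullet> \<zeta> + b \<bullet> \<eta>) (idx \<zeta> \<eta>))"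
  shows "comm_idx \<zeta> \<eta> = idx \<zeta> \<eta>"
proof (rule comm_idxI[OF _ assms(2)])
  have "(a, b) \<in> set [(1, 1), (1, 2), (2, 1)]"
    if "a \<ge> 1" "b \<ge> 1" "a \<bullet> \<zeta> + b \<bullet> \<eta> \<in> Phi" for a b :: nat
    using assms(1)[OF that] that by simp linarith
  then show "{(a, b). a \<ge> 1 \<and> b \<ge> 1 \<and> a \<bullet> \<zeta> + b \<bullet> \<eta> \<in> Phi} = set (idx \<zeta> \<eta>)"
    unfolding idx_def by auto
qed

lemma comm_idx_lg: "\<zeta> \<in> pos_roots I_lg \<Longrightarrow> \<eta> \<in> pos_roots I_lg \<Longrightarrow> comm_idx \<zeta> \<eta> = idx \<zeta> \<eta>"
  unfolding pos_roots_lg insert_iff empty_iff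
  by (elim disjE FalseE; hypsubst; rule comm_idx_eq_idx)
    (simp_all add: Phi_iff idx_def plus_prod_def, presburger+)

lemma comm_idx_sm: "\<zeta> \<in> pos_roots I_sm \<Longrightarrow> \<eta> \<in> pos_roots I_sm \<Longrightarrow> comm_idx \<zeta> \<eta> = idx \<zeta> \<eta>"
  unfolding pos_roots_sm insert_iff empty_iff
  by (elim disjE FalseE; hypsubst; rule comm_idx_eq_idx)
    (simp_all add: Phi_iff idx_def plus_prod_def, presburger+)

section \<open>Root elements in the spin representation\<close>

declare root_vec.simps [simp del]

lemma UNIV_fock: "(UNIV :: fock set) = {(True, True, True), (True, True, False), (True, False, True),
    (True, False, False), (False, True, True), (False, True, False), (False, False, True),
    (False, False, False)}"
  by (auto simp: set_eq_iff)

lemma sum_fock: "(\<Sum>k\<in>UNIV. f k) = f (True, True, True) + f (True, True, False) + f (True, False, True)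
    + f (True, False, False) + f (False, True, True) + f (False, True, False) + f (False, False, True)
    + (f (False, False, False) :: 'a::comm_monoid_add)" for f :: "bool \<times> bool \<times> bool \<Rightarrow> 'a::comm_monoid_add"
  unfolding UNIV_fock by (simp add: add_ac)

lemma all_fock: "(\<forall>s. P s) \<longleftrightarrow> P (True, True, True) \<and> P (True, True, False) \<and> P (True, False, True)
    \<and> P (True, False, False) \<and> P (False, True, True) \<and> P (False, True, False) \<and> P (False, False, True)
    \<and> P (False, False, False)"
  by (simp add: all_bool_eq)

lemma ex_fock: "(\<exists>s. P s) \<longleftrightarrow> P (True, True, True) \<or> P (True, True, False) \<or> P (True, False, True)
    \<or> P (True, False, False) \<or> P (False, True, True) \<or> P (False, True, False) \<or> P (False, False, True)
    \<or> P (False, False, False)"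
  using all_fock[of "\<lambda>s. \<not> P s"] by blast

lemma imul_ione [simp]: "A \<star> ione = A" "ione \<star> A = A"
  by (simp_all add: imul_def ione_def fun_eq_iff all_fock sum_fock)

lemma root_vec_eqI:
  "root_vec r = A \<Longrightarrow> \<forall>s s'. A s s' = f s s' \<Longrightarrow> \<forall>s s'. root_vec r s s' = f s s'"
  by simp

lemmas fock_eval = all_fock ex_fock imul_def transpose_mat_def sum_fock

lemma root_vec_a: "\<forall>s s'. root_vec (1,-1,0) s s' =
    (if (s, s') \<in> {((True, False, False), (False, True, False)), ((True, False, True), (False, True, True))}
        then 1 else 0)"
  by (rule root_vec_eqI[where A = "cre1 \<star> transpose_mat cre2"])
    (simp add: root_vec.simps raise_def lower_def, simp add: fock_eval del: split_paired_All)

lemma root_vec_b: "\<forall>s s'. root_vec (0,1,-1) s s' =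
    (if (s, s') \<in> {((False, True, False), (False, False, True)), ((True, True, False), (True, False, True))}
        then 1 else 0)"
  by (rule root_vec_eqI[where A = "cre2 \<star> transpose_mat cre3"])
    (simp add: root_vec.simps raise_def lower_def, simp add: fock_eval del: split_paired_All)

lemma root_vec_c: "\<forall>s s'. root_vec (0,0,1) s s' =
    (if (s, s') \<in> {((False, False, True), (False, False, False)), ((True, True, True), (True, True, False))} then 1
    else if (s, s') \<in> {((False, True, True), (False, True, False)), ((True, False, True), (True, False, False))}
        then -1 else 0)"
  by (rule root_vec_eqI[where A = "cre3"])
    (simp add: root_vec.simps raise_def lower_def, simp add: fock_eval del: split_paired_All)

lemma root_vec_ab: "\<forall>s s'. root_vec (1,0,-1) s s' =
    (if (s, s') \<in> {((True, False, False), (False, False, True))} then 1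
    else if (s, s') \<in> {((True, True, False), (False, True, True))} then -1 else 0)"
  by (rule root_vec_eqI[where A = "cre1 \<star> transpose_mat cre3"])
    (simp add: root_vec.simps raise_def lower_def, simp add: fock_eval del: split_paired_All)

lemma root_vec_bc: "\<forall>s s'. root_vec (0,1,0) s s' =
    (if (s, s') \<in> {((False, True, False), (False, False, False)), ((False, True, True), (False, False, True))} then 1
    else if (s, s') \<in> {((True, True, False), (True, False, False)), ((True, True, True), (True, False, True))}
        then -1 else 0)"
  by (rule root_vec_eqI[where A = "cre2"])
    (simp add: root_vec.simps raise_def lower_def, simp add: fock_eval del: split_paired_All)

lemma root_vec_bcc: "\<forall>s s'. root_vec (0,1,1) s s' =
    (if (s, s') \<in> {((False, True, True), (False, False, False)), ((True, True, True), (True, False, False))}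
        then 1 else 0)"
  by (rule root_vec_eqI[where A = "cre2 \<star> cre3"])
    (simp add: root_vec.simps raise_def lower_def, simp add: fock_eval del: split_paired_All)

lemma root_vec_abc: "\<forall>s s'. root_vec (1,0,0) s s' =
    (if (s, s') \<in> {((True, False, False), (False, False, False)), ((True, False, True), (False, False, True)),
        ((True, True, False), (False, True, False)), ((True, True, True), (False, True, True))} then 1 else 0)"
  by (rule root_vec_eqI[where A = "cre1"])
    (simp add: root_vec.simps raise_def lower_def, simp add: fock_eval del: split_paired_All)

lemma root_vec_abcc: "\<forall>s s'. root_vec (1,0,1) s s' =
    (if (s, s') \<in> {((True, False, True), (False, False, False))} then 1
    else if (s, s') \<in> {((True, True, True), (False, True, False))} then -1 else 0)"
  by (rule root_vec_eqI[where A = "cre1 \<star> cre3"])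
    (simp add: root_vec.simps raise_def lower_def, simp add: fock_eval del: split_paired_All)

lemma root_vec_abbcc: "\<forall>s s'. root_vec (1,1,0) s s' =
    (if (s, s') \<in> {((True, True, False), (False, False, False)), ((True, True, True), (False, False, True))}
        then 1 else 0)"
  by (rule root_vec_eqI[where A = "cre1 \<star> cre2"])
    (simp add: root_vec.simps raise_def lower_def, simp add: fock_eval del: split_paired_All)

lemma root_vec_o: "\<forall>s s'. root_vec (-1,0,0) s s' =
    (if (s, s') \<in> {((False, False, False), (True, False, False)), ((False, False, True), (True, False, True)),
        ((False, True, False), (True, True, False)), ((False, True, True), (True, True, True))} then 1 else 0)"
  by (rule root_vec_eqI[where A = "transpose_mat cre1"])
    (simp add: root_vec.simps raise_def lower_def, simp add: fock_eval del: split_paired_All)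

lemma root_vec_po: "\<forall>s s'. root_vec (-1,0,1) s s' =
    (if (s, s') \<in> {((False, False, True), (True, False, False))} then 1
    else if (s, s') \<in> {((False, True, True), (True, True, False))} then -1 else 0)"
  by (rule root_vec_eqI[where A = "cre3 \<star> transpose_mat cre1"])
    (simp add: root_vec.simps raise_def lower_def, simp add: fock_eval del: split_paired_All)

lemma root_vec_bpo: "\<forall>s s'. root_vec (-1,1,0) s s' =
    (if (s, s') \<in> {((False, True, False), (True, False, False)), ((False, True, True), (True, False, True))}
        then 1 else 0)"
  by (rule root_vec_eqI[where A = "cre2 \<star> transpose_mat cre1"])
    (simp add: root_vec.simps raise_def lower_def, simp add: fock_eval del: split_paired_All)

lemmas root_vecs = root_vec_a root_vec_b root_vec_c root_vec_ab root_vec_bc root_vec_bcc root_vec_abc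
    root_vec_abcc root_vec_abbcc root_vec_o root_vec_po root_vec_bpo

section \<open>Structure constants\<close>

lemma lie_constI:
  assumes "\<forall>i j. (root_vec \<zeta> \<star> root_vec \<eta>) i j - (root_vec \<eta> \<star> root_vec \<zeta>) i j = n * root_vec (\<zeta> + \<eta>) i j"
    and "\<exists>i j. root_vec (\<zeta> + \<eta>) i j \<noteq> 0"
  shows "lie_const \<zeta> \<eta> = n"
  unfolding lie_const_def
proof (rule the_equality)
  fix m assume "\<forall>i j. (root_vec \<zeta> \<star> root_vec \<eta>) i j - (root_vec \<eta> \<star> root_vec \<zeta>) i j = m * root_vec (\<zeta> + \<eta>) i j"
  moreover obtain i j where "root_vec (\<zeta> + \<eta>) i j \<noteq> 0" using assms(2) by blast
  ultimately have "m * root_vec (\<zeta> + \<eta>) i j = n * root_vec (\<zeta> + \<eta>) i j"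
    using assms(1) by metis
  then show "m = n" using \<open>root_vec (\<zeta> + \<eta>) i j \<noteq> 0\<close> by simp
qed (use assms(1) in blast)

lemma lie_const_values:
  "lie_const (1,-1,0) (0,1,-1) = 1"
  "lie_const (1,-1,0) (0,1,0) = 1"
  "lie_const (1,-1,0) (0,1,1) = 1"
  "lie_const (0,1,-1) (1,-1,0) = -1"
  "lie_const (0,1,-1) (0,0,1) = 1"
  "lie_const (0,1,-1) (1,0,1) = 1"
  "lie_const (0,0,1) (0,1,-1) = -1"
  "lie_const (0,0,1) (1,0,-1) = -1"
  "lie_const (0,0,1) (0,1,0) = -2"
  "lie_const (0,0,1) (1,0,0) = -2"
  "lie_const (1,0,-1) (0,0,1) = 1"
  "lie_const (1,0,-1) (0,1,1) = -1"
  "lie_const (0,1,0) (1,-1,0) = -1"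
  "lie_const (0,1,0) (0,0,1) = 2"
  "lie_const (0,1,0) (1,0,0) = -2"
  "lie_const (0,1,1) (1,-1,0) = -1"
  "lie_const (0,1,1) (1,0,-1) = 1"
  "lie_const (1,0,0) (0,0,1) = 2"
  "lie_const (1,0,0) (0,1,0) = 2"
  "lie_const (1,0,1) (0,1,-1) = -1"
  "lie_const (0,1,-1) (-1,0,1) = 1"
  "lie_const (0,0,1) (-1,0,0) = 2"
  "lie_const (-1,0,0) (0,0,1) = -2"
  "lie_const (-1,0,0) (0,1,0) = -2"
  "lie_const (0,1,0) (-1,0,0) = 2"
  "lie_const (-1,0,1) (0,1,-1) = -1"
  by (rule lie_constI; simp add: plus_prod_def fock_eval root_vecs del: split_paired_All split_paired_Ex)+

text \<open>The root element applied to a vector over an arbitrary commutative ring. With a symbolic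
  vector, an identity of matrices becomes eight polynomial identities, one for each
  coordinate.\<close>

definition act :: "root \<Rightarrow> 'r::comm_ring_1 \<Rightarrow> (fock \<Rightarrow> 'r) \<Rightarrow> fock \<Rightarrow> 'r"
  where "act \<zeta> t v s = v s + t * (\<Sum>k\<in>UNIV. of_int (root_vec \<zeta> s k) * v k)"

lemma act_a:
  "act (1,-1,0) t v (True, True, True) = v (True, True, True)"
  "act (1,-1,0) t v (True, True, False) = v (True, True, False)"
  "act (1,-1,0) t v (True, False, True) = v (True, False, True) + t * v (False, True, True)"
  "act (1,-1,0) t v (True, False, False) = v (True, False, False) + t * v (False, True, False)"
  "act (1,-1,0) t v (False, True, True) = v (False, True, True)"
  "act (1,-1,0) t v (False, True, False) = v (False, True, False)"
  "act (1,-1,0) t v (False, False, True) = v (False, False, True)"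
  "act (1,-1,0) t v (False, False, False) = v (False, False, False)"
  by (simp_all add: act_def sum_fock root_vec_a)

lemma act_b:
  "act (0,1,-1) t v (True, True, True) = v (True, True, True)"
  "act (0,1,-1) t v (True, True, False) = v (True, True, False) + t * v (True, False, True)"
  "act (0,1,-1) t v (True, False, True) = v (True, False, True)"
  "act (0,1,-1) t v (True, False, False) = v (True, False, False)"
  "act (0,1,-1) t v (False, True, True) = v (False, True, True)"
  "act (0,1,-1) t v (False, True, False) = v (False, True, False) + t * v (False, False, True)"
  "act (0,1,-1) t v (False, False, True) = v (False, False, True)"
  "act (0,1,-1) t v (False, False, False) = v (False, False, False)"
  by (simp_all add: act_def sum_fock root_vec_b)

lemma act_c:
  "act (0,0,1) t v (True, True, True) = v (True, True, True) + t * v (True, True, False)"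
  "act (0,0,1) t v (True, True, False) = v (True, True, False)"
  "act (0,0,1) t v (True, False, True) = v (True, False, True) - t * v (True, False, False)"
  "act (0,0,1) t v (True, False, False) = v (True, False, False)"
  "act (0,0,1) t v (False, True, True) = v (False, True, True) - t * v (False, True, False)"
  "act (0,0,1) t v (False, True, False) = v (False, True, False)"
  "act (0,0,1) t v (False, False, True) = v (False, False, True) + t * v (False, False, False)"
  "act (0,0,1) t v (False, False, False) = v (False, False, False)"
  by (simp_all add: act_def sum_fock root_vec_c)

lemma act_ab:
  "act (1,0,-1) t v (True, True, True) = v (True, True, True)"
  "act (1,0,-1) t v (True, True, False) = v (True, True, False) - t * v (False, True, True)"
  "act (1,0,-1) t v (True, False, True) = v (True, False, True)"
  "act (1,0,-1) t v (True, False, False) = v (True, False, False) + t * v (False, False, True)"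
  "act (1,0,-1) t v (False, True, True) = v (False, True, True)"
  "act (1,0,-1) t v (False, True, False) = v (False, True, False)"
  "act (1,0,-1) t v (False, False, True) = v (False, False, True)"
  "act (1,0,-1) t v (False, False, False) = v (False, False, False)"
  by (simp_all add: act_def sum_fock root_vec_ab)

lemma act_bc:
  "act (0,1,0) t v (True, True, True) = v (True, True, True) - t * v (True, False, True)"
  "act (0,1,0) t v (True, True, False) = v (True, True, False) - t * v (True, False, False)"
  "act (0,1,0) t v (True, False, True) = v (True, False, True)"
  "act (0,1,0) t v (True, False, False) = v (True, False, False)"
  "act (0,1,0) t v (False, True, True) = v (False, True, True) + t * v (False, False, True)"
  "act (0,1,0) t v (False, True, False) = v (False, True, False) + t * v (False, False, False)"
  "act (0,1,0) t v (False, False, True) = v (False, False, True)"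
  "act (0,1,0) t v (False, False, False) = v (False, False, False)"
  by (simp_all add: act_def sum_fock root_vec_bc)

lemma act_bcc:
  "act (0,1,1) t v (True, True, True) = v (True, True, True) + t * v (True, False, False)"
  "act (0,1,1) t v (True, True, False) = v (True, True, False)"
  "act (0,1,1) t v (True, False, True) = v (True, False, True)"
  "act (0,1,1) t v (True, False, False) = v (True, False, False)"
  "act (0,1,1) t v (False, True, True) = v (False, True, True) + t * v (False, False, False)"
  "act (0,1,1) t v (False, True, False) = v (False, True, False)"
  "act (0,1,1) t v (False, False, True) = v (False, False, True)"
  "act (0,1,1) t v (False, False, False) = v (False, False, False)"
  by (simp_all add: act_def sum_fock root_vec_bcc)

lemma act_abc:
  "act (1,0,0) t v (True, True, True) = v (True, True, True) + t * v (False, True, True)"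
  "act (1,0,0) t v (True, True, False) = v (True, True, False) + t * v (False, True, False)"
  "act (1,0,0) t v (True, False, True) = v (True, False, True) + t * v (False, False, True)"
  "act (1,0,0) t v (True, False, False) = v (True, False, False) + t * v (False, False, False)"
  "act (1,0,0) t v (False, True, True) = v (False, True, True)"
  "act (1,0,0) t v (False, True, False) = v (False, True, False)"
  "act (1,0,0) t v (False, False, True) = v (False, False, True)"
  "act (1,0,0) t v (False, False, False) = v (False, False, False)"
  by (simp_all add: act_def sum_fock root_vec_abc)

lemma act_abcc:
  "act (1,0,1) t v (True, True, True) = v (True, True, True) - t * v (False, True, False)"
  "act (1,0,1) t v (True, True, False) = v (True, True, False)"
  "act (1,0,1) t v (True, False, True) = v (True, False, True) + t * v (False, False, False)"
  "act (1,0,1) t v (True, False, False) = v (True, False, False)"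
  "act (1,0,1) t v (False, True, True) = v (False, True, True)"
  "act (1,0,1) t v (False, True, False) = v (False, True, False)"
  "act (1,0,1) t v (False, False, True) = v (False, False, True)"
  "act (1,0,1) t v (False, False, False) = v (False, False, False)"
  by (simp_all add: act_def sum_fock root_vec_abcc)

lemma act_abbcc:
  "act (1,1,0) t v (True, True, True) = v (True, True, True) + t * v (False, False, True)"
  "act (1,1,0) t v (True, True, False) = v (True, True, False) + t * v (False, False, False)"
  "act (1,1,0) t v (True, False, True) = v (True, False, True)"
  "act (1,1,0) t v (True, False, False) = v (True, False, False)"
  "act (1,1,0) t v (False, True, True) = v (False, True, True)"
  "act (1,1,0) t v (False, True, False) = v (False, True, False)"
  "act (1,1,0) t v (False, False, True) = v (False, False, True)"
  "act (1,1,0) t v (False, False, False) = v (False, False, False)"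
  by (simp_all add: act_def sum_fock root_vec_abbcc)

lemma act_o:
  "act (-1,0,0) t v (True, True, True) = v (True, True, True)"
  "act (-1,0,0) t v (True, True, False) = v (True, True, False)"
  "act (-1,0,0) t v (True, False, True) = v (True, False, True)"
  "act (-1,0,0) t v (True, False, False) = v (True, False, False)"
  "act (-1,0,0) t v (False, True, True) = v (False, True, True) + t * v (True, True, True)"
  "act (-1,0,0) t v (False, True, False) = v (False, True, False) + t * v (True, True, False)"
  "act (-1,0,0) t v (False, False, True) = v (False, False, True) + t * v (True, False, True)"
  "act (-1,0,0) t v (False, False, False) = v (False, False, False) + t * v (True, False, False)"
  by (simp_all add: act_def sum_fock root_vec_o)

lemma act_po:
  "act (-1,0,1) t v (True, True, True) = v (True, True, True)"
  "act (-1,0,1) t v (True, True, False) = v (True, True, False)"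
  "act (-1,0,1) t v (True, False, True) = v (True, False, True)"
  "act (-1,0,1) t v (True, False, False) = v (True, False, False)"
  "act (-1,0,1) t v (False, True, True) = v (False, True, True) - t * v (True, True, False)"
  "act (-1,0,1) t v (False, True, False) = v (False, True, False)"
  "act (-1,0,1) t v (False, False, True) = v (False, False, True) + t * v (True, False, False)"
  "act (-1,0,1) t v (False, False, False) = v (False, False, False)"
  by (simp_all add: act_def sum_fock root_vec_po)

lemma act_bpo:
  "act (-1,1,0) t v (True, True, True) = v (True, True, True)"
  "act (-1,1,0) t v (True, True, False) = v (True, True, False)"
  "act (-1,1,0) t v (True, False, True) = v (True, False, True)"
  "act (-1,1,0) t v (True, False, False) = v (True, False, False)"
  "act (-1,1,0) t v (False, True, True) = v (False, True, True) + t * v (True, False, True)"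
  "act (-1,1,0) t v (False, True, False) = v (False, True, False) + t * v (True, False, False)"
  "act (-1,1,0) t v (False, False, True) = v (False, False, True)"
  "act (-1,1,0) t v (False, False, False) = v (False, False, False)"
  by (simp_all add: act_def sum_fock root_vec_bpo)

lemmas acts = act_a act_b act_c act_ab act_bc act_bcc act_abc act_abcc act_abbcc act_o act_po act_bpo

section \<open>Words acting on vectors\<close>

definition wact :: "(root \<times> 'r::comm_ring_1) list \<Rightarrow> (fock \<Rightarrow> 'r) \<Rightarrow> fock \<Rightarrow> 'r"
  where "wact w = foldr (\<lambda>(r, t). act r t) w"

lemma wact_simps [simp]:
  "wact [] v = v"
  "wact ((r, t) # w) v = act r t (wact w v)"
  "wact (w @ w') v = wact w (wact w' v)"
  by (simp_all add: wact_def)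

definition neg_word :: "('b \<times> 'r::uminus) list \<Rightarrow> ('b \<times> 'r) list"
  where "neg_word w = rev (map (\<lambda>(r, t). (r, - t)) w)"

definition steinberg_rhs :: "root \<Rightarrow> root \<Rightarrow> 'r::comm_ring_1 \<Rightarrow> 'r \<Rightarrow> (root \<times> 'r) list"
  where "steinberg_rhs \<zeta> \<eta> t u =
    map (\<lambda>(a, b). (a \<bullet> \<zeta> + b \<bullet> \<eta>, of_int (struct_const \<zeta> \<eta> a b) * (t ^ a * u ^ b))) (idx \<zeta> \<eta>)"

definition comm_word :: "'b \<times> 'r::uminus \<Rightarrow> 'b \<times> 'r \<Rightarrow> ('b \<times> 'r) list"
  where "comm_word x y = [x, y] @ neg_word [x] @ neg_word [y]"

lemma fock_funI: "(\<forall>s. f s = g s) \<Longrightarrow> f = g"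
  by blast

lemmas word_eval = comm_word_def neg_word_def all_fock acts

lemma wact_add:
  assumes "\<zeta> \<in> pos_roots I_lg \<union> pos_roots I_sm"
  shows "wact [(\<zeta>, t), (\<zeta>, u), (\<zeta>, - (t + u))] v = v"
  using assms unfolding pos_roots_lg pos_roots_sm Un_iff insert_iff empty_iff
  by (elim disjE FalseE; hypsubst; intro fock_funI) (simp_all add: word_eval algebra_simps del: split_paired_All)

lemmas steinberg_eval = steinberg_rhs_def idx_def struct_const_def lie_const_values Phi_iff plus_prod_def
  word_eval power2_eq_square algebra_simps

text \<open>The coordinates are compared symbolically for each pair of roots in a rank two
  subsystem, so the relation is available over every K[x]/(f) at once.\<close>

lemma wact_steinberg:
  assumes "S \<in> pairs I_lg \<union> pairs I_sm" "\<zeta> \<in> pos_roots S" "\<eta> \<in> pos_roots S"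
  shows "wact (comm_word (\<zeta>, t) (\<eta>, u) @ neg_word (steinberg_rhs \<zeta> \<eta> t u)) v = v"
proof -
  have
    "\<zeta> \<in> {(1,-1,0), (0,1,-1), (1,0,-1)} \<and> \<eta> \<in> {(1,-1,0), (0,1,-1), (1,0,-1)} \<or>
     \<zeta> \<in> {(0,1,-1), (0,0,1), (0,1,0), (0,1,1)} \<and> \<eta> \<in> {(0,1,-1), (0,0,1), (0,1,0), (0,1,1)} \<or>
     \<zeta> \<in> {(1,-1,0), (0,0,1)} \<and> \<eta> \<in> {(1,-1,0), (0,0,1)} \<or>
     \<zeta> \<in> {(0,0,1), (-1,0,0), (-1,0,1)} \<and> \<eta> \<in> {(0,0,1), (-1,0,0), (-1,0,1)} \<or>
     \<zeta> \<in> {(0,1,-1), (-1,0,0)} \<and> \<eta> \<in> {(0,1,-1), (-1,0,0)}"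
    using assms unfolding pairs_lg pairs_sm Un_iff insert_iff[of S] empty_iff
    by (elim disjE FalseE; hypsubst)
      (simp_all only: pos_roots_ab pos_roots_bc pos_roots_ac pos_roots_co pos_roots_bo simp_thms)
  then show ?thesis
    unfolding insert_iff empty_iff
    by (elim disjE conjE FalseE; hypsubst; intro fock_funI)
      (simp_all add: steinberg_eval del: split_paired_All)
qed

lemma wact_alias_sm: "wact (comm_word ((0,1,-1), t) ((-1,0,1), u)) v = act (-1,1,0) (t * u) v"
  by (intro fock_funI) (simp add: word_eval algebra_simps del: split_paired_All)

lemma wact_alias_lg:
  "wact (comm_word ((1,-1,0), t) ((0,1,1), u)) v = act (1,0,1) (t * u) v"
  "wact (comm_word ((1,0,-1), t) ((0,1,1), - u)) v = act (1,1,0) (t * u) v"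
  by (intro fock_funI; simp add: word_eval algebra_simps del: split_paired_All)+

text \<open>The first commutator has the unwanted factor -t u^2 at \<alpha> + \<beta> + 2\<psi>; any
  t' and u' with product t u^2 cancel it.\<close>

lemma wact_alias_lg':
  fixes t :: "'r::comm_ring_1"
  assumes "t' * u' = t * u\<^sup>2"
  shows "wact (comm_word ((1,0,-1), t) ((0,0,1), u) @ comm_word ((1,-1,0), t') ((0,1,1), u')) v
    = act (1,0,0) (t * u) v"
proof -
  have "wact (comm_word ((1,0,-1), t) ((0,0,1), u)) v = act (1,0,0) (t * u) (act (1,0,1) (- (t * u\<^sup>2)) v)" for v
    by (intro fock_funI) (simp add: word_eval algebra_simps power2_eq_square del: split_paired_All)
  moreover have "act (1,0,1) (- s) (act (1,0,1) s v) = v" for s :: 'r and v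
    by (intro fock_funI) (simp add: word_eval algebra_simps del: split_paired_All)
  ultimately show ?thesis
    by (simp add: wact_alias_lg assms)
qed

text \<open>In this order the words give the five lift assumptions of \<open>large\<close>. Their
  coefficients are integers, so that each word makes sense over every subfield F.\<close>

definition base_words_lg :: "(root \<times> int) list list"
  where "base_words_lg =
   [comm_word ((1,0,-1), 1) ((0,1,0), 1),
    comm_word ((1,0,-1), 1) ((0,0,1), 1) @ comm_word ((1,0,-1), 1) ((0,0,1), -1)
      @ comm_word ((0,1,1), -2) ((1,-1,0), 1),
    [((0,1,0), 1)] @ comm_word ((1,-1,0), 1) ((0,1,1), 1) @ [((0,1,0), -1)]
      @ comm_word ((0,1,1), 1) ((1,-1,0), 1),
    [((1,0,-1), 1)] @ comm_word ((1,-1,0), 1) ((0,1,1), 1) @ [((1,0,-1), -1)]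
      @ comm_word ((0,1,1), 1) ((1,-1,0), 1),
    comm_word ((1,0,-1), 1) ((0,0,1), 1) @ comm_word ((1,-1,0), 1) ((0,1,1), 1)
      @ comm_word ((0,1,1), -1) ((1,0,-1), 1) @ comm_word ((0,1,0), 1) ((1,-1,0), 1)]"

definition base_words_sm :: "(root \<times> int) list list"
  where "base_words_sm =
   [comm_word ((0,1,0), 1) ((-1,0,0), 1) @ comm_word ((-1,0,1), 2) ((0,1,-1), 1),
    comm_word ((0,1,1), 1) ((-1,0,0), 1),
    comm_word ((0,1,0), 1) ((-1,0,1), 1)]"

lemma wact_base_words:
  assumes "w \<in> set (base_words_lg @ base_words_sm)"
  shows "wact (map (\<lambda>(r, n). (r, of_int n)) w) (v :: fock \<Rightarrow> 'r::comm_ring_1) = v"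
  using assms unfolding base_words_lg_def base_words_sm_def set_append Un_iff list.set insert_iff empty_iff
  by (elim disjE FalseE; hypsubst; intro fock_funI)
    (simp_all add: word_eval algebra_simps del: split_paired_All)

section \<open>Families of ring elements\<close>

text \<open>Invertibility of 2, in contrast to 2 being nonzero, is inherited by the quotients
  K[x]/(f); see \<open>good_poly_quot\<close>.\<close>

definition good :: "'b ring \<Rightarrow> bool"
  where "good R \<longleftrightarrow> cring R \<and> \<one>\<^bsub>R\<^esub> \<oplus>\<^bsub>R\<^esub> \<one>\<^bsub>R\<^esub> \<in> Units R"

text \<open>The rational component ensures $0 \ne 1$, and the value \<open>undefined\<close> outside the good rings makes equality
  a statement about good rings only.\<close>

typedef ('b, 'c) fam = "{(q :: rat, g :: 'b ring \<times> 'c \<Rightarrow> 'b).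
    \<forall>x. if good (fst x) then g x \<in> carrier (fst x) else g x = undefined}"
  by (rule exI[of _ "(0, \<lambda>x. if good (fst x) then \<zero>\<^bsub>fst x\<^esub> else undefined)"])
    (auto simp: good_def cring_def intro: ring.ring_simprules)

lemma Rep_fam_spec: "if good (fst x) then snd (Rep_fam f) x \<in> carrier (fst x) else snd (Rep_fam f) x = undefined"
  using Rep_fam[of f] unfolding mem_Collect_eq case_prod_beta by blast

definition qpart :: "('b, 'c) fam \<Rightarrow> rat"
  where "qpart f = fst (Rep_fam f)"

definition proj :: "'b ring \<times> 'c \<Rightarrow> ('b, 'c) fam \<Rightarrow> 'b"
  where "proj x f = snd (Rep_fam f) x"

text \<open>Values outside the carrier are replaced by zero, so that any function may be used to
  define a family.\<close>

definition mk :: "rat \<Rightarrow> ('b ring \<times> 'c \<Rightarrow> 'b) \<Rightarrow> ('b, 'c) fam"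
  where "mk q g = Abs_fam (q, \<lambda>x. if good (fst x) then if g x \<in> carrier (fst x) then g x else \<zero>\<^bsub>fst x\<^esub>
    else undefined)"

lemma goodD: "good R \<Longrightarrow> cring R"
  by (simp add: good_def)

lemma Rep_mk: "Rep_fam (mk q g) = (q, \<lambda>x. if good (fst x) then if g x \<in> carrier (fst x) then g x else \<zero>\<^bsub>fst x\<^esub>
    else undefined)"
  unfolding mk_def by (rule Abs_fam_inverse) (auto simp: good_def cring_def intro: ring.ring_simprules)

lemma qpart_mk [simp]: "qpart (mk q g) = q"
  by (simp add: qpart_def Rep_mk)

lemma proj_mk: "good (fst x) \<Longrightarrow> g x \<in> carrier (fst x) \<Longrightarrow> proj x (mk q g) = g x"
  by (simp add: proj_def Rep_mk)

lemma proj_closed [simp, intro]: "good (fst x) \<Longrightarrow> proj x f \<in> carrier (fst x)"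
  using Rep_fam_spec[of x f] by (simp add: proj_def)

lemma fam_eqI:
  assumes "qpart f = qpart g" "\<And>x. good (fst x) \<Longrightarrow> proj x f = proj x g"
  shows "f = g"
proof -
  have "snd (Rep_fam f) x = snd (Rep_fam g) x" for x
    using assms(2)[of x] Rep_fam_spec[of x f] Rep_fam_spec[of x g]
    by (cases "good (fst x)") (simp_all add: proj_def)
  with assms(1) show ?thesis
    by (intro Rep_fam_inject[THEN iffD1] prod_eqI) (auto simp: qpart_def)
qed

instantiation fam :: (type, type) comm_ring_1
begin

definition "0 = mk 0 (\<lambda>x. \<zero>\<^bsub>fst x\<^esub>)"
definition "1 = mk 1 (\<lambda>x. \<one>\<^bsub>fst x\<^esub>)"
definition "f + g = mk (qpart f + qpart g) (\<lambda>x. proj x f \<oplus>\<^bsub>fst x\<^esub> proj x g)"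
definition "- f = mk (- qpart f) (\<lambda>x. \<ominus>\<^bsub>fst x\<^esub> proj x f)"
definition "f - g = mk (qpart f - qpart g) (\<lambda>x. proj x f \<oplus>\<^bsub>fst x\<^esub> \<ominus>\<^bsub>fst x\<^esub> proj x g)"
definition "f * g = mk (qpart f * qpart g) (\<lambda>x. proj x f \<otimes>\<^bsub>fst x\<^esub> proj x g)"

lemma qpart_simps [simp]: "qpart 0 = 0" "qpart 1 = 1" "qpart (f + g) = qpart f + qpart g"
  "qpart (- f) = - qpart f" "qpart (f - g) = qpart f - qpart g" "qpart (f * g) = qpart f * qpart g"
  by (simp_all add: zero_fam_def one_fam_def plus_fam_def uminus_fam_def minus_fam_def times_fam_def)

lemma proj_simps:
  assumes "good (fst x)"
  shows "proj x 0 = \<zero>\<^bsub>fst x\<^esub>" "proj x 1 = \<one>\<^bsub>fst x\<^esub>" "proj x (f + g) = proj x f \<oplus>\<^bsub>fst x\<^esub> proj x g"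
    "proj x (- f) = \<ominus>\<^bsub>fst x\<^esub> proj x f" "proj x (f - g) = proj x f \<oplus>\<^bsub>fst x\<^esub> \<ominus>\<^bsub>fst x\<^esub> proj x g"
    "proj x (f * g) = proj x f \<otimes>\<^bsub>fst x\<^esub> proj x g"
proof -
  interpret cring "fst x" by (rule goodD) fact
  show "proj x 0 = \<zero>\<^bsub>fst x\<^esub>" "proj x 1 = \<one>\<^bsub>fst x\<^esub>" "proj x (f + g) = proj x f \<oplus>\<^bsub>fst x\<^esub> proj x g"
    "proj x (- f) = \<ominus>\<^bsub>fst x\<^esub> proj x f" "proj x (f - g) = proj x f \<oplus>\<^bsub>fst x\<^esub> \<ominus>\<^bsub>fst x\<^esub> proj x g"
    "proj x (f * g) = proj x f \<otimes>\<^bsub>fst x\<^esub> proj x g"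
    using assms
    by (simp_all add: zero_fam_def one_fam_def plus_fam_def uminus_fam_def minus_fam_def times_fam_def
        proj_mk)
qed

instance
proof
  fix f g k :: "('a, 'b) fam"
  show "(0 :: ('a, 'b) fam) \<noteq> 1"
    using qpart_simps(1,2) by (metis zero_neq_one)
  show "f + g + k = f + (g + k)" "f + g = g + f" "0 + f = f" "- f + f = 0" "f - g = f + - g"
    "f * g * k = f * (g * k)" "f * g = g * f" "1 * f = f" "(f + g) * k = f * k + g * k"
  proof -
    have c: "cring (fst x)" if "good (fst x)" for x :: "'a ring \<times> 'b"
      using that by (rule goodD)
    note s = proj_simps cring.cring_simprules[OF c] algebra_simps
    show "f + g + k = f + (g + k)" by (rule fam_eqI) (simp_all add: s)
    show "f + g = g + f" by (rule fam_eqI) (simp_all add: s)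
    show "0 + f = f" by (rule fam_eqI) (simp_all add: s)
    show "- f + f = 0" by (rule fam_eqI) (simp_all add: s)
    show "f - g = f + - g" by (rule fam_eqI) (simp_all add: s)
    show "f * g * k = f * (g * k)" by (rule fam_eqI) (simp_all add: s)
    show "f * g = g * f" by (rule fam_eqI) (simp_all add: s)
    show "1 * f = f"
    proof (rule fam_eqI)
      fix x :: "'a ring \<times> 'b" assume x: "good (fst x)"
      then interpret cring "fst x" by (rule goodD)
      show "proj x (1 * f) = proj x f" using x by (simp add: proj_simps)
    qed simp
    show "(f + g) * k = f * k + g * k" by (rule fam_eqI) (simp_all add: s)
  qed
qed

end

text \<open>The extra component has to be halved as well, which is why it is rational and not an
  integer.\<close>

definition half :: "('b, 'c) fam"
  where "half = mk (1 / 2) (\<lambda>x. inv\<^bsub>fst x\<^esub> (\<one>\<^bsub>fst x\<^esub> \<oplus>\<^bsub>fst x\<^esub> \<one>\<^bsub>fst x\<^esub>))"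

lemma half: "2 * half = (1 :: ('b, 'c) fam)"
proof (rule fam_eqI)
  show "qpart (2 * half) = qpart (1 :: ('b, 'c) fam)"
    unfolding mult_2 qpart_simps half_def qpart_mk by simp
  fix x :: "'b ring \<times> 'c" assume x: "good (fst x)"
  then interpret cring "fst x" by (rule goodD)
  let ?two = "\<one>\<^bsub>fst x\<^esub> \<oplus>\<^bsub>fst x\<^esub> \<one>\<^bsub>fst x\<^esub>"
  have u: "?two \<in> Units (fst x)" using x by (simp add: good_def)
  have p: "proj x (half :: ('b, 'c) fam) = inv\<^bsub>fst x\<^esub> ?two"
    unfolding half_def using x u by (simp add: proj_mk)
  have "(2 :: ('b, 'c) fam) = 1 + 1" by simp
  then have "proj x (2 :: ('b, 'c) fam) = ?two"
    using x by (simp only: proj_simps)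
  then show "proj x (2 * half) = proj x (1 :: ('b, 'c) fam)"
    using x u by (simp add: proj_simps p)
qed

lemma proj_sum:
  assumes "good (fst x)" "finite A"
  shows "proj x (sum f A) = (\<Oplus>\<^bsub>fst x\<^esub>k\<in>A. proj x (f k))"
proof -
  interpret cring "fst x" by (rule goodD) fact
  show ?thesis
    using assms(2) by induction (use assms(1) in \<open>simp_all add: proj_simps\<close>)
qed

lemma proj_power: "good (fst x) \<Longrightarrow> proj x (t ^ n) = proj x t [^]\<^bsub>fst x\<^esub> n"
proof -
  assume g: "good (fst x)"
  then interpret cring "fst x" by (rule goodD)
  show ?thesis
    by (induction n) (use g in \<open>simp_all add: proj_simps m_comm\<close>)
qed

lemma proj_of_int: "good (fst x) \<Longrightarrow> proj x (of_int n) = [n] \<cdot>\<^bsub>fst x\<^esub> \<one>\<^bsub>fst x\<^esub>"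
proof -
  assume g: "good (fst x)"
  then interpret cring "fst x" by (rule goodD)
  have nat: "proj x (of_nat n) = [n] \<cdot>\<^bsub>fst x\<^esub> \<one>\<^bsub>fst x\<^esub>" for n :: nat
    by (induction n) (use g in \<open>simp_all add: proj_simps a_comm\<close>)
  show ?thesis
  proof (cases n)
    case (nonneg m)
    then show ?thesis by (simp add: nat add_pow_def int_pow_int)
  next
    case (neg m)
    then have n: "n = - int (Suc m)" by simp
    have "n < 0" "nat (- n) = Suc m" by (simp_all add: n)
    then have "[n] \<cdot>\<^bsub>fst x\<^esub> \<one>\<^bsub>fst x\<^esub> = \<ominus>\<^bsub>fst x\<^esub> ([Suc m] \<cdot>\<^bsub>fst x\<^esub> \<one>\<^bsub>fst x\<^esub>)"
      by (simp only: add_pow_int_lt)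
    then show ?thesis
      unfolding n of_int_minus proj_simps(4)[OF g] of_int_of_nat_eq nat by (rule sym)
  qed
qed

lemma proj_of_int_mult: "good (fst x) \<Longrightarrow> proj x (of_int n * t) = [n] \<cdot>\<^bsub>fst x\<^esub> proj x t"
proof -
  assume g: "good (fst x)"
  then interpret cring "fst x" by (rule goodD)
  show ?thesis
    using g by (simp add: proj_simps(6) proj_of_int add_pow_ldistr_int)
qed


section \<open>Matrices over the ring of families\<close>

definition mat_one :: "'r::comm_ring_1 mat"
  where "mat_one = (\<lambda>i j. of_bool (i = j))"

definition mat_mul :: "'r::comm_ring_1 mat \<Rightarrow> 'r mat \<Rightarrow> 'r mat"
  where "mat_mul A B = (\<lambda>i j. \<Sum>k\<in>UNIV. A i k * B k j)"

definition xmat :: "root \<Rightarrow> 'r::comm_ring_1 \<Rightarrow> 'r mat"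
  where "xmat \<zeta> t = (\<lambda>i j. of_bool (i = j) + of_int (root_vec \<zeta> i j) * t)"

definition word_mat :: "(root \<times> 'r::comm_ring_1) list \<Rightarrow> 'r mat"
  where "word_mat w = foldr (\<lambda>(r, t). mat_mul (xmat r t)) w mat_one"

lemma xmat_column: "mat_mul (xmat \<zeta> t) A i j = act \<zeta> t (\<lambda>k. A k j) i"
proof -
  have "(\<Sum>k\<in>UNIV. of_bool (i = k) * A k j) = A i j"
    by (simp add: of_bool_def if_distrib[of "\<lambda>x. x * _"] cong: if_cong)
  moreover have "(\<Sum>k\<in>UNIV. of_int (root_vec \<zeta> i k) * t * A k j) = t * (\<Sum>k\<in>UNIV. of_int (root_vec \<zeta> i k) * A k j)"
    by (simp add: sum_distrib_left mult_ac)
  ultimately show ?thesis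
    by (simp add: mat_mul_def xmat_def act_def distrib_right sum.distrib)
qed

lemma word_mat_column: "(\<lambda>i. word_mat w i j) = wact w (\<lambda>i. of_bool (i = j))"
proof (induction w)
  case Nil
  then show ?case by (simp add: word_mat_def mat_one_def)
next
  case (Cons s w)
  obtain r t where s: "s = (r, t)" by (cases s)
  have "word_mat (s # w) i j = act r t (\<lambda>k. word_mat w k j) i" for i
    by (simp add: word_mat_def s xmat_column)
  then show ?case using Cons by (simp add: s)
qed

lemma word_mat_eq_one: "(\<And>v. wact w v = v) \<Longrightarrow> word_mat w = mat_one"
  using word_mat_column[of w] by (fastforce simp: fun_eq_iff mat_one_def)

lemma word_mat_eq_xmat:
  assumes "\<And>v. wact w v = act \<zeta> t v"
  shows "word_mat w = xmat \<zeta> t"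
proof -
  have "word_mat w i j = xmat \<zeta> t i j" for i j
  proof -
    have "word_mat w i j = act \<zeta> t (\<lambda>i. of_bool (i = j)) i"
      using fun_cong[OF word_mat_column[of w j], of i] by (simp add: assms)
    also have "\<dots> = xmat \<zeta> t i j"
      by (simp add: act_def xmat_def mult.commute)
    finally show ?thesis .
  qed
  then show ?thesis by blast
qed

definition pmat :: "'b ring \<times> 'c \<Rightarrow> ('b, 'c) fam mat \<Rightarrow> 'b mat"
  where "pmat x A = (\<lambda>i j. proj x (A i j))"

lemma pmat_one: "good (fst x) \<Longrightarrow> pmat x mat_one = \<one>\<^bsub>mat_monoid (fst x)\<^esub>"
  by (auto simp: pmat_def mat_one_def mat_monoid_def proj_simps fun_eq_iff)

lemma pmat_mul: "good (fst x) \<Longrightarrow> pmat x (mat_mul A B) = pmat x A \<otimes>\<^bsub>mat_monoid (fst x)\<^esub> pmat x B"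
  by (simp add: pmat_def mat_mul_def mat_monoid_def proj_sum proj_simps)

lemma pmat_xmat: "good (fst x) \<Longrightarrow> pmat x (xmat \<zeta> t) = x_root (fst x) \<zeta> (proj x t)"
  by (auto simp: pmat_def xmat_def x_root_def proj_simps(1-3) proj_of_int_mult fun_eq_iff)

lemma pmat_word:
  assumes "good (fst x)"
  shows "pmat x (word_mat w) = list_prod (mat_monoid (fst x)) (map (\<lambda>(\<zeta>, t). x_root (fst x) \<zeta> (proj x t)) w)"
  by (induction w) (auto simp: word_mat_def list_prod_def assms pmat_one pmat_mul pmat_xmat)

text \<open>Passing to units and to generated subgroups changes only the carrier, so words are
  evaluated in the matrix monoid.\<close>

lemma list_prod_U_gen: "list_prod (U_gen I R T) = list_prod (mat_monoid R)"
  and one_U_gen: "\<one>\<^bsub>U_gen I R T\<^esub> = \<one>\<^bsub>mat_monoid R\<^esub>"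
  by (simp_all add: list_prod_def U_gen_def B3_def units_of_def fun_eq_iff)

section \<open>Derivations as rewriting\<close>

text \<open>An index consists of K, F, f and a sequence of parameters; its first two entries will be
  the t and u of a Steinberg relation.\<close>

type_synonym 'a ix = "'a ring \<times> 'a set \<times> (nat \<Rightarrow> 'a) \<times> (nat \<Rightarrow> 'a)"
type_synonym 'a sc = "('a, 'a set \<times> (nat \<Rightarrow> 'a) \<times> (nat \<Rightarrow> 'a)) fam"

definition Iof :: "bool \<Rightarrow> root set"
  where "Iof b = (if b then I_lg else I_sm)"

fun valid :: "'a ix \<Rightarrow> bool"
  where "valid (K, F, f, v) \<longleftrightarrow> field K \<and> good K \<and> subfield F K \<and> f \<in> carrier (UP K)"

text \<open>The bound 20 covers the longest base word, which has 16 symbols, and the in-subgroup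
  relations that are used, which have at most 7.\<close>

fun rels :: "bool \<Rightarrow> 'a ix \<Rightarrow> 'a word set"
  where "rels b (K, F, f, v) = in_subgroup_rels (Iof b) K f 20 \<union> lifted_rels (Iof b) K F 20"

abbreviation genw :: "bool \<Rightarrow> 'a ix \<Rightarrow> 'a word set"
  where "genw b x \<equiv> lists (gens (Iof b) (fst x))"

lemma valid_good: "valid x \<Longrightarrow> good (fst x)" "valid x \<Longrightarrow> field (fst x)"
  by (cases x; simp)+

text \<open>A derivation step in which only the relator is shifted or inverted and the word stays in
  place. This makes steps compatible with concatenation, as needed for a congruence.\<close>

definition step :: "bool \<Rightarrow> 'a ix \<Rightarrow> 'a word \<Rightarrow> 'a word \<Rightarrow> bool"
  where "step b x w w' \<longleftrightarrow> (\<exists>p u v q. {p, u, v, q} \<subseteq> genw b x \<and> w = p @ u @ q \<and> w' = p @ v @ q \<and>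
    (\<exists>r\<in>rels b x. cyc_equiv (fst x) r (u @ word_inv (fst x) v)))"

lemma word_inv_append: "word_inv K (u @ v) = word_inv K v @ word_inv K u"
  by (simp add: word_inv_def)

lemma word_inv_Nil [simp]: "word_inv K [] = []"
  by (simp add: word_inv_def)

lemma word_inv_closed:
  assumes "cring K" "w \<in> lists (gens I K)"
  shows "word_inv K w \<in> lists (gens I K)"
proof -
  interpret cring K by fact
  show ?thesis using assms(2) by (auto simp: word_inv_def gens_def in_lists_conv_set)
qed

lemma word_inv_inv:
  assumes "cring K" "w \<in> lists (gens I K)"
  shows "word_inv K (word_inv K w) = w"
proof -
  interpret cring K by fact
  have "map ((\<lambda>(\<zeta>, t, i). (\<zeta>, \<ominus>\<^bsub>K\<^esub> t, i)) \<circ> (\<lambda>(\<zeta>, t, i). (\<zeta>, \<ominus>\<^bsub>K\<^esub> t, i))) w = w"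
    using assms(2) by (intro map_idI) (auto simp: gens_def in_lists_conv_set)
  then show ?thesis by (simp add: word_inv_def rev_map)
qed

lemma valid_cring: "valid x \<Longrightarrow> cring (fst x)"
  by (intro goodD valid_good)

lemma cyc_equiv_inv:
  assumes "word_inv K w = w'" "word_inv K w' = w"
  shows "cyc_equiv K r w \<longleftrightarrow> cyc_equiv K r w'"
  using assms by (auto simp: cyc_equiv_def)

lemma cyc_equiv_rotate:
  "cyc_equiv K r (u @ v) \<Longrightarrow> word_inv K (u @ v) = u' @ v' \<Longrightarrow> word_inv K (v @ u) = v' @ u' \<Longrightarrow> cyc_equiv K r (v @ u)"
proof -
  assume r: "cyc_equiv K r (u @ v)" and i: "word_inv K (u @ v) = u' @ v'" "word_inv K (v @ u) = v' @ u'"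
  have rot: "a @ b = rotate (length b) (b @ a)" for a b :: "'a word"
    by (simp add: rotate_append)
  from r obtain n where "r = rotate n (u @ v) \<or> r = rotate n (u' @ v')"
    unfolding cyc_equiv_def i by blast
  then show ?thesis
    unfolding cyc_equiv_def i by (metis rot rotate_rotate)
qed

context
  fixes b :: bool and x :: "'a ix"
  assumes valid: "valid x"
begin

lemma inv_closed: "w \<in> genw b x \<Longrightarrow> word_inv (fst x) w \<in> genw b x"
  by (rule word_inv_closed[OF valid_cring[OF valid]])

lemma inv_inv: "w \<in> genw b x \<Longrightarrow> word_inv (fst x) (word_inv (fst x) w) = w"
  by (rule word_inv_inv[OF valid_cring[OF valid]])

lemma step_closed: "step b x w w' \<Longrightarrow> w \<in> genw b x \<and> w' \<in> genw b x"
  unfolding step_def by auto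

lemma step_sym: "step b x w w' \<Longrightarrow> step b x w' w"
proof -
  assume "step b x w w'"
  then obtain p u v q r where *: "{p, u, v, q} \<subseteq> genw b x" "w = p @ u @ q" "w' = p @ v @ q"
    "r \<in> rels b x" "cyc_equiv (fst x) r (u @ word_inv (fst x) v)"
    unfolding step_def by blast
  then have "cyc_equiv (fst x) r (v @ word_inv (fst x) u)"
    by (subst cyc_equiv_inv[of _ _ "u @ word_inv (fst x) v"]) (auto simp: word_inv_append inv_inv)
  with * show ?thesis unfolding step_def by blast
qed

lemma step_context:
  assumes "step b x w w'" "c \<in> genw b x" "d \<in> genw b x"
  shows "step b x (c @ w @ d) (c @ w' @ d)"
proof -
  from assms(1) obtain p u v q r where *: "{p, u, v, q} \<subseteq> genw b x" "w = p @ u @ q" "w' = p @ v @ q"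
    "r \<in> rels b x" "cyc_equiv (fst x) r (u @ word_inv (fst x) v)"
    unfolding step_def by blast
  then have "{c @ p, u, v, q @ d} \<subseteq> genw b x" "c @ w @ d = (c @ p) @ u @ (q @ d)" "c @ w' @ d = (c @ p) @ v @ (q @ d)"
    using assms by auto
  with *(4,5) show ?thesis unfolding step_def by blast
qed

text \<open>The relator \<open>u @ word_inv K v\<close> is rotated so that the inverse of v comes in
  front, and then inverted; this is a relator for the inverses of u and v.\<close>

lemma step_inv:
  assumes "step b x w w'"
  shows "step b x (word_inv (fst x) w) (word_inv (fst x) w')"
proof -
  let ?i = "word_inv (fst x)"
  from assms obtain p u v q r where *: "{p, u, v, q} \<subseteq> genw b x" "w = p @ u @ q" "w' = p @ v @ q"
    "r \<in> rels b x" "cyc_equiv (fst x) r (u @ ?i v)"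
    unfolding step_def by blast
  then have "cyc_equiv (fst x) r (?i v @ u)"
    by (intro cyc_equiv_rotate[of _ _ u "?i v" v "?i u"]) (auto simp: word_inv_append inv_inv)
  then have "cyc_equiv (fst x) r (?i u @ ?i (?i v))"
    using * by (subst cyc_equiv_inv[of _ _ "?i v @ u"]) (auto simp: word_inv_append inv_inv)
  moreover have "{?i q, ?i u, ?i v, ?i p} \<subseteq> genw b x" "?i w = ?i q @ ?i u @ ?i p" "?i w' = ?i q @ ?i v @ ?i p"
    using * inv_closed by (auto simp: word_inv_append)
  ultimately show ?thesis using *(4) unfolding step_def by blast
qed

definition near :: "nat \<Rightarrow> 'a word \<Rightarrow> 'a word \<Rightarrow> bool"
  where "near N w w' \<longleftrightarrow> w \<in> genw b x \<and> w' \<in> genw b x \<and> (\<exists>n\<le>N. (step b x ^^ n) w w')"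

lemma near_refl: "w \<in> genw b x \<Longrightarrow> near N w w"
  unfolding near_def by (auto intro: exI[of _ 0])

lemma near_mono: "near N w w' \<Longrightarrow> N \<le> N' \<Longrightarrow> near N' w w'"
  unfolding near_def using le_trans by blast

lemma near_trans: "near N w w' \<Longrightarrow> near N' w' w'' \<Longrightarrow> near (N + N') w w''"
  unfolding near_def using add_mono relpowp_trans[of _ "step b x"] by metis

lemma near_map:
  assumes "near N w w'" "\<And>w w'. step b x w w' \<Longrightarrow> step b x (g w) (g w')"
    "\<And>w. w \<in> genw b x \<Longrightarrow> g w \<in> genw b x"
  shows "near N (g w) (g w')"
proof -
  have "(step b x ^^ n) u u' \<Longrightarrow> (step b x ^^ n) (g u) (g u')" for n u u'
    by (induction n arbitrary: u') (auto intro: assms(2) relpowp_Suc_I elim!: relpowp_Suc_E)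
  with assms show ?thesis unfolding near_def by blast
qed

lemma near_sym: "near N w w' \<Longrightarrow> near N w' w"
proof -
  have "(step b x ^^ n) u u' \<Longrightarrow> (step b x ^^ n) u' u" for n u u'
  proof (induction n arbitrary: u')
    case (Suc n)
    then obtain y where "(step b x ^^ n) u y" "step b x y u'" by (auto elim: relpowp_Suc_E)
    then show ?case using Suc.IH step_sym relpowp_Suc_I2 by metis
  qed simp
  then show "near N w w' \<Longrightarrow> near N w' w" unfolding near_def by blast
qed

lemma near_append:
  assumes "near N w w'" "near N' u u'"
  shows "near (N + N') (w @ u) (w' @ u')"
proof -
  have g: "w \<in> genw b x" "u \<in> genw b x" "w' \<in> genw b x" using assms by (auto simp: near_def)
  have "near N (w @ u) (w' @ u)"
    using assms(1) g step_context[of _ _ "[]" u] by (intro near_map[of N w w' "\<lambda>w. w @ u"]) auto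
  moreover have "near N' (w' @ u) (w' @ u')"
    using assms(2) g step_context[of _ _ w' "[]"] by (intro near_map[of N' u u' "\<lambda>u. w' @ u"]) auto
  ultimately show ?thesis by (rule near_trans)
qed

lemma near_inv: "near N w w' \<Longrightarrow> near N (word_inv (fst x) w) (word_inv (fst x) w')"
  by (rule near_map[of N w w' "word_inv (fst x)"]) (assumption | erule step_inv | erule inv_closed)+

lemma near_rel: "r \<in> rels b x \<Longrightarrow> r \<in> genw b x \<Longrightarrow> near 1 r []"
proof -
  assume r: "r \<in> rels b x" "r \<in> genw b x"
  have "cyc_equiv (fst x) r (r @ word_inv (fst x) [])"
    unfolding cyc_equiv_def by (rule exI[of _ 0]) simp
  moreover have "{[], r, [], []} \<subseteq> genw b x" "r = [] @ r @ []" "[] = [] @ [] @ ([] :: 'a word)"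
    using r by auto
  ultimately have "step b x r []"
    unfolding step_def using r(1) by blast
  then have "(step b x ^^ 1) r []" by simp
  with r show ?thesis unfolding near_def by blast
qed

text \<open>Inverse symbols do not cancel by themselves: each pair is removed by a relator, at the
  cost of one step for every symbol.\<close>

lemma near_cancel:
  assumes "w \<in> genw b x"
    and sym: "\<And>s. s \<in> gens (Iof b) (fst x) \<Longrightarrow> [s] @ word_inv (fst x) [s] \<in> rels b x"
  shows "near (length w) (w @ word_inv (fst x) w) []"
  using assms(1)
proof (induction w)
  case Nil
  then show ?case by (simp add: near_refl)
next
  case (Cons s w)
  let ?i = "word_inv (fst x)"
  have "[s] \<in> genw b x" "w \<in> genw b x" using Cons by auto
  note s = this inv_closed[OF this(1)]
  have "near (length w) (w @ ?i w) []" using Cons by auto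
  then have "near (length w) ([s] @ (w @ ?i w) @ ?i [s]) ([s] @ [] @ ?i [s])"
    using s by (intro near_map[of _ _ _ "\<lambda>w. [s] @ w @ ?i [s]"] step_context) (simp_all del: append.simps)
  moreover have "near 1 ([s] @ [] @ ?i [s]) []"
    using s sym[of s] near_rel[of "[s] @ ?i [s]"] by simp
  ultimately have "near (length w + 1) ([s] @ (w @ ?i w) @ ?i [s]) []"
    by (rule near_trans)
  then show ?case using word_inv_append[of "fst x" "[s]" w] by simp
qed

lemma step_derive_step:
  assumes "step b x w w'"
  shows "derive_step (Iof b) (fst x) (rels b x) w w'"
proof -
  from assms obtain p u v q r where *: "{p, u, v, q} \<subseteq> genw b x" "w = p @ u @ q" "w' = p @ v @ q"
    "r \<in> rels b x" "cyc_equiv (fst x) r (u @ word_inv (fst x) v)"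
    unfolding step_def by blast
  have refl: "cyc_equiv (fst x) w w" for w
    unfolding cyc_equiv_def by (rule exI[of _ 0]) simp
  have "cyc_equiv (fst x) w (p @ u @ q)" "cyc_equiv (fst x) w' (p @ v @ q)" "{p, q, u, v} \<subseteq> genw b x"
    using refl * by auto
  moreover have "w' \<in> genw b x" using step_closed[OF assms] by blast
  ultimately show ?thesis
    unfolding derive_step_def using *(4,5)
    by (intro conjI bexI[of _ r] exI[of _ p] exI[of _ q] exI[of _ u] exI[of _ v])
qed

lemma near_derivable: "near N w [] \<Longrightarrow> derivable_within (Iof b) (fst x) (rels b x) N w"
proof -
  have "(step b x ^^ n) u u' \<Longrightarrow> (derive_step (Iof b) (fst x) (rels b x) ^^ n) u u'" for n u u'
    by (induction n arbitrary: u') (auto intro: step_derive_step relpowp_Suc_I elim!: relpowp_Suc_E)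
  then show "near N w [] \<Longrightarrow> ?thesis" unfolding near_def derivable_within_def by blast
qed

end

section \<open>Classes of monomials in the quotient ring\<close>

lemma add_hom_int:
  fixes n :: int
  assumes "cring K" "cring R" and h: "\<And>s. s \<in> carrier K \<Longrightarrow> h s \<in> carrier R"
    "\<And>s s'. s \<in> carrier K \<Longrightarrow> s' \<in> carrier K \<Longrightarrow> h (s \<oplus>\<^bsub>K\<^esub> s') = h s \<oplus>\<^bsub>R\<^esub> h s'"
    and s: "s \<in> carrier K"
  shows "h \<zero>\<^bsub>K\<^esub> = \<zero>\<^bsub>R\<^esub>" "h (\<ominus>\<^bsub>K\<^esub> s) = \<ominus>\<^bsub>R\<^esub> h s" "h ([n] \<cdot>\<^bsub>K\<^esub> s) = [n] \<cdot>\<^bsub>R\<^esub> h s"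
proof -
  interpret K: cring K by fact
  interpret R: cring R by fact
  have "h \<zero>\<^bsub>K\<^esub> \<oplus>\<^bsub>R\<^esub> h \<zero>\<^bsub>K\<^esub> = h \<zero>\<^bsub>K\<^esub>"
    using h(2)[of "\<zero>\<^bsub>K\<^esub>" "\<zero>\<^bsub>K\<^esub>"] by simp
  then show z: "h \<zero>\<^bsub>K\<^esub> = \<zero>\<^bsub>R\<^esub>"
    using R.add.r_cancel_one[of "h \<zero>\<^bsub>K\<^esub>" "h \<zero>\<^bsub>K\<^esub>"] h(1) by simp
  have m: "h (\<ominus>\<^bsub>K\<^esub> s) = \<ominus>\<^bsub>R\<^esub> h s" if "s \<in> carrier K" for s
    using that h(2)[of "\<ominus>\<^bsub>K\<^esub> s" s] z h(1) by (intro R.minus_equality[symmetric]) (simp_all add: K.l_neg)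
  then show "h (\<ominus>\<^bsub>K\<^esub> s) = \<ominus>\<^bsub>R\<^esub> h s" using s .
  have p: "h ([k] \<cdot>\<^bsub>K\<^esub> s) = [k] \<cdot>\<^bsub>R\<^esub> h s" for k :: nat
    by (induction k) (use s h z in simp_all)
  show "h ([n] \<cdot>\<^bsub>K\<^esub> s) = [n] \<cdot>\<^bsub>R\<^esub> h s"
  proof (cases "n < 0")
    case True
    then show ?thesis
      using s m[of "[nat (- n)] \<cdot>\<^bsub>K\<^esub> s"] by (simp add: add_pow_int_lt p)
  next
    case False
    then show ?thesis by (simp add: add_pow_int_ge p)
  qed
qed

definition kappa :: "'a ring \<Rightarrow> (nat \<Rightarrow> 'a) \<Rightarrow> nat \<Rightarrow> 'a \<Rightarrow> (nat \<Rightarrow> 'a) set"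
  where "kappa K f i s = poly_class K f (up_ring.monom (UP K) s i)"

lemma kappa:
  assumes "cring K" "f \<in> carrier (UP K)"
  shows cring_poly_quot: "cring (poly_quot K f)"
    and kappa_closed: "s \<in> carrier K \<Longrightarrow> kappa K f i s \<in> carrier (poly_quot K f)"
    and kappa_add: "s \<in> carrier K \<Longrightarrow> s' \<in> carrier K \<Longrightarrow>
      kappa K f i (s \<oplus>\<^bsub>K\<^esub> s') = kappa K f i s \<oplus>\<^bsub>poly_quot K f\<^esub> kappa K f i s'"
    and kappa_mult: "s \<in> carrier K \<Longrightarrow> s' \<in> carrier K \<Longrightarrow>
      kappa K f (i + j) (s \<otimes>\<^bsub>K\<^esub> s') = kappa K f i s \<otimes>\<^bsub>poly_quot K f\<^esub> kappa K f j s'"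
    and kappa_one: "kappa K f 0 \<one>\<^bsub>K\<^esub> = \<one>\<^bsub>poly_quot K f\<^esub>"
proof -
  interpret K: cring K by fact
  interpret UP_cring K "UP K" by unfold_locales simp
  interpret I: ideal "PIdl\<^bsub>UP K\<^esub> f" "UP K"
    using assms(2) by (rule P.cgenideal_ideal)
  interpret h: ring_hom_cring "UP K" "poly_quot K f" "poly_class K f"
    using I.rcos_ring_hom_cring[OF P.is_cring] by (simp add: poly_quot_def poly_class_def[abs_def])
  show "cring (poly_quot K f)" by (rule h.S.is_cring)
  show "s \<in> carrier K \<Longrightarrow> kappa K f i s \<in> carrier (poly_quot K f)"
    by (simp add: kappa_def)
  show "s \<in> carrier K \<Longrightarrow> s' \<in> carrier K \<Longrightarrow>
      kappa K f i (s \<oplus>\<^bsub>K\<^esub> s') = kappa K f i s \<oplus>\<^bsub>poly_quot K f\<^esub> kappa K f i s'"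
    by (simp add: kappa_def)
  show "s \<in> carrier K \<Longrightarrow> s' \<in> carrier K \<Longrightarrow>
      kappa K f (i + j) (s \<otimes>\<^bsub>K\<^esub> s') = kappa K f i s \<otimes>\<^bsub>poly_quot K f\<^esub> kappa K f j s'"
    by (simp add: kappa_def)
  show "kappa K f 0 \<one>\<^bsub>K\<^esub> = \<one>\<^bsub>poly_quot K f\<^esub>"
    by (simp add: kappa_def)
qed

lemma good_poly_quot:
  assumes "good K" "f \<in> carrier (UP K)"
  shows "good (poly_quot K f)"
proof -
  have K: "cring K" using assms(1) by (rule goodD)
  interpret K: cring K by fact
  interpret R: cring "poly_quot K f" by (rule cring_poly_quot[OF K assms(2)])
  note k = kappa[OF K assms(2)]
  let ?two = "\<one>\<^bsub>K\<^esub> \<oplus>\<^bsub>K\<^esub> \<one>\<^bsub>K\<^esub>" and ?twoR = "\<one>\<^bsub>poly_quot K f\<^esub> \<oplus>\<^bsub>poly_quot K f\<^esub> \<one>\<^bsub>poly_quot K f\<^esub>"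
  have u: "?two \<in> Units K" using assms(1) by (simp add: good_def)
  have "kappa K f 0 ?two = ?twoR" using k(3)[of "\<one>\<^bsub>K\<^esub>" "\<one>\<^bsub>K\<^esub>" 0] k(5) by simp
  moreover have "kappa K f 0 (inv\<^bsub>K\<^esub> ?two) \<otimes>\<^bsub>poly_quot K f\<^esub> kappa K f 0 ?two = \<one>\<^bsub>poly_quot K f\<^esub>"
    using k(4)[of "inv\<^bsub>K\<^esub> ?two" ?two 0 0] u k(5) by simp
  moreover have "kappa K f 0 (inv\<^bsub>K\<^esub> ?two) \<in> carrier (poly_quot K f)"
    using u by (intro k(2)) simp
  ultimately have "?twoR \<in> Units (poly_quot K f)"
    using R.one_closed R.a_closed by (auto simp: Units_def R.m_comm intro!: bexI[of _ "kappa K f 0 (inv\<^bsub>K\<^esub> ?two)"])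
  then show ?thesis by (simp add: good_def R.is_cring)
qed

text \<open>This turns an element of a single ring with carrier into an element of a type-class
  ring, where the identities for \<open>wact\<close> apply.\<close>

definition const :: "'b \<Rightarrow> ('b, unit) fam"
  where "const c = mk 0 (\<lambda>_. c)"

lemma proj_const: "good R \<Longrightarrow> c \<in> carrier R \<Longrightarrow> proj (R, ()) (const c) = c"
  unfolding const_def by (subst proj_mk) auto

type_synonym 'a fword = "(root \<times> 'a sc \<times> nat) list"

definition projw :: "'a ix \<Rightarrow> 'a fword \<Rightarrow> 'a word"
  where "projw x = map (\<lambda>(\<zeta>, t, i). (\<zeta>, proj x t, i))"

lemma projw_simps [simp]: "projw x [] = []" "projw x ((\<zeta>, t, i) # w) = (\<zeta>, proj x t, i) # projw x w"
  "projw x (w @ w') = projw x w @ projw x w'"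
  by (simp_all add: projw_def)

lemma length_projw [simp]: "length (projw x w) = length w"
  by (simp add: projw_def)

text \<open>Here \<open>T\<close>, read in the quotient ring, is the class of \<open>t x\<^sup>i\<close>.\<close>

definition corr :: "'a ix \<Rightarrow> 'a sc \<times> nat \<Rightarrow> ((nat \<Rightarrow> 'a) set, unit) fam \<Rightarrow> bool"
  where "corr x p T \<longleftrightarrow> proj (poly_quot (fst x) (fst (snd (snd x))), ()) T
    = kappa (fst x) (fst (snd (snd x))) (snd p) (proj x (fst p))"

abbreviation corr_letter :: "'a ix \<Rightarrow> root \<times> 'a sc \<times> nat \<Rightarrow> root \<times> ((nat \<Rightarrow> 'a) set, unit) fam \<Rightarrow> bool"
  where "corr_letter x \<equiv> \<lambda>(\<zeta>, p) (\<zeta>', T). \<zeta> = \<zeta>' \<and> corr x p T"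

definition cls :: "'a ix \<Rightarrow> 'a sc \<times> nat \<Rightarrow> ((nat \<Rightarrow> 'a) set, unit) fam"
  where "cls x p = const (kappa (fst x) (fst (snd (snd x))) (snd p) (proj x (fst p)))"

context
  fixes x :: "'a ix"
  assumes valid: "valid x"
begin

private lemma vx: "cring (fst x)" "good (fst x)" "fst (snd (snd x)) \<in> carrier (UP (fst x))"
  "good (poly_quot (fst x) (fst (snd (snd x))))" "good (fst (poly_quot (fst x) (fst (snd (snd x))), ()))"
proof -
  show 1: "cring (fst x)" "good (fst x)"
    using valid by (rule valid_cring, rule valid_good)
  show 2: "fst (snd (snd x)) \<in> carrier (UP (fst x))"
    using valid by (cases x) simp
  show "good (poly_quot (fst x) (fst (snd (snd x))))" "good (fst (poly_quot (fst x) (fst (snd (snd x))), ()))"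
    using good_poly_quot[OF 1(2) 2] by simp_all
qed

lemma corr_cls: "corr x p (cls x p)"
  unfolding corr_def cls_def by (rule proj_const) (use vx in \<open>auto intro: kappa_closed\<close>)

private lemma kappa_hom:
  assumes "s \<in> carrier (fst x)"
  shows "kappa (fst x) (fst (snd (snd x))) i (\<ominus>\<^bsub>fst x\<^esub> s)
      = \<ominus>\<^bsub>poly_quot (fst x) (fst (snd (snd x)))\<^esub> kappa (fst x) (fst (snd (snd x))) i s"
    and "kappa (fst x) (fst (snd (snd x))) i (add_pow (fst x) (n :: int) s)
      = add_pow (poly_quot (fst x) (fst (snd (snd x)))) n (kappa (fst x) (fst (snd (snd x))) i s)"
proof -
  let ?h = "kappa (fst x) (fst (snd (snd x))) i"
  note h = add_hom_int[where h = ?h, OF vx(1) cring_poly_quot[OF vx(1,3)] kappa_closed[OF vx(1,3)]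
      kappa_add[OF vx(1,3)] assms]
  show "?h (\<ominus>\<^bsub>fst x\<^esub> s) = \<ominus>\<^bsub>poly_quot (fst x) (fst (snd (snd x)))\<^esub> ?h s" by (rule h(2))
  show "?h (add_pow (fst x) n s) = add_pow (poly_quot (fst x) (fst (snd (snd x)))) n (?h s)" by (rule h(3))
qed

lemma corr_uminus: "corr x (t, i) T \<Longrightarrow> corr x (- t, i) (- T)"
  unfolding corr_def by (simp add: proj_simps vx kappa_hom)

lemma corr_add: "corr x (t, i) T \<Longrightarrow> corr x (u, i) U \<Longrightarrow> corr x (t + u, i) (T + U)"
  unfolding corr_def by (simp add: proj_simps vx kappa_add)

lemma corr_mult: "corr x (t, i) T \<Longrightarrow> corr x (u, j) U \<Longrightarrow> corr x (t * u, i + j) (T * U)"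
  unfolding corr_def by (simp add: proj_simps vx kappa_mult)

lemma corr_one: "corr x (1, 0) 1"
  unfolding corr_def by (simp add: proj_simps vx kappa_one)

lemma corr_power: "corr x (t, i) T \<Longrightarrow> corr x (t ^ n, n * i) (T ^ n)"
  by (induction n) (auto simp: corr_one corr_mult)

lemma corr_of_int: "corr x (t, i) T \<Longrightarrow> corr x (of_int n * t, i) (of_int n * T)"
  unfolding corr_def by (simp add: proj_of_int_mult vx kappa_hom)

text \<open>The bridge from symbols with degrees to matrices: each symbol corresponds to a root
  element over K[x]/(f), so relations follow from identities for \<open>wact\<close>.\<close>

lemma word_val_eq:
  assumes "list_all2 (corr_letter x) w w'"
  shows "word_val I (fst x) (fst (snd (snd x))) (projw x w)
    = pmat (poly_quot (fst x) (fst (snd (snd x))), ()) (word_mat w')"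
proof -
  have "map (\<lambda>(\<zeta>, t, i). x_deg (fst x) (fst (snd (snd x))) \<zeta> t i) (projw x w)
    = map (\<lambda>(\<zeta>, T). x_root (poly_quot (fst x) (fst (snd (snd x)))) \<zeta>
        (proj (poly_quot (fst x) (fst (snd (snd x))), ()) T)) w'"
    using assms by induction (auto simp: corr_def x_deg_def kappa_def)
  then show ?thesis
    unfolding word_val_def U_poly_def list_prod_U_gen pmat_word[OF vx(5)] by simp
qed

lemma in_subgroup_relI:
  assumes w: "\<And>\<zeta> t i. (\<zeta>, t, i) \<in> set w \<Longrightarrow> \<zeta> \<in> pos_roots S \<and> i \<le> ht I \<zeta>" and S: "S \<in> pairs I"
    and "length w \<le> M"
    and "list_all2 (corr_letter x) w w'" "\<And>v. wact w' v = v"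
  shows "projw x w \<in> in_subgroup_rels I (fst x) (fst (snd (snd x))) M"
proof -
  have "projw x w \<in> lists (gens I (fst x))"
  proof -
    have "(\<zeta>, proj x t, i) \<in> gens I (fst x)" if "(\<zeta>, t, i) \<in> set w" for \<zeta> t i
      using w[OF that] S vx(2) unfolding gens_def rank2_roots_def by blast
    then show ?thesis by (auto simp: projw_def in_lists_conv_set simp del: split_paired_All)
  qed
  moreover have "fst ` set (projw x w) \<subseteq> pos_roots S"
    using w by (force simp: projw_def)
  moreover have "word_val I (fst x) (fst (snd (snd x))) (projw x w)
      = \<one>\<^bsub>U_poly I (fst x) (fst (snd (snd x)))\<^esub>"
    unfolding word_val_eq[OF assms(4)] word_mat_eq_one[OF assms(5)] pmat_one[OF vx(5)]
    by (simp add: U_poly_def one_U_gen)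
  ultimately show ?thesis
    using S assms(3) unfolding in_subgroup_rels_def by auto
qed

lemma word_val_alias:
  assumes "list_all2 (corr_letter x) w w'" "\<And>v. wact w' v = act \<zeta> T v"
    and "corr x (t, i) T"
  shows "word_val I (fst x) (fst (snd (snd x))) (projw x w)
    = x_deg (fst x) (fst (snd (snd x))) \<zeta> (proj x t) i"
  using assms(3) unfolding word_val_eq[OF assms(1)] word_mat_eq_xmat[OF assms(2)] pmat_xmat[OF vx(5)]
  by (simp add: x_deg_def corr_def kappa_def)

end

section \<open>Lifted words\<close>

text \<open>Polynomials over the ring of families are coefficient sequences, since \<open>UP\<close>
  requires a ring with a carrier. \<open>rp\<close> translates them to \<open>UP K\<close> at each
  index.\<close>

definition conv :: "(nat \<Rightarrow> 'r::comm_ring_1) \<Rightarrow> (nat \<Rightarrow> 'r) \<Rightarrow> nat \<Rightarrow> 'r"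
  where "conv p q = (\<lambda>n. \<Sum>i\<le>n. p i * q (n - i))"

definition lin_seq :: "'r::comm_ring_1 \<Rightarrow> 'r \<Rightarrow> nat \<Rightarrow> 'r"
  where "lin_seq s t = (\<lambda>i. if i = 0 then s else if i = 1 then t else 0)"

primrec conv_pow :: "(nat \<Rightarrow> 'r::comm_ring_1) \<Rightarrow> nat \<Rightarrow> nat \<Rightarrow> 'r"
  where "conv_pow p 0 = lin_seq 1 0" | "conv_pow p (Suc n) = conv (conv_pow p n) p"

definition rp :: "'a ix \<Rightarrow> (nat \<Rightarrow> 'a sc) \<Rightarrow> nat \<Rightarrow> 'a"
  where "rp x p = (\<lambda>i. proj x (p i))"

definition bounded_seq :: "(nat \<Rightarrow> 'r::zero) \<Rightarrow> bool"
  where "bounded_seq p \<longleftrightarrow> (\<exists>n. \<forall>m>n. p m = 0)"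

lemma bounded_lin_seq: "bounded_seq (lin_seq s t)"
  unfolding bounded_seq_def lin_seq_def by (rule exI[of _ 1]) auto

lemma bounded_conv: "bounded_seq p \<Longrightarrow> bounded_seq q \<Longrightarrow> bounded_seq (conv p q)"
proof -
  assume "bounded_seq p" "bounded_seq q"
  then obtain m n where mn: "\<And>i. i > m \<Longrightarrow> p i = 0" "\<And>i. i > n \<Longrightarrow> q i = 0"
    unfolding bounded_seq_def by blast
  have "conv p q k = 0" if "k > m + n" for k
    unfolding conv_def
  proof (rule sum.neutral, rule ballI)
    fix i assume "i \<in> {..k}"
    then show "p i * q (k - i) = 0"
      using mn(1)[of i] mn(2)[of "k - i"] that by (cases "i > m") auto
  qed
  then show ?thesis unfolding bounded_seq_def by blast
qed

lemma bounded_conv_pow: "bounded_seq p \<Longrightarrow> bounded_seq (conv_pow p n)"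
  by (induction n) (auto simp: bounded_lin_seq bounded_conv)

context
  fixes x :: "'a ix"
  assumes g: "good (fst x)"
begin

interpretation K: cring "fst x" by (rule goodD[OF g])
interpretation UP_cring "fst x" "UP (fst x)" by unfold_locales simp

lemma rp_up: "bounded_seq p \<Longrightarrow> rp x p \<in> up (fst x)"
proof -
  assume "bounded_seq p"
  then obtain n where n: "\<forall>m>n. p m = 0" unfolding bounded_seq_def by blast
  show ?thesis
  proof (rule mem_upI)
    show "rp x p m \<in> carrier (fst x)" for m using g by (simp add: rp_def)
    show "\<exists>n. bound \<zero>\<^bsub>fst x\<^esub> n (rp x p)"
      using n g by (intro exI[of _ n] bound.intro) (simp add: rp_def proj_simps)
  qed
qed

lemma carrier_UP: "carrier (UP R) = up R"
  by (simp add: UP_def)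

lemma rp_closed: "bounded_seq p \<Longrightarrow> rp x p \<in> carrier (UP (fst x))"
  unfolding carrier_UP by (rule rp_up)

lemma coeff_rp: "bounded_seq p \<Longrightarrow> up_ring.coeff (UP (fst x)) (rp x p) i = proj x (p i)"
  using rp_up[of p] unfolding UP_def by (simp add: rp_def)

lemma rp_conv:
  assumes "bounded_seq p" "bounded_seq q"
  shows "rp x (conv p q) = rp x p \<otimes>\<^bsub>UP (fst x)\<^esub> rp x q"
proof -
  have "rp x p \<otimes>\<^bsub>UP (fst x)\<^esub> rp x q = (\<lambda>n. \<Oplus>\<^bsub>fst x\<^esub>i \<in> {..n}. rp x p i \<otimes>\<^bsub>fst x\<^esub> rp x q (n - i))"
    using rp_up[OF assms(1)] rp_up[OF assms(2)] unfolding UP_def by simp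
  then show ?thesis
    using g by (simp add: rp_def conv_def proj_sum proj_simps)
qed

lemma rp_lin_seq: "rp x (lin_seq s t) = linpoly (fst x) (proj x s) (proj x t)"
proof (rule up_eqI)
  show "up_ring.coeff (UP (fst x)) (rp x (lin_seq s t)) n
      = up_ring.coeff (UP (fst x)) (linpoly (fst x) (proj x s) (proj x t)) n" for n
    unfolding coeff_rp[OF bounded_lin_seq] using g by (auto simp: linpoly_def lin_seq_def proj_simps)
  show "rp x (lin_seq s t) \<in> carrier (UP (fst x))" by (intro rp_closed bounded_lin_seq)
  show "linpoly (fst x) (proj x s) (proj x t) \<in> carrier (UP (fst x))"
    using g by (simp add: linpoly_def)
qed

lemma rp_const: "rp x (lin_seq s 0) = up_ring.monom (UP (fst x)) (proj x s) 0"
  unfolding rp_lin_seq using g by (simp add: linpoly_def proj_simps)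

lemma rp_conv_pow: "bounded_seq p \<Longrightarrow> rp x (conv_pow p n) = rp x p [^]\<^bsub>UP (fst x)\<^esub> n"
proof (induction n)
  case 0
  then show ?case using g by (simp add: rp_const proj_simps)
next
  case (Suc n)
  then show ?case by (simp add: rp_conv bounded_conv_pow)
qed

end

definition lift_seq :: "root set \<Rightarrow> root \<times> root \<times> root \<Rightarrow> (root \<Rightarrow> 'r::comm_ring_1) \<Rightarrow> (root \<Rightarrow> 'r)
    \<Rightarrow> root \<times> int \<Rightarrow> nat \<Rightarrow> 'r"
  where "lift_seq I = (\<lambda>(r1, r2, r3) T0 T1 (\<eta>, n). conv (lin_seq (of_int n) 0)
    (conv (conv_pow (lin_seq (T0 r1) (T1 r1)) (root_coeff I \<eta> r1))
      (conv (conv_pow (lin_seq (T0 r2) (T1 r2)) (root_coeff I \<eta> r2))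
        (conv_pow (lin_seq (T0 r3) (T1 r3)) (root_coeff I \<eta> r3)))))"

lemma bounded_lift_seq: "bounded_seq (lift_seq I rs T0 T1 s)"
  by (cases rs; cases s) (simp add: lift_seq_def bounded_conv bounded_conv_pow bounded_lin_seq)

lemma rp_lift_seq:
  assumes "good (fst x)" "r1 \<noteq> r2" "r1 \<noteq> r3" "r2 \<noteq> r3" "I = {r1, r2, r3}"
  shows "rp x (lift_seq I (r1, r2, r3) T0 T1 (\<eta>, n))
    = lift_poly I (fst x) (\<lambda>\<zeta>. proj x (T0 \<zeta>)) (\<lambda>\<zeta>. proj x (T1 \<zeta>)) (\<eta>, proj x (of_int n))"
proof -
  interpret K: cring "fst x" by (rule goodD[OF assms(1)])
  interpret UP_cring "fst x" "UP (fst x)" by unfold_locales simp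
  have c: "linpoly (fst x) (proj x s) (proj x t) \<in> carrier (UP (fst x))" for s t
    using assms(1) by (simp add: linpoly_def)
  have k: "linpoly (fst x) (proj x s) (proj x 0) = up_ring.monom (UP (fst x)) (proj x s) 0" for s
    by (rule rp_const[OF assms(1), unfolded rp_lin_seq[OF assms(1)]])
  show ?thesis
    unfolding lift_poly_def lift_seq_def assms(5) using assms(1-4)
    by (simp add: rp_conv rp_conv_pow k rp_lin_seq bounded_conv bounded_conv_pow bounded_lin_seq c)
qed

definition flift :: "root set \<Rightarrow> root \<times> root \<times> root \<Rightarrow> (root \<Rightarrow> 'a sc) \<Rightarrow> (root \<Rightarrow> 'a sc)
    \<Rightarrow> (root \<times> int) list \<Rightarrow> 'a fword"
  where "flift I rs T0 T1 w = concat (map (\<lambda>s. map (\<lambda>i. (fst s, lift_seq I rs T0 T1 s i, i)) [0..<Suc (ht I (fst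
      s))]) w)"

lemma projw_flift:
  assumes "good (fst x)" "r1 \<noteq> r2" "r1 \<noteq> r3" "r2 \<noteq> r3" "I = {r1, r2, r3}"
  shows "projw x (flift I (r1, r2, r3) T0 T1 w) = lift_word I (fst x) (\<lambda>\<zeta>. proj x (T0 \<zeta>)) (\<lambda>\<zeta>. proj x (T1 \<zeta>))
    (map (\<lambda>(\<eta>, n). (\<eta>, proj x (of_int n))) w)"
proof (induction w)
  case (Cons s w)
  obtain \<eta> n where s: "s = (\<eta>, n)" by (cases s)
  have "projw x (map (\<lambda>i. (\<eta>, lift_seq I (r1, r2, r3) T0 T1 s i, i)) xs)
    = map (\<lambda>i. (\<eta>, up_ring.coeff (UP (fst x)) (lift_poly I (fst x) (\<lambda>\<zeta>. proj x (T0 \<zeta>)) (\<lambda>\<zeta>. proj x (T1 \<zeta>))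
      (\<eta>, proj x (of_int n))) i, i)) xs" for xs
    unfolding rp_lift_seq[OF assms, symmetric] coeff_rp[OF assms(1) bounded_lift_seq] s
    by (simp add: projw_def)
  then show ?case
    using Cons by (simp add: flift_def lift_word_def s del: upt_Suc)
qed (simp add: flift_def lift_word_def)

lemma good_subfield:
  assumes "good K" "field K" "subfield F K"
  shows "good (K\<lparr>carrier := F\<rparr>)"
proof -
  interpret K: field K by fact
  interpret F: field "K\<lparr>carrier := F\<rparr>" by (rule K.subfield_iff(2)[OF assms(3)])
  let ?two = "\<one>\<^bsub>K\<^esub> \<oplus>\<^bsub>K\<^esub> \<one>\<^bsub>K\<^esub>"
  have "?two \<noteq> \<zero>\<^bsub>K\<^esub>"
    using assms(1) unfolding good_def by (metis K.field_Units Diff_iff singletonI)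
  moreover have "?two \<in> F" using F.one_closed F.add.m_closed by fastforce
  ultimately have "?two \<in> Units (K\<lparr>carrier := F\<rparr>)"
    unfolding F.field_Units by simp
  then show ?thesis by (simp add: good_def F.is_cring)
qed

text \<open>A word with integer coefficients that acts trivially over all good rings is specialised
  to the ring with carrier F. The inclusion into K preserves sums and 1, hence integers have the
  same value in both.\<close>

lemma lifted_relI:
  fixes x :: "'a ix"
  assumes x: "valid x"
    and w: "\<And>\<eta> n. (\<eta>, n) \<in> set w \<Longrightarrow> \<eta> \<in> rank2_roots I" "length w \<le> M"
      "\<And>v :: fock \<Rightarrow> ('a, unit) fam. wact (map (\<lambda>(\<eta>, n). (\<eta>, of_int n)) w) v = v"
    and I: "r1 \<noteq> r2" "r1 \<noteq> r3" "r2 \<noteq> r3" "I = {r1, r2, r3}"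
  shows "projw x (flift I (r1, r2, r3) T0 T1 w) \<in> lifted_rels I (fst x) (fst (snd x)) M"
proof -
  define K where "K = fst x"
  define F where "F = fst (snd x)"
  have K: "good K" "field K" "subfield F K"
    using x unfolding K_def F_def by (cases x; simp)+
  let ?R = "K\<lparr>carrier := F\<rparr>" and ?y = "(K\<lparr>carrier := F\<rparr>, ())"
  have R: "good ?R" by (rule good_subfield[OF K])
  interpret K: field K by (rule K(2))
  interpret R: cring ?R by (rule goodD[OF R])
  have FK: "F \<subseteq> carrier K" using K(3) by (rule subfieldE(3))
  have int: "proj ?y (of_int n) = proj x (of_int n)" for n
    using add_hom_int(3)[of ?R K "\<lambda>x. x" "\<one>\<^bsub>K\<^esub>" n] FK R K R.is_cring K.is_cring R.one_closed
    by (auto simp: proj_of_int K_def)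
  have intF: "proj x (of_int n) \<in> F" for n
    using proj_closed[of ?y "of_int n"] R by (simp add: int)
  let ?u = "map (\<lambda>(\<eta>, n). (\<eta>, proj x (of_int n))) w"
  have "map (\<lambda>(\<eta>, u). x_root ?R \<eta> u) ?u
    = map (\<lambda>(\<eta>, u). x_root ?R \<eta> (proj ?y u)) (map (\<lambda>(\<eta>, n). (\<eta>, of_int n)) w)"
    by (auto simp: int)
  moreover have "list_prod (mat_monoid ?R) (map (\<lambda>(\<eta>, u). x_root ?R \<eta> (proj ?y u))
      (map (\<lambda>(\<eta>, n). (\<eta>, of_int n)) w)) = \<one>\<^bsub>mat_monoid ?R\<^esub>"
    unfolding pmat_word[of ?y, unfolded fst_conv, OF R, symmetric] word_mat_eq_one[OF w(3)]
    by (rule pmat_one[of ?y, unfolded fst_conv, OF R])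
  ultimately have "list_prod (U_field I ?R) (map (\<lambda>(\<eta>, u). x_root ?R \<eta> u) ?u) = \<one>\<^bsub>U_field I ?R\<^esub>"
    unfolding U_field_def list_prod_U_gen one_U_gen by (simp only:)
  moreover have "?u \<in> lists (rank2_roots I \<times> F)"
    using w(1) intF by (auto simp: in_lists_conv_set)
  ultimately have "?u \<in> base_rels I K F M"
    unfolding base_rels_def using w(2) by simp
  moreover have "(\<lambda>\<zeta>. proj x (T \<zeta>)) ` I \<subseteq> carrier K" for T :: "root \<Rightarrow> 'a sc"
    using K(1) by (auto simp: K_def)
  ultimately show ?thesis
    unfolding projw_flift[OF K(1)[unfolded K_def] I] lifted_rels_def K_def[symmetric] F_def[symmetric]
    by blast
qed

lemma flift_gens:
  assumes "(\<zeta>, t, i) \<in> set (flift I rs T0 T1 w)"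
  shows "i \<le> ht I \<zeta> \<and> (\<exists>n. (\<zeta>, n) \<in> set w)"
  using assms unfolding flift_def by (auto simp del: upt_Suc)

section \<open>The group of families of words\<close>

declare valid.simps [simp del]

text \<open>The bound on the length makes inverses possible: cancelling a word against its inverse
  takes one step for every symbol.\<close>

definition wf_fam :: "(bool \<times> 'a ix \<Rightarrow> 'a word) \<Rightarrow> bool"
  where "wf_fam g \<longleftrightarrow> (\<exists>L. \<forall>b x. valid x \<longrightarrow> g (b, x) \<in> genw b x \<and> length (g (b, x)) \<le> L)"

text \<open>The Boolean in the index selects the large or the small basis. As a type cannot depend
  on the basis, both share one group.\<close>

definition wfam_eq :: "(bool \<times> 'a ix \<Rightarrow> 'a word) \<Rightarrow> (bool \<times> 'a ix \<Rightarrow> 'a word) \<Rightarrow> bool"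
  where "wfam_eq g h \<longleftrightarrow> wf_fam g \<and> wf_fam h \<and> (\<exists>N. \<forall>b x. valid x \<longrightarrow> near b x N (g (b, x)) (h (b, x)))"

lemma wf_famI: "(\<And>b x. valid x \<Longrightarrow> g (b, x) \<in> genw b x \<and> length (g (b, x)) \<le> L) \<Longrightarrow> wf_fam g"
  unfolding wf_fam_def by blast

lemma wfam_eqI: "wf_fam g \<Longrightarrow> wf_fam h \<Longrightarrow> (\<And>b x. valid x \<Longrightarrow> near b x N (g (b, x)) (h (b, x)))
    \<Longrightarrow> wfam_eq g h"
  unfolding wfam_eq_def by blast

lemma wfam_eqE:
  assumes "wfam_eq g h"
  obtains N where "\<And>b x. valid x \<Longrightarrow> near b x N (g (b, x)) (h (b, x))"
  using assms unfolding wfam_eq_def by blast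

lemma wfam_eq_refl: "wf_fam g \<Longrightarrow> wfam_eq g g"
  unfolding wfam_eq_def wf_fam_def by (meson near_refl)

lemma wfam_eqD: "wfam_eq g h \<Longrightarrow> wf_fam g \<and> wf_fam h"
  by (simp add: wfam_eq_def)

lemma wfam_eq_sym: "wfam_eq g h \<Longrightarrow> wfam_eq h g"
  unfolding wfam_eq_def by (meson near_sym)

lemma wfam_eq_trans: "wfam_eq g h \<Longrightarrow> wfam_eq h k \<Longrightarrow> wfam_eq g k"
  unfolding wfam_eq_def by (meson near_trans)

lemma wf_append: "wf_fam g \<Longrightarrow> wf_fam h \<Longrightarrow> wf_fam (\<lambda>i. g i @ h i)"
proof -
  assume "wf_fam g" "wf_fam h"
  then obtain L L' where L: "\<And>b x. valid x \<Longrightarrow> g (b, x) \<in> genw b x \<and> length (g (b, x)) \<le> L"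
    "\<And>b x. valid x \<Longrightarrow> h (b, x) \<in> genw b x \<and> length (h (b, x)) \<le> L'"
    unfolding wf_fam_def by blast
  have "g (b, x) @ h (b, x) \<in> genw b x \<and> length (g (b, x) @ h (b, x)) \<le> L + L'" if "valid x" for b x
    using L[OF that, of b] by (simp add: add_mono)
  then show ?thesis unfolding wf_fam_def by blast
qed

lemma wf_inv: "wf_fam g \<Longrightarrow> wf_fam (\<lambda>i. word_inv (fst (snd i)) (g i))"
proof -
  assume "wf_fam g"
  then obtain L where L: "\<And>b x. valid x \<Longrightarrow> g (b, x) \<in> genw b x \<and> length (g (b, x)) \<le> L"
    unfolding wf_fam_def by blast
  have "word_inv (fst x) (g (b, x)) \<in> genw b x \<and> length (word_inv (fst x) (g (b, x))) \<le> L" if "valid x" for b x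
    using L[OF that, of b] inv_closed[OF that] by (simp add: word_inv_def)
  then show ?thesis by (intro wf_famI[of _ L]) simp
qed

lemma wf_Nil: "wf_fam (\<lambda>i. [])"
  unfolding wf_fam_def by auto

lemma wfam_eq_append:
  assumes "wfam_eq g g'" "wfam_eq h h'"
  shows "wfam_eq (\<lambda>i. g i @ h i) (\<lambda>i. g' i @ h' i)"
proof -
  obtain N where N: "\<And>b x. valid x \<Longrightarrow> near b x N (g (b, x)) (g' (b, x))"
    using wfam_eqE[OF assms(1)] by blast
  obtain N' where N': "\<And>b x. valid x \<Longrightarrow> near b x N' (h (b, x)) (h' (b, x))"
    using wfam_eqE[OF assms(2)] by blast
  show ?thesis
    using assms[THEN wfam_eqD] by (intro wfam_eqI[of _ _ "N + N'"] wf_append near_append N N') auto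
qed

lemma wfam_eq_inv:
  assumes "wfam_eq g g'"
  shows "wfam_eq (\<lambda>i. word_inv (fst (snd i)) (g i)) (\<lambda>i. word_inv (fst (snd i)) (g' i))"
proof -
  obtain N where N: "\<And>b x. valid x \<Longrightarrow> near b x N (g (b, x)) (g' (b, x))"
    using wfam_eqE[OF assms(1)] by blast
  show ?thesis
  proof (rule wfam_eqI[of _ _ N])
    show "wf_fam (\<lambda>i. word_inv (fst (snd i)) (g i))" "wf_fam (\<lambda>i. word_inv (fst (snd i)) (g' i))"
      using wfam_eqD[OF assms] by (auto intro: wf_inv)
    show "near b x N (word_inv (fst (snd (b, x))) (g (b, x))) (word_inv (fst (snd (b, x))) (g' (b, x)))"
      if "valid x" for b x
      using near_inv[OF that N[OF that]] by simp
  qed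
qed

lemma inverse_symbol_rel:
  assumes x: "valid x" and s: "s \<in> gens (Iof b) (fst x)"
  shows "[s] @ word_inv (fst x) [s] \<in> rels b x"
proof -
  obtain \<zeta> t i where s': "s = (\<zeta>, t, i)" by (cases s)
  obtain S where S: "S \<in> pairs (Iof b)" "\<zeta> \<in> pos_roots S" and t: "t \<in> carrier (fst x)" "i \<le> ht (Iof b) \<zeta>"
    using s unfolding s' gens_def rank2_roots_def by blast
  define T :: "'a sc" where "T = mk 0 (\<lambda>_. t)"
  have T: "proj y T = (if t \<in> carrier (fst y) then t else \<zero>\<^bsub>fst y\<^esub>)" if "good (fst y)" for y
    using that unfolding T_def proj_def Rep_mk by simp
  have gx: "good (fst x)" by (rule valid_good(1)[OF x])
  let ?c = "cls x (T, i)"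
  have "projw x [(\<zeta>, T, i), (\<zeta>, - T, i)] \<in> in_subgroup_rels (Iof b) (fst x) (fst (snd (snd x))) 20"
  proof (rule in_subgroup_relI[OF x _ S(1), where w' = "[(\<zeta>, ?c), (\<zeta>, - ?c)]"])
    show "wact [(\<zeta>, ?c), (\<zeta>, - ?c)] v = v" for v
    proof -
      have "act \<zeta> 0 w = w" for w :: "fock \<Rightarrow> ((nat \<Rightarrow> 'a) set, unit) fam" by (simp add: act_def fun_eq_iff)
      moreover have "\<zeta> \<in> pos_roots I_lg \<union> pos_roots I_sm"
      proof -
        have "\<zeta> \<in> rank2_roots (Iof b)" using S unfolding rank2_roots_def by blast
        then show ?thesis
          by (cases b) (auto simp: Iof_def rank2_roots_lg rank2_roots_sm pos_roots_lg pos_roots_sm)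
      qed
      ultimately show ?thesis
        using wact_add[of \<zeta> ?c "- ?c" v] by simp
    qed
  qed (use S t in \<open>auto simp: corr_cls[OF x] corr_uminus[OF x]\<close>)
  moreover have "projw x [(\<zeta>, T, i), (\<zeta>, - T, i)] = [s] @ word_inv (fst x) [s]"
    using T[OF gx] t gx by (simp add: s' word_inv_def proj_simps)
  ultimately show ?thesis by (cases x) simp
qed

lemma wfam_eq_cancel: "wf_fam g \<Longrightarrow> wfam_eq (\<lambda>i. word_inv (fst (snd i)) (g i) @ g i) (\<lambda>i. [])"
proof -
  assume g: "wf_fam g"
  then obtain L where L: "\<And>b x. valid x \<Longrightarrow> g (b, x) \<in> genw b x \<and> length (g (b, x)) \<le> L"
    unfolding wf_fam_def by blast
  have "near b x L (word_inv (fst x) (g (b, x)) @ g (b, x)) []" if x: "valid x" for b x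
  proof -
    let ?w = "word_inv (fst x) (g (b, x))"
    have "?w \<in> genw b x" "length ?w \<le> L" using L[OF x, of b] inv_closed[OF x] by (auto simp: word_inv_def)
    then have "near b x L (?w @ word_inv (fst x) ?w) []"
      using near_cancel[OF x _ inverse_symbol_rel[OF x], of ?w] near_mono[OF x] by blast
    moreover have "word_inv (fst x) ?w = g (b, x)" using L[OF x, of b] by (intro inv_inv[OF x]) blast
    ultimately show ?thesis by simp
  qed
  then show ?thesis
    using g by (intro wfam_eqI[of _ _ L] wf_append wf_inv wf_Nil) simp_all
qed

quotient_type 'a gam = "bool \<times> 'a ix \<Rightarrow> 'a word" / partial: wfam_eq
proof (rule part_equivpI)
  show "\<exists>g :: bool \<times> 'a ix \<Rightarrow> 'a word. wfam_eq g g" using wfam_eq_refl[OF wf_Nil] by blast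
  show "symp wfam_eq" by (rule sympI) (rule wfam_eq_sym)
  show "transp wfam_eq" by (rule transpI) (rule wfam_eq_trans)
qed

instantiation gam :: (type) group_add
begin

lift_definition zero_gam :: "'a gam" is "\<lambda>i. []" by (rule wfam_eq_refl[OF wf_Nil])

lift_definition plus_gam :: "'a gam \<Rightarrow> 'a gam \<Rightarrow> 'a gam" is "\<lambda>g h i. g i @ h i"
  by (rule wfam_eq_append)

lift_definition uminus_gam :: "'a gam \<Rightarrow> 'a gam" is "\<lambda>g i. word_inv (fst (snd i)) (g i)"
  by (rule wfam_eq_inv)

definition "g - h = g + - (h :: 'a gam)"

instance
proof
  fix g h k :: "'a gam"
  show "g + h + k = g + (h + k)"
    by transfer (auto intro!: wfam_eq_refl wf_append dest: wfam_eqD)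
  show "0 + g = g" by transfer simp
  show "g + 0 = g" by transfer simp
  show "- g + g = 0" by transfer (auto intro!: wfam_eq_cancel dest: wfam_eqD)
  show "g + - h = g - h" by (simp add: minus_gam_def)
qed

end

section \<open>Words with coefficients in the ring of families\<close>

definition okw :: "bool \<Rightarrow> 'a fword \<Rightarrow> bool"
  where "okw b w \<longleftrightarrow> (\<forall>(\<zeta>, t, i) \<in> set w. \<zeta> \<in> rank2_roots (Iof b) \<and> i \<le> ht (Iof b) \<zeta>)"

text \<open>At the other basis the word is empty, so that equations hold there trivially.\<close>

definition fam_word :: "bool \<Rightarrow> 'a fword \<Rightarrow> bool \<times> 'a ix \<Rightarrow> 'a word"
  where "fam_word b w = (\<lambda>(b', x). if b' = b then projw x w else [])"

definition word_gam :: "bool \<Rightarrow> 'a fword \<Rightarrow> 'a gam"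
  where "word_gam b w = abs_gam (fam_word b w)"

lemma projw_genw: "valid x \<Longrightarrow> okw b w \<Longrightarrow> projw x w \<in> genw b x"
  using valid_good(1)[of x] by (auto simp: projw_def okw_def gens_def in_lists_conv_set)

lemma wf_fam_word: "okw b w \<Longrightarrow> wf_fam (fam_word b w)"
  by (rule wf_famI[of _ "length w"]) (simp add: fam_word_def projw_genw)

lemma abs_gam_eq: "wf_fam g \<Longrightarrow> wf_fam h \<Longrightarrow> abs_gam g = abs_gam h \<longleftrightarrow> wfam_eq g h"
  using Quotient_rel[OF Quotient_gam, of g h] wfam_eq_refl by blast

lemma word_gam_Nil [simp]: "word_gam b [] = 0"
  unfolding word_gam_def zero_gam_def fam_word_def by (rule arg_cong[of _ _ abs_gam]) auto

lemma abs_gam_plus: "wf_fam g \<Longrightarrow> wf_fam h \<Longrightarrow> abs_gam g + abs_gam h = abs_gam (\<lambda>i. g i @ h i)"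
  by (rule plus_gam.abs_eq) (auto intro: wfam_eq_refl)

lemma abs_gam_uminus: "wf_fam g \<Longrightarrow> - abs_gam g = abs_gam (\<lambda>i. word_inv (fst (snd i)) (g i))"
  by (rule uminus_gam.abs_eq) (auto intro: wfam_eq_refl)

lemma word_gam_append:
  assumes "okw b w" "okw b w'"
  shows "word_gam b (w @ w') = word_gam b w + word_gam b w'"
proof -
  have "fam_word b (w @ w') = (\<lambda>i. fam_word b w i @ fam_word b w' i)"
    by (auto simp: fam_word_def fun_eq_iff)
  then show ?thesis
    unfolding word_gam_def using assms by (simp add: abs_gam_plus wf_fam_word)
qed

lemma okw_append: "okw b (w @ w') \<longleftrightarrow> okw b w \<and> okw b w'"
  unfolding okw_def set_append by blast

definition fneg :: "'a fword \<Rightarrow> 'a fword"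
  where "fneg w = rev (map (\<lambda>(\<zeta>, t, i). (\<zeta>, - t, i)) w)"

lemma okw_fneg [simp]: "okw b (fneg w) \<longleftrightarrow> okw b w"
  by (auto simp: okw_def fneg_def)

lemma projw_fneg: "valid x \<Longrightarrow> projw x (fneg w) = word_inv (fst x) (projw x w)"
  using valid_good(1)[of x] by (auto simp: projw_def fneg_def word_inv_def rev_map proj_simps)

lemma word_gam_fneg:
  assumes "okw b w"
  shows "word_gam b (fneg w) = - word_gam b w"
proof -
  have "wfam_eq (fam_word b (fneg w)) (\<lambda>i. word_inv (fst (snd i)) (fam_word b w i))"
    unfolding wfam_eq_def
  proof (intro conjI exI[of _ 0] allI impI)
    show "wf_fam (fam_word b (fneg w))" "wf_fam (\<lambda>i. word_inv (fst (snd i)) (fam_word b w i))"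
      using assms by (auto intro: wf_fam_word wf_inv)
    fix b' and x :: "'a ix" assume x: "valid x"
    show "near b' x 0 (fam_word b (fneg w) (b', x)) (word_inv (fst (snd (b', x))) (fam_word b w (b', x)))"
      using x assms projw_genw[OF x, of b "fneg w"]
      by (auto simp: fam_word_def projw_fneg[OF x, symmetric] intro!: near_refl)
  qed
  then show ?thesis
    unfolding word_gam_def abs_gam_uminus[OF wf_fam_word[OF assms]]
    using abs_gam_eq wfam_eqD by blast
qed

lemma word_gam_eq_0I:
  assumes "okw b w" "\<And>x. valid x \<Longrightarrow> projw x w \<in> rels b x"
  shows "word_gam b w = 0"
proof -
  have "wfam_eq (fam_word b w) (\<lambda>i. [])"
    unfolding wfam_eq_def
  proof (intro conjI exI[of _ 1] allI impI)
    show "wf_fam (fam_word b w)" "wf_fam (\<lambda>i :: bool \<times> 'a ix. [])"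
      using assms(1) by (auto intro: wf_fam_word wf_Nil)
    fix b' and x :: "'a ix" assume x: "valid x"
    show "near b' x 1 (fam_word b w (b', x)) []"
      using near_rel[OF x assms(2)[OF x] projw_genw[OF x assms(1)]] near_refl[OF x, of "[]" b']
      by (auto simp: fam_word_def)
  qed
  then show ?thesis
    unfolding word_gam_def zero_gam_def by (simp add: abs_gam_eq wfam_eqD)
qed

text \<open>The way back from the group: unfolding the quotient turns a single equation into one
  bound for all fields, polynomials and parameters.\<close>

lemma word_gam_eq_0D:
  assumes "okw b w" "word_gam b w = 0"
  shows "\<exists>N. \<forall>x. valid x \<longrightarrow> derivable_within (Iof b) (fst x) (rels b x) N (projw x w)"
proof -
  have "wfam_eq (fam_word b w) (\<lambda>i. [])"
    using assms unfolding word_gam_def zero_gam_def by (simp add: abs_gam_eq wf_fam_word wf_Nil)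
  then obtain N where N: "\<And>x. valid x \<Longrightarrow> near b x N (fam_word b w (b, x)) []"
    unfolding wfam_eq_def by blast
  have "derivable_within (Iof b) (fst x) (rels b x) N (projw x w)" if "valid x" for x
    using near_derivable[OF that N[OF that]] by (simp add: fam_word_def)
  then show ?thesis by blast
qed

text \<open>The value 0 above the height lets the commutation assumptions of the locales be stated
  without bounds on the degrees.\<close>

definition letter :: "bool \<Rightarrow> root \<Rightarrow> nat \<Rightarrow> 'a sc \<Rightarrow> 'a gam"
  where "letter b \<zeta> i t = (if i \<le> ht (Iof b) \<zeta> then word_gam b [(\<zeta>, t, i)] else 0)"

lemma okw_simps [simp]: "okw b []"
  "okw b ((\<zeta>, t, i) # w) \<longleftrightarrow> \<zeta> \<in> rank2_roots (Iof b) \<and> i \<le> ht (Iof b) \<zeta> \<and> okw b w"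
  by (simp_all add: okw_def)

lemma word_gam_Cons:
  assumes "okw b ((\<zeta>, t, i) # w)"
  shows "word_gam b ((\<zeta>, t, i) # w) = letter b \<zeta> i t + word_gam b w"
  using assms word_gam_append[of b "[(\<zeta>, t, i)]" w] by (simp add: letter_def)

lemma letter_uminus: "\<zeta> \<in> rank2_roots (Iof b) \<Longrightarrow> letter b \<zeta> i (- t) = - letter b \<zeta> i t"
  using word_gam_fneg[of b "[(\<zeta>, t, i)]"] by (simp add: letter_def fneg_def)

lemma rank2_rootsD:
  assumes "\<zeta> \<in> rank2_roots (Iof b)"
  obtains S where "S \<in> pairs (Iof b)" "\<zeta> \<in> pos_roots S"
  using assms unfolding rank2_roots_def by blast

lemma pairs_Iof: "S \<in> pairs (Iof b) \<Longrightarrow> S \<in> pairs I_lg \<union> pairs I_sm"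
  by (cases b) (simp_all add: Iof_def)

lemma word_gam_in_subgroup:
  assumes S: "S \<in> pairs (Iof b)"
    and w: "\<And>\<zeta> t i. (\<zeta>, t, i) \<in> set w \<Longrightarrow> \<zeta> \<in> pos_roots S \<and> i \<le> ht (Iof b) \<zeta>" "length w \<le> 20"
    and c: "\<And>x. valid x \<Longrightarrow> list_all2 (corr_letter x) w (w' x)"
    and v: "\<And>x v. valid x \<Longrightarrow> wact (w' x) v = v"
  shows "word_gam b w = 0"
proof (rule word_gam_eq_0I)
  show "okw b w"
    using w(1) S unfolding okw_def rank2_roots_def by blast
  fix x :: "'a ix" assume x: "valid x"
  have "projw x w \<in> in_subgroup_rels (Iof b) (fst x) (fst (snd (snd x))) 20"
    using w(1) by (rule in_subgroup_relI[OF x _ S w(2) c[OF x] v[OF x]])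
  then show "projw x w \<in> rels b x" by (cases x) simp
qed

lemma letter_add:
  assumes "\<zeta> \<in> rank2_roots (Iof b)"
  shows "letter b \<zeta> i (t + u) = letter b \<zeta> i t + letter b \<zeta> i u"
proof (cases "i \<le> ht (Iof b) \<zeta>")
  case True
  obtain S where S: "S \<in> pairs (Iof b)" "\<zeta> \<in> pos_roots S" using rank2_rootsD[OF assms] .
  have P: "\<zeta> \<in> pos_roots I_lg \<union> pos_roots I_sm"
    using assms by (cases b) (auto simp: Iof_def rank2_roots_lg rank2_roots_sm pos_roots_lg pos_roots_sm)
  have "word_gam b [(\<zeta>, t, i), (\<zeta>, u, i), (\<zeta>, - (t + u), i)] = 0"
  proof (rule word_gam_in_subgroup[OF S(1)])
    fix x :: "'a ix" assume x: "valid x"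
    show "list_all2 (corr_letter x) [(\<zeta>, t, i), (\<zeta>, u, i), (\<zeta>, - (t + u), i)]
      [(\<zeta>, cls x (t, i)), (\<zeta>, cls x (u, i)), (\<zeta>, - (cls x (t, i) + cls x (u, i)))]"
      using x by (simp add: corr_cls corr_uminus corr_add del: minus_add_distrib)
    show "wact [(\<zeta>, cls x (t, i)), (\<zeta>, cls x (u, i)), (\<zeta>, - (cls x (t, i) + cls x (u, i)))] v = v" for v
      by (rule wact_add[OF P])
  qed (use S(2) True in auto)
  then have "letter b \<zeta> i t + letter b \<zeta> i u - letter b \<zeta> i (t + u) = 0"
    using assms True
    by (simp add: word_gam_Cons letter_uminus add_diff_eq del: minus_add_distrib)
  then show ?thesis by simp
next
  case False
  then show ?thesis by (simp add: letter_def)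
qed

lemma idx_pos_roots:
  assumes "\<zeta> \<in> pos_roots (Iof b)" "\<eta> \<in> pos_roots (Iof b)" "(m, n) \<in> set (idx \<zeta> \<eta>)"
  shows "m \<bullet> \<zeta> + n \<bullet> \<eta> \<in> pos_roots (Iof b) \<and> ht (Iof b) (m \<bullet> \<zeta> + n \<bullet> \<eta>) = m * ht (Iof b) \<zeta> + n * ht (Iof b) \<eta>"
proof -
  have "list_all (\<lambda>(m, n). m \<bullet> \<zeta> + n \<bullet> \<eta> \<in> pos_roots (Iof b) \<and>
      ht (Iof b) (m \<bullet> \<zeta> + n \<bullet> \<eta>) = m * ht (Iof b) \<zeta> + n * ht (Iof b) \<eta>) (idx \<zeta> \<eta>)"
  proof (cases b)
    case True
    then have b: "b = True" by simp
    show ?thesis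
      using assms(1,2) unfolding b Iof_def if_True if_False pos_roots_lg insert_iff empty_iff
      by (elim disjE FalseE; hypsubst; simp add: idx_def Phi_iff plus_prod_def)
  next
    case False
    then have b: "b = False" by simp
    show ?thesis
      using assms(1,2) unfolding b Iof_def if_True if_False pos_roots_sm insert_iff empty_iff
      by (elim disjE FalseE; hypsubst; simp add: idx_def Phi_iff plus_prod_def)
  qed
  then show ?thesis using assms(3) unfolding list_all_iff by blast
qed

lemma scal_distrib: "(m * n) \<bullet> \<zeta> = m \<bullet> n \<bullet> \<zeta>" "(m + n) \<bullet> \<zeta> = m \<bullet> \<zeta> + n \<bullet> \<zeta>"
    "m \<bullet> (\<zeta> + \<eta>) = m \<bullet> \<zeta> + m \<bullet> \<eta>" "m \<bullet> 0 = 0"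
  by (cases \<zeta>; cases \<eta>; simp add: plus_prod_def zero_prod_def algebra_simps)+

lemma scal_sum: "m \<bullet> (\<Sum>\<eta>\<in>S. c \<eta> \<bullet> \<eta>) = (\<Sum>\<eta>\<in>S. (m * c \<eta>) \<bullet> \<eta>)"
  by (induction S rule: infinite_finite_induct) (simp_all add: scal_distrib)

lemma pos_roots_combination:
  assumes "\<zeta> \<in> pos_roots S" "\<eta> \<in> pos_roots S" "m \<bullet> \<zeta> + n \<bullet> \<eta> \<in> Phi"
  shows "m \<bullet> \<zeta> + n \<bullet> \<eta> \<in> pos_roots S"
proof -
  obtain c d where cd: "\<zeta> = (\<Sum>\<theta>\<in>S. c \<theta> \<bullet> \<theta>)" "\<eta> = (\<Sum>\<theta>\<in>S. d \<theta> \<bullet> \<theta>)"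
    using assms(1,2) unfolding pos_roots_def by blast
  have "m \<bullet> \<zeta> + n \<bullet> \<eta> = (\<Sum>\<theta>\<in>S. (m * c \<theta> + n * d \<theta>) \<bullet> \<theta>)"
    unfolding cd scal_sum by (simp add: scal_distrib(2) sum.distrib)
  with assms(3) show ?thesis
    unfolding pos_roots_def by (intro CollectI conjI exI[of _ "\<lambda>\<theta>. m * c \<theta> + n * d \<theta>"])
qed

lemma rank2_roots_subset: "rank2_roots (Iof b) \<subseteq> pos_roots (Iof b)"
  by (cases b) (auto simp: Iof_def rank2_roots_lg rank2_roots_sm pos_roots_lg pos_roots_sm)

lemma idx_roots:
  assumes "S \<in> pairs (Iof b)" "\<zeta> \<in> pos_roots S" "\<eta> \<in> pos_roots S" "(m, n) \<in> set (idx \<zeta> \<eta>)"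
  shows "m \<bullet> \<zeta> + n \<bullet> \<eta> \<in> pos_roots S \<and> ht (Iof b) (m \<bullet> \<zeta> + n \<bullet> \<eta>) = m * ht (Iof b) \<zeta> + n * ht (Iof b) \<eta>"
proof
  show "m \<bullet> \<zeta> + n \<bullet> \<eta> \<in> pos_roots S"
    using assms by (intro pos_roots_combination) (auto simp: idx_def split: if_splits)
  have "{\<zeta>, \<eta>} \<subseteq> pos_roots (Iof b)"
    using assms(1-3) rank2_roots_subset[of b] unfolding rank2_roots_def by blast
  then show "ht (Iof b) (m \<bullet> \<zeta> + n \<bullet> \<eta>) = m * ht (Iof b) \<zeta> + n * ht (Iof b) \<eta>"
    using idx_pos_roots assms(4) by blast
qed

definition comm_rhs :: "root \<Rightarrow> root \<Rightarrow> 'r::comm_ring_1 \<Rightarrow> 'r \<Rightarrow> nat \<Rightarrow> nat \<Rightarrow> (root \<times> 'r \<times> nat) list"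
  where "comm_rhs \<zeta> \<eta> t u i j =
    map (\<lambda>(m, n). (m \<bullet> \<zeta> + n \<bullet> \<eta>, of_int (struct_const \<zeta> \<eta> m n) * (t ^ m * u ^ n), m * i + n * j)) (idx \<zeta> \<eta>)"

lemma cmt_letter:
  assumes S: "S \<in> pairs (Iof b)" "\<zeta> \<in> pos_roots S" "\<eta> \<in> pos_roots S"
    and i: "i \<le> ht (Iof b) \<zeta>" "j \<le> ht (Iof b) \<eta>"
  shows "cmt (letter b \<zeta> i t) (letter b \<eta> j u) = word_gam b (comm_rhs \<zeta> \<eta> t u i j)"
proof -
  have r: "\<zeta> \<in> rank2_roots (Iof b)" "\<eta> \<in> rank2_roots (Iof b)"
    using S unfolding rank2_roots_def by blast+
  have rhs: "\<theta> \<in> pos_roots S \<and> k \<le> ht (Iof b) \<theta>" if "(\<theta>, s, k) \<in> set (comm_rhs \<zeta> \<eta> t u i j)" for \<theta> s k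
  proof -
    from that obtain m n where mn: "(m, n) \<in> set (idx \<zeta> \<eta>)" "\<theta> = m \<bullet> \<zeta> + n \<bullet> \<eta>" "k = m * i + n * j"
      unfolding comm_rhs_def by auto
    then show ?thesis
      using idx_roots[OF S mn(1)] i by (simp add: add_mono)
  qed
  have ok: "okw b (comm_rhs \<zeta> \<eta> t u i j)"
    using rhs S(1) unfolding okw_def rank2_roots_def by blast
  have "word_gam b ([(\<zeta>, t, i), (\<eta>, u, j), (\<zeta>, - t, i), (\<eta>, - u, j)] @ fneg (comm_rhs \<zeta> \<eta> t u i j)) = 0"
  proof (rule word_gam_in_subgroup[OF S(1)])
    fix x :: "'a ix" assume x: "valid x"
    let ?T = "cls x (t, i)" and ?U = "cls x (u, j)"
    have c: "corr x (t, i) ?T" "corr x (u, j) ?U" using x by (auto intro: corr_cls)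
    have "list_all2 (corr_letter x) (fneg (comm_rhs \<zeta> \<eta> t u i j))
      (neg_word (steinberg_rhs \<zeta> \<eta> ?T ?U))"
    proof -
      have "corr x (- (of_int k * (t ^ m * u ^ n)), m * i + n * j) (- (of_int k * (?T ^ m * ?U ^ n)))" for k m n
        using c by (intro corr_uminus[OF x] corr_of_int[OF x] corr_mult[OF x] corr_power[OF x])
      then show ?thesis
        unfolding fneg_def neg_word_def comm_rhs_def steinberg_rhs_def list_all2_rev map_map list_all2_map1
            list_all2_map2
        by (intro list.rel_refl_strong) (simp only: comp_def case_prod_beta fst_conv snd_conv simp_thms)
    qed
    then show "list_all2 (corr_letter x)
        ([(\<zeta>, t, i), (\<eta>, u, j), (\<zeta>, - t, i), (\<eta>, - u, j)] @ fneg (comm_rhs \<zeta> \<eta> t u i j))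
        (comm_word (\<zeta>, ?T) (\<eta>, ?U) @ neg_word (steinberg_rhs \<zeta> \<eta> ?T ?U))"
    proof -
      have w: "comm_word (\<zeta>, ?T) (\<eta>, ?U) = [(\<zeta>, ?T), (\<eta>, ?U), (\<zeta>, - ?T), (\<eta>, - ?U)]"
        by (simp add: comm_word_def neg_word_def)
      assume "list_all2 (corr_letter x) (fneg (comm_rhs \<zeta> \<eta> t u i j))
        (neg_word (steinberg_rhs \<zeta> \<eta> ?T ?U))"
      then show ?thesis
        unfolding w append.simps list.rel_inject prod.case using c corr_uminus[OF x] by blast
    qed
    show "wact (comm_word (\<zeta>, ?T) (\<eta>, ?U) @ neg_word (steinberg_rhs \<zeta> \<eta> ?T ?U)) v = v" for v
      by (rule wact_steinberg[OF pairs_Iof[OF S(1)] S(2,3)])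
  next
    show "length ([(\<zeta>, t, i), (\<eta>, u, j), (\<zeta>, - t, i), (\<eta>, - u, j)] @ fneg (comm_rhs \<zeta> \<eta> t u i j)) \<le> 20"
      unfolding length_append fneg_def comm_rhs_def length_rev length_map
      using length_filter_le[of "\<lambda>(a, b). a \<bullet> \<zeta> + b \<bullet> \<eta> \<in> Phi" "[(1, 1), (1, 2), (2, 1)]"]
      unfolding idx_def[symmetric] by simp
    fix \<theta> s k assume "(\<theta>, s, k) \<in> set ([(\<zeta>, t, i), (\<eta>, u, j), (\<zeta>, - t, i), (\<eta>, - u, j)] @ fneg (comm_rhs \<zeta> \<eta> t u
        i j))"
    then show "\<theta> \<in> pos_roots S \<and> k \<le> ht (Iof b) \<theta>"
      using S(2,3) i rhs by (auto simp: fneg_def)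
  qed
  moreover have "okw b [(\<zeta>, t, i), (\<eta>, u, j), (\<zeta>, - t, i), (\<eta>, - u, j)]"
    using r i by simp
  ultimately have "word_gam b [(\<zeta>, t, i), (\<eta>, u, j), (\<zeta>, - t, i), (\<eta>, - u, j)] - word_gam b (comm_rhs \<zeta> \<eta> t u i
      j) = 0"
    using ok word_gam_append[of b "[(\<zeta>, t, i), (\<eta>, u, j), (\<zeta>, - t, i), (\<eta>, - u, j)]" "fneg (comm_rhs \<zeta> \<eta> t u i j)"]
    by (simp only: word_gam_fneg okw_fneg diff_conv_add_uminus simp_thms)
  then have "word_gam b [(\<zeta>, t, i), (\<eta>, u, j), (\<zeta>, - t, i), (\<eta>, - u, j)] = word_gam b (comm_rhs \<zeta> \<eta> t u i j)"
    by (simp only: right_minus_eq)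
  then show ?thesis
    using r i by (simp add: word_gam_Cons letter_uminus cmt_def diff_conv_add_uminus add.assoc del:
        add_uminus_conv_diff)
qed

section \<open>Lifts of the integer words\<close>

lemma conv_eval: "conv p q 0 = p 0 * q 0" "conv p q 1 = p 0 * q 1 + p 1 * q 0"
  "conv p q 2 = p 0 * q 2 + p 1 * q 1 + p 2 * q 0"
  "conv p q 3 = p 0 * q 3 + p 1 * q 2 + p 2 * q 1 + p 3 * q 0"
proof -
  have "{..1::nat} = {0, 1}" "{..2::nat} = {0, 1, 2}" "{..3::nat} = {0, 1, 2, 3}" by auto
  then show "conv p q 0 = p 0 * q 0" "conv p q 1 = p 0 * q 1 + p 1 * q 0"
    "conv p q 2 = p 0 * q 2 + p 1 * q 1 + p 2 * q 0"
    "conv p q 3 = p 0 * q 3 + p 1 * q 2 + p 2 * q 1 + p 3 * q 0"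
    unfolding conv_def by (simp_all add: add.assoc)
qed

lemma conv_pow_eval: "conv_pow p 1 = conv (lin_seq 1 0) p" "conv_pow p 2 = conv (conv (lin_seq 1 0) p) p"
  by (simp_all only: One_nat_def numeral_2_eq_2 conv_pow.simps)

lemma lifted_rels_subset: "lifted_rels (Iof b) (fst x) (fst (snd x)) 20 \<subseteq> rels b x"
  by (cases x) simp

definition pick :: "root \<times> root \<times> root \<Rightarrow> 'r \<Rightarrow> 'r \<Rightarrow> 'r \<Rightarrow> root \<Rightarrow> 'r"
  where "pick = (\<lambda>(r1, r2, r3) s t u r. if r = r1 then s else if r = r2 then t else u)"

abbreviation basis :: "bool \<Rightarrow> root \<times> root \<times> root"
  where "basis b \<equiv> if b then ((1,-1,0), (0,1,-1), (0,0,1)) else ((0,1,-1), (0,0,1), (-1,0,0))"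

context
  fixes A0 A1 B0 B1 C0 C1 :: "'a sc"
begin

text \<open>The polynomials A, B, C belong to the roots in the order of \<open>basis\<close>:
  \<alpha>, \<beta>, \<psi> for the large and \<beta>, \<psi>, \<omega> for the small basis.\<close>

definition block :: "bool \<Rightarrow> root \<times> int \<Rightarrow> 'a fword"
  where "block b s = flift (Iof b) (basis b) (pick (basis b) A0 B0 C0) (pick (basis b) A1 B1 C1) [s]"

lemmas block_eval = block_def flift_def lift_seq_def pick_def root_coeff_lg_simps root_coeff_sm_simps coeff3_def
  Iof_def conv_eval conv_pow_eval lin_seq_def upt_rec power2_eq_square

lemma block_lg:
  "block True ((1,-1,0), n) = [((1,-1,0), of_int n * A0, 0), ((1,-1,0), of_int n * A1, 1)]"
  "block True ((0,0,1), n) = [((0,0,1), of_int n * C0, 0), ((0,0,1), of_int n * C1, 1)]"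
  "block True ((1,0,-1), n) = [((1,0,-1), of_int n * (A0 * B0), 0), ((1,0,-1), of_int n * (A0 * B1 + A1 * B0), 1),
    ((1,0,-1), of_int n * (A1 * B1), 2)]"
  "block True ((0,1,0), n) = [((0,1,0), of_int n * (B0 * C0), 0), ((0,1,0), of_int n * (B0 * C1 + B1 * C0), 1),
    ((0,1,0), of_int n * (B1 * C1), 2)]"
  "block True ((0,1,1), n) = [((0,1,1), of_int n * (B0 * C0\<^sup>2), 0),
    ((0,1,1), of_int n * (B1 * C0\<^sup>2 + 2 * (B0 * (C0 * C1))), 1),
    ((0,1,1), of_int n * (2 * (B1 * (C0 * C1)) + B0 * C1\<^sup>2), 2), ((0,1,1), of_int n * (B1 * C1\<^sup>2), 3)]"
  by (simp_all add: block_eval algebra_simps)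

lemma block_sm:
  "block False ((0,1,-1), n) = [((0,1,-1), of_int n * A0, 0), ((0,1,-1), of_int n * A1, 1)]"
  "block False ((-1,0,0), n) = [((-1,0,0), of_int n * C0, 0), ((-1,0,0), of_int n * C1, 1)]"
  "block False ((0,1,0), n) = [((0,1,0), of_int n * (A0 * B0), 0), ((0,1,0), of_int n * (A0 * B1 + A1 * B0), 1),
    ((0,1,0), of_int n * (A1 * B1), 2)]"
  "block False ((-1,0,1), n) = [((-1,0,1), of_int n * (B0 * C0), 0), ((-1,0,1), of_int n * (B0 * C1 + B1 * C0), 1),
    ((-1,0,1), of_int n * (B1 * C1), 2)]"
  "block False ((0,1,1), n) = [((0,1,1), of_int n * (A0 * B0\<^sup>2), 0),
    ((0,1,1), of_int n * (A1 * B0\<^sup>2 + 2 * (A0 * (B0 * B1))), 1),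
    ((0,1,1), of_int n * (2 * (A1 * (B0 * B1)) + A0 * B1\<^sup>2), 2), ((0,1,1), of_int n * (A1 * B1\<^sup>2), 3)]"
  by (simp_all add: block_eval algebra_simps)

definition ev :: "bool \<Rightarrow> (root \<times> int) list \<Rightarrow> 'a gam"
  where "ev b w = sum_list (map (\<lambda>s. word_gam b (block b s)) w)"

lemma okw_flift: "(\<And>\<zeta> n. (\<zeta>, n) \<in> set w \<Longrightarrow> \<zeta> \<in> rank2_roots (Iof b)) \<Longrightarrow> okw b (flift (Iof b) rs T0 T1 w)"
  using flift_gens unfolding okw_def by fast

lemma word_gam_flift:
  assumes "\<And>\<zeta> n. (\<zeta>, n) \<in> set w \<Longrightarrow> \<zeta> \<in> rank2_roots (Iof b)"
  shows "word_gam b (flift (Iof b) (basis b) (pick (basis b) A0 B0 C0) (pick (basis b) A1 B1 C1) w) = ev b w"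
  using assms
proof (induction w)
  case Nil
  then show ?case by (simp add: flift_def ev_def)
next
  case (Cons s w)
  have "flift (Iof b) (basis b) (pick (basis b) A0 B0 C0) (pick (basis b) A1 B1 C1) (s # w)
    = block b s @ flift (Iof b) (basis b) (pick (basis b) A0 B0 C0) (pick (basis b) A1 B1 C1) w"
    by (simp add: flift_def block_def del: upt_Suc)
  moreover have "okw b (block b s)"
    unfolding block_def
  proof (rule okw_flift)
    show "\<zeta> \<in> rank2_roots (Iof b)" if "(\<zeta>, n) \<in> set [s]" for \<zeta> n
      using that by (intro Cons.prems[of \<zeta> n]) simp
  qed
  moreover have r: "\<zeta> \<in> rank2_roots (Iof b)" if "(\<zeta>, n) \<in> set w" for \<zeta> n
    using that by (intro Cons.prems[of \<zeta> n]) simp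
  moreover have "okw b (flift (Iof b) (basis b) (pick (basis b) A0 B0 C0) (pick (basis b) A1 B1 C1) w)"
    using r by (rule okw_flift)
  ultimately show ?case
    using Cons.IH[OF r] by (simp add: word_gam_append ev_def)
qed

lemma ev_base_word:
  assumes w: "w \<in> set (if b then base_words_lg else base_words_sm)"
  shows "ev b w = 0"
proof -
  have r: "\<zeta> \<in> rank2_roots (Iof b)" if "(\<zeta>, n) \<in> set w" for \<zeta> n
    using w that by (cases b) (auto simp: base_words_lg_def base_words_sm_def comm_word_def neg_word_def Iof_def
        rank2_roots_lg rank2_roots_sm)
  have l: "length w \<le> 20"
    using w by (cases b) (auto simp: base_words_lg_def base_words_sm_def comm_word_def neg_word_def)
  have a: "wact (map (\<lambda>(r, n). (r, of_int n)) w) v = v" for v :: "fock \<Rightarrow> ('a, unit) fam"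
    using w by (intro wact_base_words) (auto split: if_splits)
  have "word_gam b (flift (Iof b) (basis b) (pick (basis b) A0 B0 C0) (pick (basis b) A1 B1 C1) w) = 0"
  proof (rule word_gam_eq_0I)
    show "okw b (flift (Iof b) (basis b) (pick (basis b) A0 B0 C0) (pick (basis b) A1 B1 C1) w)"
      using r by (rule okw_flift)
    fix x :: "'a ix" assume x: "valid x"
    define r1 r2 r3 where "r1 = fst (basis b)" "r2 = fst (snd (basis b))" "r3 = snd (snd (basis b))"
    then have bs: "basis b = (r1, r2, r3)" by simp
    have I: "r1 \<noteq> r2" "r1 \<noteq> r3" "r2 \<noteq> r3" "Iof b = {r1, r2, r3}"
      unfolding \<open>r1 = _\<close> \<open>r2 = _\<close> \<open>r3 = _\<close> by (cases b; simp add: Iof_def I_lg_eq I_sm_eq)+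
    show "projw x (flift (Iof b) (basis b) (pick (basis b) A0 B0 C0) (pick (basis b) A1 B1 C1) w) \<in> rels b x"
      unfolding bs by (rule subsetD[OF lifted_rels_subset lifted_relI[OF x r l a I]])
  qed
  then show ?thesis using r by (simp only: word_gam_flift)
qed

end


text \<open>The lift of a negated symbol lists its degrees in increasing order, while the inverse
  word lists them in decreasing order. They agree because letters at one root commute.\<close>

lemma quad_uminus:
  assumes "\<And>i t. Y i (- t) = - Y i t" "\<And>i j s t. cm (Y i s) (Y j t)"
  shows "quad Y (- p) (- q) (- r) = - quad Y p q r" "cub Y (- p) (- q) (- r) (- s) = - cub Y p q r s"
    "lin Y (- p) (- q) = - lin Y p q"
proof -
  have c: "Y i s + Y j t = Y j t + Y i s" "Y i s + (Y j t + z) = Y j t + (Y i s + z)" for i j s t z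
    using assms(2)[of i s j t] by (simp_all add: cm_def flip: add.assoc)
  note n = minus_add assms(1)[symmetric] add.assoc c[where i = 1 and j = 0] c[where i = 2 and j = 0] c[where i =
      2 and j = 1] c[where i = 3 and j = 0] c[where i = 3 and j = 1] c[where i = 3 and j = 2]
  show "quad Y (- p) (- q) (- r) = - quad Y p q r" by (simp only: quad_def n)
  show "cub Y (- p) (- q) (- r) (- s) = - cub Y p q r s" by (simp only: cub_def n)
  show "lin Y (- p) (- q) = - lin Y p q" by (simp only: lin_def n)
qed

lemma cm_letter_root:
  assumes "S \<in> pairs (Iof b)" "\<zeta> \<in> pos_roots S" "\<eta> \<in> pos_roots S" "idx \<zeta> \<eta> = []"
  shows "cm (letter b \<zeta> i t) (letter b \<eta> j u)"
proof (cases "i \<le> ht (Iof b) \<zeta> \<and> j \<le> ht (Iof b) \<eta>")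
  case True
  then show ?thesis
    using cmt_letter[OF assms(1-3), of i j t u] by (simp add: comm_rhs_def assms(4) cmt_eq_0)
qed (auto simp: letter_def)

section \<open>The letters of the large basis\<close>

abbreviation "s_a \<equiv> letter True (1,-1,0)"
abbreviation "s_b \<equiv> letter True (0,1,-1)"
abbreviation "s_c \<equiv> letter True (0,0,1)"
abbreviation "s_ab \<equiv> letter True (1,0,-1)"
abbreviation "s_bc \<equiv> letter True (0,1,0)"
abbreviation "s_bcc \<equiv> letter True (0,1,1)"

lemma pairs_members:
  "{(1,-1,0), (0,1,-1)} \<in> pairs (Iof True)" "{(0,1,-1), (0,0,1)} \<in> pairs (Iof True)"
  "{(1,-1,0), (0,0,1)} \<in> pairs (Iof True)" "{(0,1,-1), (0,0,1)} \<in> pairs (Iof False)"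
  "{(0,0,1), (-1,0,0)} \<in> pairs (Iof False)" "{(0,1,-1), (-1,0,0)} \<in> pairs (Iof False)"
  by (simp_all add: Iof_def pairs_lg pairs_sm)

lemmas pair_roots = pos_roots_ab pos_roots_bc pos_roots_ac pos_roots_co pos_roots_bo
lemmas idx_eval = idx_def Phi_iff plus_prod_def
lemmas in_ab = cm_letter_root[OF pairs_members(1), unfolded pair_roots]
  and in_bc = cm_letter_root[OF pairs_members(2), unfolded pair_roots]
  and in_ac = cm_letter_root[OF pairs_members(3), unfolded pair_roots]
  and in_bp = cm_letter_root[OF pairs_members(4), unfolded pair_roots]
  and in_pq = cm_letter_root[OF pairs_members(5), unfolded pair_roots]
  and in_bq = cm_letter_root[OF pairs_members(6), unfolded pair_roots]

lemma Iof_simps [simp]: "Iof True = I_lg" "Iof False = I_sm"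
  by (simp_all add: Iof_def)

lemmas rank2_simps = rank2_roots_lg rank2_roots_sm

lemma cm_lg:
  "cm (s_a i s) (s_a j t)" "cm (s_b i s) (s_b j t)" "cm (s_c i s) (s_c j t)" "cm (s_ab i s) (s_ab j t)"
  "cm (s_bc i s) (s_bc j t)" "cm (s_bcc i s) (s_bcc j t)" "cm (s_a i s) (s_ab j t)" "cm (s_b i s) (s_ab j t)"
  "cm (s_a i s) (s_c j t)" "cm (s_b i s) (s_bc j t)" "cm (s_b i s) (s_bcc j t)" "cm (s_c i s) (s_bcc j t)"
  "cm (s_bc i s) (s_bcc j t)"
  by (rule in_ab in_bc in_ac; simp add: idx_eval; fail)+

lemma uminus_lg: "s_a i (- t) = - s_a i t" "s_b i (- t) = - s_b i t" "s_c i (- t) = - s_c i t"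
  "s_ab i (- t) = - s_ab i t" "s_bc i (- t) = - s_bc i t" "s_bcc i (- t) = - s_bcc i t"
  by (rule letter_uminus; simp add: rank2_simps)+

lemma block_gam_lg:
  fixes A0 A1 B0 B1 C0 C1 :: "'a sc"
  shows "word_gam True (block A0 A1 B0 B1 C0 C1 True ((1,-1,0), n)) = lin s_a (of_int n * A0) (of_int n * A1)"
    "word_gam True (block A0 A1 B0 B1 C0 C1 True ((0,0,1), n)) = lin s_c (of_int n * C0) (of_int n * C1)"
    "word_gam True (block A0 A1 B0 B1 C0 C1 True ((1,0,-1), n)) =
      quad s_ab (of_int n * (A0 * B0)) (of_int n * (A0 * B1 + A1 * B0)) (of_int n * (A1 * B1))"
    "word_gam True (block A0 A1 B0 B1 C0 C1 True ((0,1,0), n)) =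
      quad s_bc (of_int n * (B0 * C0)) (of_int n * (B0 * C1 + B1 * C0)) (of_int n * (B1 * C1))"
    "word_gam True (block A0 A1 B0 B1 C0 C1 True ((0,1,1), n)) =
      cub s_bcc (of_int n * (B0 * C0\<^sup>2)) (of_int n * (B1 * C0\<^sup>2 + 2 * (B0 * (C0 * C1))))
        (of_int n * (2 * (B1 * (C0 * C1)) + B0 * C1\<^sup>2)) (of_int n * (B1 * C1\<^sup>2))"
  unfolding block_lg lin_def quad_def cub_def by (simp_all add: word_gam_Cons rank2_simps add.assoc)


lemma block_neg_lg:
  assumes "r \<in> {(1,-1,0), (0,0,1), (1,0,-1), (0,1,0), (0,1,1)}"
  shows "word_gam True (block A0 A1 B0 B1 C0 C1 True (r, - n)) = - word_gam True (block A0 A1 B0 B1 C0 C1 True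
      (r, n))"
  using assms
  by (auto simp: block_gam_lg quad_uminus uminus_lg cm_lg simp del: minus_add_distrib add_uminus_conv_diff)

lemma ev_append: "ev A0 A1 B0 B1 C0 C1 b (w @ w') = ev A0 A1 B0 B1 C0 C1 b w + ev A0 A1 B0 B1 C0 C1 b w'"
  by (simp add: ev_def)

lemma ev_comm_word_lg:
  assumes "r \<in> {(1,-1,0), (0,0,1), (1,0,-1), (0,1,0), (0,1,1)}" "r' \<in> {(1,-1,0), (0,0,1), (1,0,-1), (0,1,0), (0,1,1)}"
  shows "ev A0 A1 B0 B1 C0 C1 True (comm_word (r, m) (r', n)) = cmt (word_gam True (block A0 A1 B0 B1 C0 C1 True
      (r, m)))
    (word_gam True (block A0 A1 B0 B1 C0 C1 True (r', n)))"
  by (simp add: block_neg_lg[OF assms(1)] block_neg_lg[OF assms(2)] ev_def comm_word_def neg_word_def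
      cmt_def diff_conv_add_uminus add.assoc del: add_uminus_conv_diff)

interpretation lg: large half s_a s_b s_c s_ab s_bc s_bcc
proof unfold_locales
  show "2 * half = (1 :: 'a sc)" by (rule half)
  show "s_a i (s + t) = s_a i s + s_a i t" "s_b i (s + t) = s_b i s + s_b i t" "s_c i (s + t) = s_c i s + s_c i t"
    "s_ab i (s + t) = s_ab i s + s_ab i t" "s_bc i (s + t) = s_bc i s + s_bc i t"
    "s_bcc i (s + t) = s_bcc i s + s_bcc i t" for i and s t :: "'a sc"
    by (rule letter_add; simp add: rank2_simps)+
  show "cmt (s_a i s) (s_b j t) = s_ab (i + j) (s * t)" if "i \<le> 1" "j \<le> 1" for i j and s t :: "'a sc"
    using cmt_letter[OF pairs_members(1), unfolded pair_roots, of "(1,-1,0)" "(0,1,-1)" i j s t] that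
    by (simp add: comm_rhs_def idx_eval struct_const_def lie_const_values word_gam_Cons rank2_simps)
  show "cmt (s_b i s) (s_c j t) = s_bc (i + j) (s * t) + s_bcc (i + 2 * j) (- (s * t\<^sup>2))"
    if "i \<le> 1" "j \<le> 1" for i j and s t :: "'a sc"
    using cmt_letter[OF pairs_members(2), unfolded pair_roots, of "(0,1,-1)" "(0,0,1)" i j s t] that
    by (simp add: comm_rhs_def idx_eval struct_const_def lie_const_values word_gam_Cons rank2_simps)
  show "cmt (s_bc i s) (s_c j t) = s_bcc (i + j) (2 * (s * t))" if "i \<le> 2" "j \<le> 1" for i j and s t :: "'a sc"
    using cmt_letter[OF pairs_members(2), unfolded pair_roots, of "(0,1,0)" "(0,0,1)" i j s t] that
    by (simp add: comm_rhs_def idx_eval struct_const_def lie_const_values word_gam_Cons rank2_simps)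
next
  fix A0 A1 B0 B1 C0 C1 :: "'a sc"
  let ?ev = "ev A0 A1 B0 B1 C0 C1 True"
  have n: "quad s_bc (- p) (- q) (- r) = - quad s_bc p q r" "quad s_ab (- p) (- q) (- r) = - quad s_ab p q r"
    "cub s_bcc (- p) (- q) (- r) (- s) = - cub s_bcc p q r s" "lin s_c (- p) (- q) = - lin s_c p q"
    for p q r s :: "'a sc"
    by (rule quad_uminus; simp add: uminus_lg cm_lg)+
  have e: "?ev w = 0" if "w \<in> set base_words_lg" for w
    using ev_base_word[of w True] that by simp
  have one: "?ev [s] = word_gam True (block A0 A1 B0 B1 C0 C1 True s)" for s by (simp add: ev_def)
  let ?a = "lin s_a A0 A1" and ?c = "lin s_c C0 C1"
    and ?ab = "quad s_ab (A0 * B0) (A0 * B1 + A1 * B0) (A1 * B1)"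
    and ?bc = "quad s_bc (B0 * C0) (B0 * C1 + B1 * C0) (B1 * C1)"
    and ?bcc = "cub s_bcc (B0 * C0\<^sup>2) (B1 * C0\<^sup>2 + 2 * (B0 * (C0 * C1)))
        (2 * (B1 * (C0 * C1)) + B0 * C1\<^sup>2) (B1 * C1\<^sup>2)"
    and ?bcc2 = "cub s_bcc (- (2 * (B0 * C0\<^sup>2))) (- (2 * (B1 * C0\<^sup>2 + 2 * (B0 * (C0 * C1)))))
        (- (2 * (2 * (B1 * (C0 * C1)) + B0 * C1\<^sup>2))) (- (2 * (B1 * C1\<^sup>2)))"
  let ?B = "\<lambda>r k. word_gam True (block A0 A1 B0 B1 C0 C1 True (r, k))"
  have B: "?B (1,-1,0) 1 = ?a" "?B (0,0,1) 1 = ?c" "?B (1,0,-1) 1 = ?ab" "?B (0,1,0) 1 = ?bc" "?B (0,1,1) 1 = ?bcc"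
    "?B (0,0,1) (-1) = - ?c" "?B (1,0,-1) (-1) = - ?ab" "?B (0,1,0) (-1) = - ?bc" "?B (0,1,1) (-1) = - ?bcc"
    "?B (0,1,1) (-2) = ?bcc2"
    unfolding block_gam_lg of_int_1 of_int_minus of_int_numeral mult_1_left mult_minus1 n mult_minus_left by
        (rule refl)+
  note ev = ev_append ev_comm_word_lg one B insert_iff simp_thms
  show "cm ?ab ?bc"
    using e[of "comm_word ((1,0,-1), 1) ((0,1,0), 1)"] by (simp add: base_words_lg_def ev cmt_eq_0)
  have "cmt ?ab ?c + cmt ?ab (- ?c) + cmt ?bcc2 ?a = 0"
    using e[of "comm_word ((1,0,-1), 1) ((0,0,1), 1) @ comm_word ((1,0,-1), 1) ((0,0,1), -1)
      @ comm_word ((0,1,1), -2) ((1,-1,0), 1)"] by (simp add: base_words_lg_def ev add.assoc)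
  then show "cmt ?ab ?c + cmt ?ab (- ?c) = cmt ?a ?bcc2"
    unfolding cmt_swap[of ?bcc2 ?a] by (simp add: eq_neg_iff_add_eq_0 del: minus_add_distrib)
  have "?bc + (cmt ?a ?bcc + (- ?bc + cmt ?bcc ?a)) = 0"
    using e[of "[((0,1,0), 1)] @ comm_word ((1,-1,0), 1) ((0,1,1), 1) @ [((0,1,0), -1)]
      @ comm_word ((0,1,1), 1) ((1,-1,0), 1)"] by (simp only: ev) (simp add: base_words_lg_def add.assoc del:
          add_uminus_conv_diff)
  then show "cm ?bc (cmt ?a ?bcc)"
    unfolding cmt_swap[of ?bcc ?a] cmt_eq_0[symmetric] cmt_def[of _ "cmt ?a ?bcc"]
    by (simp add: diff_conv_add_uminus add.assoc del: add_uminus_conv_diff)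
  have "?ab + (cmt ?a ?bcc + (- ?ab + cmt ?bcc ?a)) = 0"
    using e[of "[((1,0,-1), 1)] @ comm_word ((1,-1,0), 1) ((0,1,1), 1) @ [((1,0,-1), -1)]
      @ comm_word ((0,1,1), 1) ((1,-1,0), 1)"] by (simp only: ev) (simp add: base_words_lg_def add.assoc del:
          add_uminus_conv_diff)
  then show "cm ?ab (cmt ?a ?bcc)"
    unfolding cmt_swap[of ?bcc ?a] cmt_eq_0[symmetric] cmt_def[of _ "cmt ?a ?bcc"]
    by (simp add: diff_conv_add_uminus add.assoc del: add_uminus_conv_diff)
  have "cmt ?ab ?c + cmt ?a ?bcc + cmt (- ?bcc) ?ab + cmt ?bc ?a = 0"
    using e[of "comm_word ((1,0,-1), 1) ((0,0,1), 1) @ comm_word ((1,-1,0), 1) ((0,1,1), 1)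
      @ comm_word ((0,1,1), -1) ((1,0,-1), 1) @ comm_word ((0,1,0), 1) ((1,-1,0), 1)"]
    by (simp only: ev) (simp add: base_words_lg_def add.assoc)
  then show "cmt ?ab ?c + cmt ?a ?bcc = cmt ?a ?bc + cmt ?ab (- ?bcc)"
    unfolding cmt_swap[of "- ?bcc" ?ab] cmt_swap[of ?bc ?a] add_uminus_conv_diff right_minus_eq diff_eq_eq
        add_0_left .
qed (rule cm_lg)+


section \<open>The letters of the small basis\<close>

abbreviation "t_b \<equiv> letter False (0,1,-1)"
abbreviation "t_p \<equiv> letter False (0,0,1)"
abbreviation "t_q \<equiv> letter False (-1,0,0)"
abbreviation "t_bp \<equiv> letter False (0,1,0)"
abbreviation "t_bpp \<equiv> letter False (0,1,1)"
abbreviation "t_pq \<equiv> letter False (-1,0,1)"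

lemma cm_sm:
  "cm (t_bp i s) (t_bp j t)" "cm (t_pq i s) (t_pq j t)" "cm (t_b i s) (t_bp j t)" "cm (t_b i s) (t_q j t)"
  "cm (t_bp i s) (t_bpp j t)" "cm (t_q i s) (t_pq j t)" "cm (t_p i s) (t_bpp j t)" "cm (t_p i s) (t_pq j t)"
  "cm (t_b i s) (t_b j t)" "cm (t_p i s) (t_p j t)" "cm (t_q i s) (t_q j t)" "cm (t_bpp i s) (t_bpp j t)"
  "cm (t_b i s) (t_bpp j t)"
  by (rule in_bp in_pq in_bq; simp add: idx_eval; fail)+

lemma uminus_sm: "t_b i (- t) = - t_b i t" "t_p i (- t) = - t_p i t" "t_q i (- t) = - t_q i t"
  "t_bp i (- t) = - t_bp i t" "t_bpp i (- t) = - t_bpp i t" "t_pq i (- t) = - t_pq i t"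
  by (rule letter_uminus; simp add: rank2_simps)+

lemma block_gam_sm:
  fixes A0 A1 B0 B1 C0 C1 :: "'a sc"
  shows "word_gam False (block A0 A1 B0 B1 C0 C1 False ((0,1,-1), n)) = lin t_b (of_int n * A0) (of_int n * A1)"
    "word_gam False (block A0 A1 B0 B1 C0 C1 False ((-1,0,0), n)) = lin t_q (of_int n * C0) (of_int n * C1)"
    "word_gam False (block A0 A1 B0 B1 C0 C1 False ((0,1,0), n)) =
      quad t_bp (of_int n * (A0 * B0)) (of_int n * (A0 * B1 + A1 * B0)) (of_int n * (A1 * B1))"
    "word_gam False (block A0 A1 B0 B1 C0 C1 False ((-1,0,1), n)) =
      quad t_pq (of_int n * (B0 * C0)) (of_int n * (B0 * C1 + B1 * C0)) (of_int n * (B1 * C1))"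
    "word_gam False (block A0 A1 B0 B1 C0 C1 False ((0,1,1), n)) =
      cub t_bpp (of_int n * (A0 * B0\<^sup>2)) (of_int n * (A1 * B0\<^sup>2 + 2 * (A0 * (B0 * B1))))
        (of_int n * (2 * (A1 * (B0 * B1)) + A0 * B1\<^sup>2)) (of_int n * (A1 * B1\<^sup>2))"
  unfolding block_sm lin_def quad_def cub_def by (simp_all add: word_gam_Cons rank2_simps add.assoc)

lemma block_neg_sm:
  assumes "r \<in> {(0,1,-1), (-1,0,0), (0,1,0), (-1,0,1), (0,1,1)}"
  shows "word_gam False (block A0 A1 B0 B1 C0 C1 False (r, - n)) = - word_gam False (block A0 A1 B0 B1 C0 C1
      False (r, n))"
  using assms
  by (auto simp: block_gam_sm quad_uminus uminus_sm cm_sm simp del: minus_add_distrib add_uminus_conv_diff)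

lemma ev_comm_word_sm:
  assumes "r \<in> {(0,1,-1), (-1,0,0), (0,1,0), (-1,0,1), (0,1,1)}" "r' \<in> {(0,1,-1), (-1,0,0), (0,1,0), (-1,0,1),
      (0,1,1)}"
  shows "ev A0 A1 B0 B1 C0 C1 False (comm_word (r, m) (r', n)) = cmt (word_gam False (block A0 A1 B0 B1 C0 C1
      False (r, m)))
    (word_gam False (block A0 A1 B0 B1 C0 C1 False (r', n)))"
  by (simp add: block_neg_sm[OF assms(1)] block_neg_sm[OF assms(2)] ev_def comm_word_def neg_word_def
      cmt_def diff_conv_add_uminus add.assoc del: add_uminus_conv_diff)

interpretation sm: small t_b t_p t_q t_bp t_bpp t_pq half
proof unfold_locales
  show "2 * half = (1 :: 'a sc)" by (rule half)
  show "t_b i (s + t) = t_b i s + t_b i t" "t_p i (s + t) = t_p i s + t_p i t" "t_q i (s + t) = t_q i s + t_q i t"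
    "t_bp i (s + t) = t_bp i s + t_bp i t" "t_bpp i (s + t) = t_bpp i s + t_bpp i t"
    "t_pq i (s + t) = t_pq i s + t_pq i t" for i and s t :: "'a sc"
    by (rule letter_add; simp add: rank2_simps)+
  show "cmt (t_bp i s) (t_p j t) = t_bpp (i + j) (2 * (s * t))" if "i \<le> 2" "j \<le> 1" for i j and s t :: "'a sc"
    using cmt_letter[OF pairs_members(4), unfolded pair_roots, of "(0,1,0)" "(0,0,1)" i j s t] that
    by (simp add: comm_rhs_def idx_eval struct_const_def lie_const_values word_gam_Cons rank2_simps)
  show "cmt (t_p i s) (t_q j t) = t_pq (i + j) (2 * (s * t))" if "i \<le> 1" "j \<le> 1" for i j and s t :: "'a sc"
    using cmt_letter[OF pairs_members(5), unfolded pair_roots, of "(0,0,1)" "(-1,0,0)" i j s t] that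
    by (simp add: comm_rhs_def idx_eval struct_const_def lie_const_values word_gam_Cons rank2_simps)
next
  fix A0 A1 B0 B1 C0 C1 :: "'a sc"
  let ?ev = "ev A0 A1 B0 B1 C0 C1 False"
  have e: "?ev w = 0" if "w \<in> set base_words_sm" for w
    using ev_base_word[of w False] that by simp
  let ?b = "lin t_b A0 A1" and ?q = "lin t_q C0 C1"
    and ?bp = "quad t_bp (A0 * B0) (A0 * B1 + A1 * B0) (A1 * B1)"
    and ?pq = "quad t_pq (B0 * C0) (B0 * C1 + B1 * C0) (B1 * C1)"
    and ?pq2 = "quad t_pq (2 * (B0 * C0)) (2 * (B0 * C1 + B1 * C0)) (2 * (B1 * C1))"
    and ?bpp = "cub t_bpp (A0 * B0\<^sup>2) (A1 * B0\<^sup>2 + 2 * (A0 * (B0 * B1)))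
        (2 * (A1 * (B0 * B1)) + A0 * B1\<^sup>2) (A1 * B1\<^sup>2)"
  let ?B = "\<lambda>r k. word_gam False (block A0 A1 B0 B1 C0 C1 False (r, k))"
  have B: "?B (0,1,-1) 1 = ?b" "?B (-1,0,0) 1 = ?q" "?B (0,1,0) 1 = ?bp" "?B (-1,0,1) 1 = ?pq" "?B (0,1,1) 1 = ?bpp"
    "?B (-1,0,1) 2 = ?pq2"
    unfolding block_gam_sm of_int_1 of_int_numeral mult_1_left by (rule refl)+
  note ev = ev_append ev_comm_word_sm B insert_iff simp_thms
  have "cmt ?bp ?q + cmt ?pq2 ?b = 0"
    using e[of "comm_word ((0,1,0), 1) ((-1,0,0), 1) @ comm_word ((-1,0,1), 2) ((0,1,-1), 1)"]
    by (simp add: base_words_sm_def ev)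
  then show "cmt ?bp ?q = cmt ?b ?pq2"
    unfolding cmt_swap[of ?pq2 ?b] by simp
  show "cm ?bpp ?q"
    using e[of "comm_word ((0,1,1), 1) ((-1,0,0), 1)"] by (simp add: base_words_sm_def ev cmt_eq_0)
  show "cm ?bp ?pq"
    using e[of "comm_word ((0,1,0), 1) ((-1,0,1), 1)"] by (simp add: base_words_sm_def ev cmt_eq_0)
qed (rule cm_sm)+

section \<open>Aliases and the Steinberg relations\<close>

definition cw :: "('s \<Rightarrow> 's) \<Rightarrow> root \<times> 's \<times> nat \<Rightarrow> root \<times> 's \<times> nat \<Rightarrow> (root \<times> 's \<times> nat) list"
  where "cw neg = (\<lambda>(r, t, i) (r', u, j). [(r, t, i), (r', u, j), (r, neg t, i), (r', neg u, j)])"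

text \<open>
  Since \<open>(i - n) + min i n = i\<close>, truncated subtraction distributes the degree over the two factors of a
  commutator.  The last case multiplies $[x_{\alpha+\beta}, x_\psi]$ by a commutator
  $[x_\alpha, x_{\beta+2\psi}]$ that cancels its factor at the root $\alpha+\beta+2\psi$.
\<close>

definition alg :: "'s \<Rightarrow> ('s \<Rightarrow> 's) \<Rightarrow> bool \<Rightarrow> root \<Rightarrow> 's \<Rightarrow> nat \<Rightarrow> (root \<times> 's \<times> nat) list"
  where "alg e neg b \<zeta> t i =
    (if \<not> b then cw neg ((0,1,-1), t, i - 2) ((-1,0,1), e, min i 2)
     else if \<zeta> = (1,0,1) then cw neg ((1,-1,0), t, i - 3) ((0,1,1), e, min i 3)
     else if \<zeta> = (1,1,0) then cw neg ((1,0,-1), t, i - 3) ((0,1,1), neg e, min i 3)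
     else cw neg ((1,0,-1), t, min i 2) ((0,0,1), e, i - 2)
       @ cw neg ((1,-1,0), t, min i 2 + 2 * (i - 2) - 3) ((0,1,1), e, min (min i 2 + 2 * (i - 2)) 3))"

definition alias_of :: "'a ring \<Rightarrow> bool \<Rightarrow> 'a symb \<Rightarrow> 'a word"
  where "alias_of K b = (\<lambda>(\<zeta>, t, i). alg \<one>\<^bsub>K\<^esub> (\<lambda>t. \<ominus>\<^bsub>K\<^esub> t) b \<zeta> t i)"

definition exw :: "bool \<Rightarrow> root \<Rightarrow> 'a sc \<Rightarrow> nat \<Rightarrow> 'a fword"
  where "exw b \<zeta> t i = (if \<zeta> \<in> rank2_roots (Iof b) then [(\<zeta>, t, i)] else alg 1 uminus b \<zeta> t i)"

lemma projw_alg: "valid x \<Longrightarrow> projw x (alg 1 uminus b \<zeta> t i) = alias_of (fst x) b (\<zeta>, proj x t, i)"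
proof -
  assume x: "valid x"
  interpret cring "fst x" by (rule valid_cring[OF x])
  show ?thesis
    using valid_good(1)[OF x] by (simp add: alg_def alias_of_def cw_def proj_simps minus_minus del: Iof_simps)
qed

lemma projw_exw: "valid x \<Longrightarrow> projw x (exw b \<zeta> t i) = expand (Iof b) (alias_of (fst x) b) (\<zeta>, proj x t, i)"
  by (simp add: exw_def expand_def projw_alg)

lemma pos_not_rank2:
  "\<zeta> \<in> pos_roots (Iof b) \<Longrightarrow> \<zeta> \<notin> rank2_roots (Iof b) \<Longrightarrow>
    b \<and> (\<zeta> = (1,0,0) \<or> \<zeta> = (1,0,1) \<or> \<zeta> = (1,1,0)) \<or> \<not> b \<and> \<zeta> = (-1,1,0)"
  by (cases b) (auto simp: pos_roots_lg pos_roots_sm rank2_simps)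

lemma okw_alg:
  assumes "\<zeta> \<in> pos_roots (Iof b)" "\<zeta> \<notin> rank2_roots (Iof b)" "i \<le> ht (Iof b) \<zeta>"
  shows "okw b (alg 1 uminus b \<zeta> t i)"
  using pos_not_rank2[OF assms(1,2)] assms(3)
  by (elim disjE conjE) (auto simp: alg_def cw_def rank2_simps okw_append min_def)

lemma okw_exw: "\<zeta> \<in> pos_roots (Iof b) \<Longrightarrow> i \<le> ht (Iof b) \<zeta> \<Longrightarrow> okw b (exw b \<zeta> t i)"
  by (simp add: exw_def okw_alg)

lemma word_gam_cw:
  assumes "okw b (cw uminus (r, t, i) (r', u, j))"
  shows "word_gam b (cw uminus (r, t, i) (r', u, j)) = cmt (letter b r i t) (letter b r' j u)"
  using assms unfolding cw_def
  by (simp add: word_gam_Cons letter_uminus cmt_def diff_conv_add_uminus add.assoc del: add_uminus_conv_diff)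

definition elt :: "bool \<Rightarrow> root \<Rightarrow> nat \<Rightarrow> 'a sc \<Rightarrow> 'a gam"
  where "elt b \<zeta> i t = word_gam b (exw b \<zeta> t i)"

lemma elt_lg:
  "i \<le> 1 \<Longrightarrow> elt True (1,-1,0) i t = s_a i t" "i \<le> 1 \<Longrightarrow> elt True (0,1,-1) i t = s_b i t"
  "i \<le> 1 \<Longrightarrow> elt True (0,0,1) i t = s_c i t" "i \<le> 2 \<Longrightarrow> elt True (1,0,-1) i t = s_ab i t"
  "i \<le> 2 \<Longrightarrow> elt True (0,1,0) i t = s_bc i t" "i \<le> 3 \<Longrightarrow> elt True (0,1,1) i t = s_bcc i t"
  by (simp_all add: elt_def exw_def rank2_simps letter_def)

text \<open>The alias words repeat the definitions of \<open>lg.abc\<close>, \<open>lg.abcc\<close>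
  and \<open>lg.abbcc\<close> symbol by symbol, including the truncated subtractions.\<close>

lemma elt_lg':
  "i \<le> 3 \<Longrightarrow> elt True (1,0,0) i t = lg.abc i t" "i \<le> 4 \<Longrightarrow> elt True (1,0,1) i t = lg.abcc i t"
  "i \<le> 5 \<Longrightarrow> elt True (1,1,0) i t = lg.abbcc i t"
proof -
  assume i: "i \<le> 3"
  have "okw True (alg 1 uminus True (1,0,0) t i)"
    using i by (intro okw_alg) (simp_all add: pos_roots_lg rank2_simps)
  then show "elt True (1,0,0) i t = lg.abc i t"
    unfolding elt_def exw_def alg_def
    by (simp add: rank2_simps okw_append word_gam_append word_gam_cw lg.abc_def lg.abcc_def)
next
  assume i: "i \<le> 4"
  have "okw True (alg 1 uminus True (1,0,1) t i)"
    using i by (intro okw_alg) (simp_all add: pos_roots_lg rank2_simps)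
  then show "elt True (1,0,1) i t = lg.abcc i t"
    unfolding elt_def exw_def alg_def by (simp add: rank2_simps word_gam_cw lg.abcc_def)
next
  assume i: "i \<le> 5"
  have "okw True (alg 1 uminus True (1,1,0) t i)"
    using i by (intro okw_alg) (simp_all add: pos_roots_lg rank2_simps)
  then show "elt True (1,1,0) i t = lg.abbcc i t"
    unfolding elt_def exw_def alg_def by (simp add: rank2_simps word_gam_cw lg.abbcc_def)
qed

lemma elt_sm:
  "i \<le> 1 \<Longrightarrow> elt False (0,1,-1) i t = t_b i t" "i \<le> 1 \<Longrightarrow> elt False (0,0,1) i t = t_p i t"
  "i \<le> 1 \<Longrightarrow> elt False (-1,0,0) i t = t_q i t" "i \<le> 2 \<Longrightarrow> elt False (0,1,0) i t = t_bp i t"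
  "i \<le> 3 \<Longrightarrow> elt False (0,1,1) i t = t_bpp i t" "i \<le> 2 \<Longrightarrow> elt False (-1,0,1) i t = t_pq i t"
  by (simp_all add: elt_def exw_def rank2_simps letter_def)

lemma elt_sm': "i \<le> 3 \<Longrightarrow> elt False (-1,1,0) i t = sm.bpq i t"
proof -
  assume i: "i \<le> 3"
  have "okw False (alg 1 uminus False (-1,1,0) t i)"
    using i by (intro okw_alg) (simp_all add: pos_roots_sm rank2_simps)
  then show ?thesis
    unfolding elt_def exw_def alg_def by (simp add: rank2_simps word_gam_cw sm.bpq_def)
qed

lemmas elt_values = elt_lg elt_lg' elt_sm elt_sm'

lemma elt_add:
  fixes t u :: "'a sc"
  assumes "\<zeta> \<in> pos_roots (Iof b)" "i \<le> ht (Iof b) \<zeta>"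
  shows "elt b \<zeta> i (t + u) = elt b \<zeta> i t + elt b \<zeta> i u"
proof (cases "\<zeta> \<in> rank2_roots (Iof b)")
  case True
  then have "elt b \<zeta> i s = letter b \<zeta> i s" for s :: "'a sc"
    using assms(2) by (simp add: elt_def exw_def letter_def)
  then show ?thesis using letter_add[OF True] by simp
next
  case False
  from pos_not_rank2[OF assms(1) False] assms(2) show ?thesis
    by (elim disjE conjE) (simp_all add: elt_values lg.abc_add lg.abcc_add lg.abbcc_add sm.bpq_add)
qed

section \<open>Commutators of all positive roots\<close>

lemma commutators_lg:
  fixes s t :: "'a sc"
  shows "i \<le> 1 \<Longrightarrow> j \<le> 1 \<Longrightarrow> cmt (s_b i s) (s_a j t) = s_ab (i + j) (- (s * t))"
    "i \<le> 2 \<Longrightarrow> j \<le> 1 \<Longrightarrow> cmt (s_bc i s) (s_a j t) = lg.abc (i + j) (- (s * t)) + lg.abbcc (2 * i + j) (s\<^sup>2 * t)"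
    "i \<le> 3 \<Longrightarrow> j \<le> 1 \<Longrightarrow> cmt (s_bcc i s) (s_a j t) = lg.abcc (i + j) (- (s * t))"
    "i \<le> 1 \<Longrightarrow> j \<le> 1 \<Longrightarrow> cmt (s_c i s) (s_b j t) = s_bc (i + j) (- (s * t)) + s_bcc (2 * i + j) (s\<^sup>2 * t)"
    "i \<le> 4 \<Longrightarrow> j \<le> 1 \<Longrightarrow> cmt (lg.abcc i s) (s_b j t) = lg.abbcc (i + j) (- (s * t))"
    "i \<le> 1 \<Longrightarrow> j \<le> 2 \<Longrightarrow> cmt (s_c i s) (s_ab j t) = lg.abc (i + j) (- (s * t)) + lg.abcc (2 * i + j) (s\<^sup>2 * t)"
    "i \<le> 1 \<Longrightarrow> j \<le> 2 \<Longrightarrow> cmt (s_c i s) (s_bc j t) = s_bcc (i + j) (- (2 * (s * t)))"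
    "i \<le> 1 \<Longrightarrow> j \<le> 3 \<Longrightarrow> cmt (s_c i s) (lg.abc j t) = lg.abcc (i + j) (- (2 * (s * t)))"
    "i \<le> 3 \<Longrightarrow> j \<le> 2 \<Longrightarrow> cmt (s_bcc i s) (s_ab j t) = lg.abbcc (i + j) (s * t)"
    "i \<le> 2 \<Longrightarrow> j \<le> 3 \<Longrightarrow> cmt (s_bc i s) (lg.abc j t) = lg.abbcc (i + j) (- (2 * (s * t)))"
proof -
  have abc: "lg.abc d (- v) = - lg.abc d v" if "d \<le> 3" for d and v :: "'a sc"
    using additive_uminus[of "lg.abc d"] lg.abc_add[OF that] by blast
  note n = minus_add uminus_lg lg.abcc_uminus lg.abbcc_uminus abc
  \<comment> \<open>Swapping the arguments inverts the commutator and so reverses its two factors;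
    these facts restore the order required by the Steinberg relation.\<close>
  have c: "- lg.abbcc k y + - lg.abc d v = - lg.abc d v + - lg.abbcc k y" if "d \<le> 3" "k \<le> 5" for d k and v y ::
      "'a sc"
    using lg.abbcc_abc[OF that, of y v] by (simp add: cm_def del: add_uminus_conv_diff flip: minus_add)
  have c': "- lg.abcc k y + - lg.abc d v = - lg.abc d v + - lg.abcc k y" if "d \<le> 3" "k \<le> 4" for d k and v y :: "'a sc"
    using lg.abcc_abc[OF that, of y v] by (simp add: cm_def del: add_uminus_conv_diff flip: minus_add)
  have c'': "- s_bcc k y + - s_bc d v = - s_bc d v + - s_bcc k y" for d k and v y :: "'a sc"
    using cm_lg(13)[of d v k y] by (simp add: cm_def del: add_uminus_conv_diff flip: minus_add)
  show "i \<le> 1 \<Longrightarrow> j \<le> 1 \<Longrightarrow> cmt (s_b i s) (s_a j t) = s_ab (i + j) (- (s * t))"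
    by (simp add: cmt_swap[of "s_b _ _"] lg.cmt_a_b n add.commute mult.commute)
  show "i \<le> 2 \<Longrightarrow> j \<le> 1 \<Longrightarrow> cmt (s_bc i s) (s_a j t) = lg.abc (i + j) (- (s * t)) + lg.abbcc (2 * i + j) (s\<^sup>2 * t)"
    using lg.cmt_a_bc[of j i t s] c[of "i + j" "2 * i + j" "- (s\<^sup>2 * t)" "s * t"]
    by (simp add: cmt_swap[of "s_bc _ _"] n add.commute[of j] mult.commute[of t] del: add_uminus_conv_diff)
  show "i \<le> 3 \<Longrightarrow> j \<le> 1 \<Longrightarrow> cmt (s_bcc i s) (s_a j t) = lg.abcc (i + j) (- (s * t))"
    by (simp add: cmt_swap[of "s_bcc _ _"] lg.cmt_a_bcc_abcc n add.commute mult.commute)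
  show "i \<le> 1 \<Longrightarrow> j \<le> 1 \<Longrightarrow> cmt (s_c i s) (s_b j t) = s_bc (i + j) (- (s * t)) + s_bcc (2 * i + j) (s\<^sup>2 * t)"
    using lg.cmt_b_c[of j i t s] c''[of "2 * i + j" "- (s\<^sup>2 * t)" "i + j" "s * t"]
    by (simp add: cmt_swap[of "s_c _ _"] n add.commute[of j] mult.commute[of t] del: add_uminus_conv_diff)
  show "i \<le> 4 \<Longrightarrow> j \<le> 1 \<Longrightarrow> cmt (lg.abcc i s) (s_b j t) = lg.abbcc (i + j) (- (s * t))"
    by (simp add: cmt_swap[of "lg.abcc _ _"] lg.cmt_b_abcc n add.commute mult.commute)
  show "i \<le> 1 \<Longrightarrow> j \<le> 2 \<Longrightarrow> cmt (s_c i s) (s_ab j t) = lg.abc (i + j) (- (s * t)) + lg.abcc (2 * i + j) (s\<^sup>2 * t)"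
    using lg.cmt_ab_c[of j i t s] c'[of "i + j" "2 * i + j" "- (s\<^sup>2 * t)" "s * t"]
    by (simp add: cmt_swap[of "s_c _ _"] n add.commute[of j] mult.commute[of t] del: add_uminus_conv_diff)
  show "i \<le> 1 \<Longrightarrow> j \<le> 2 \<Longrightarrow> cmt (s_c i s) (s_bc j t) = s_bcc (i + j) (- (2 * (s * t)))"
    by (simp add: cmt_swap[of "s_c _ _"] lg.cmt_bc_c n add.commute mult.commute)
  show "i \<le> 1 \<Longrightarrow> j \<le> 3 \<Longrightarrow> cmt (s_c i s) (lg.abc j t) = lg.abcc (i + j) (- (2 * (s * t)))"
    by (simp add: cmt_swap[of "s_c _ _"] lg.cmt_abc_c n add.commute mult.commute)
  show "i \<le> 3 \<Longrightarrow> j \<le> 2 \<Longrightarrow> cmt (s_bcc i s) (s_ab j t) = lg.abbcc (i + j) (s * t)"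
    by (simp add: cmt_swap[of "s_bcc _ _"] lg.cmt_ab_bcc n add.commute mult.commute)
  show "i \<le> 2 \<Longrightarrow> j \<le> 3 \<Longrightarrow> cmt (s_bc i s) (lg.abc j t) = lg.abbcc (i + j) (- (2 * (s * t)))"
    by (simp add: cmt_swap[of "s_bc _ _"] lg.cmt_abc_bc n add.commute mult.commute)
qed

lemma commutators_sm:
  fixes s t :: "'a sc"
  shows "i \<le> 1 \<Longrightarrow> j \<le> 1 \<Longrightarrow> cmt (t_b i s) (t_p j t) = t_bp (i + j) (s * t) + t_bpp (i + 2 * j) (- (s * t\<^sup>2))"
    "i \<le> 1 \<Longrightarrow> j \<le> 1 \<Longrightarrow> cmt (t_p i s) (t_b j t) = t_bp (i + j) (- (s * t)) + t_bpp (2 * i + j) (s\<^sup>2 * t)"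
    "i \<le> 2 \<Longrightarrow> j \<le> 1 \<Longrightarrow> cmt (t_pq i s) (t_b j t) = sm.bpq (i + j) (- (s * t))"
    "i \<le> 1 \<Longrightarrow> j \<le> 2 \<Longrightarrow> cmt (t_p i s) (t_bp j t) = t_bpp (i + j) (- (2 * (s * t)))"
    "i \<le> 1 \<Longrightarrow> j \<le> 1 \<Longrightarrow> cmt (t_q i s) (t_p j t) = t_pq (i + j) (- (2 * (s * t)))"
    "i \<le> 1 \<Longrightarrow> j \<le> 2 \<Longrightarrow> cmt (t_q i s) (t_bp j t) = sm.bpq (i + j) (- (2 * (s * t)))"
proof -
  have bpq: "sm.bpq d (- v) = - sm.bpq d v" if "d \<le> 3" for d and v :: "'a sc"
    using additive_uminus[of "sm.bpq d"] sm.bpq_add[OF that] by blast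
  note n = minus_add uminus_sm bpq
  show 1: "cmt (t_b i s) (t_p j t) = t_bp (i + j) (s * t) + t_bpp (i + 2 * j) (- (s * t\<^sup>2))"
    if "i \<le> 1" "j \<le> 1" for i j and s t :: "'a sc"
    using cmt_letter[OF pairs_members(4), unfolded pair_roots, of "(0,1,-1)" "(0,0,1)" i j s t] that
    by (simp add: comm_rhs_def idx_eval struct_const_def lie_const_values word_gam_Cons rank2_simps)
  have c: "- t_bpp k y + - t_bp d v = - t_bp d v + - t_bpp k y" for d k and v y :: "'a sc"
    using cm_sm(5)[of d v k y] by (simp add: cm_def del: add_uminus_conv_diff flip: minus_add)
  show "i \<le> 1 \<Longrightarrow> j \<le> 1 \<Longrightarrow> cmt (t_p i s) (t_b j t) = t_bp (i + j) (- (s * t)) + t_bpp (2 * i + j) (s\<^sup>2 * t)"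
    using 1[of j i t s] c[of "2 * i + j" "- (s\<^sup>2 * t)" "i + j" "s * t"]
    by (simp add: cmt_swap[of "t_p _ _"] n add.commute[of j] mult.commute[of t] del: add_uminus_conv_diff)
  show "i \<le> 2 \<Longrightarrow> j \<le> 1 \<Longrightarrow> cmt (t_pq i s) (t_b j t) = sm.bpq (i + j) (- (s * t))"
    by (simp add: cmt_swap[of "t_pq _ _"] sm.cmt_b_pq n add.commute mult.commute)
  show "i \<le> 1 \<Longrightarrow> j \<le> 2 \<Longrightarrow> cmt (t_p i s) (t_bp j t) = t_bpp (i + j) (- (2 * (s * t)))"
    by (simp add: cmt_swap[of "t_p _ _"] sm.cmt_bp_p n add.commute mult.commute)
  show "i \<le> 1 \<Longrightarrow> j \<le> 1 \<Longrightarrow> cmt (t_q i s) (t_p j t) = t_pq (i + j) (- (2 * (s * t)))"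
    by (simp add: cmt_swap[of "t_q _ _"] sm.cmt_p_q n add.commute mult.commute)
  show "i \<le> 1 \<Longrightarrow> j \<le> 2 \<Longrightarrow> cmt (t_q i s) (t_bp j t) = sm.bpq (i + j) (- (2 * (s * t)))"
    by (simp add: cmt_swap[of "t_q _ _"] sm.cmt_bp_q n add.commute mult.commute)
qed

lemmas commuting_lg = cm_lg lg.ab_bc lg.a_abcc lg.c_abcc lg.bc_abcc lg.bcc_abcc lg.ab_abcc lg.abcc_abcc
    lg.a_abbcc lg.b_abbcc
  lg.c_abbcc lg.ab_abbcc lg.bc_abbcc lg.bcc_abbcc lg.abcc_abbcc lg.abbcc_abbcc lg.a_abc lg.b_abc lg.ab_abc lg.bcc_abc
  lg.abcc_abc lg.abbcc_abc lg.abc_abc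
lemmas commuting_sm = cm_sm sm.bpp_q sm.bpp_pq sm.bp_pq sm.b_bpq sm.q_bpq sm.bp_bpq sm.bpp_bpq sm.pq_bpq
    sm.p_bpq sm.bpq_bpq

lemmas table_lg = commuting_lg[THEN cmt_0] commuting_lg[THEN cm_sym, THEN cmt_0] lg.cmt_a_b lg.cmt_a_bc
    lg.cmt_a_bcc_abcc
  lg.cmt_b_c lg.cmt_b_abcc lg.cmt_ab_c lg.cmt_ab_bcc lg.cmt_bc_c lg.cmt_abc_c lg.cmt_abc_bc commutators_lg
lemmas table_sm = commuting_sm[THEN cmt_0] commuting_sm[THEN cm_sym, THEN cmt_0] commutators_sm
  sm.cmt_b_pq sm.cmt_bp_q sm.cmt_bp_p sm.cmt_p_q

lemmas elt_eval = idx_eval struct_const_def lie_const_values elt_values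

text \<open>There are 81 ordered pairs of roots, but the degrees stay symbolic, so each pair needs
  only its entry in \<open>table_lg\<close>.\<close>

lemma cmt_elt_lg:
  assumes "\<zeta> \<in> pos_roots I_lg" "\<eta> \<in> pos_roots I_lg" "i \<le> ht I_lg \<zeta>" "j \<le> ht I_lg \<eta>"
  shows "cmt (elt True \<zeta> i t) (elt True \<eta> j u) =
    sum_list (map (\<lambda>(m, n). elt True (m \<bullet> \<zeta> + n \<bullet> \<eta>) (m * i + n * j)
      (of_int (struct_const \<zeta> \<eta> m n) * (t ^ m * u ^ n))) (idx \<zeta> \<eta>))"
  using assms unfolding pos_roots_lg insert_iff empty_iff
  by (elim disjE FalseE; hypsubst) (simp_all add: elt_eval table_lg)

lemma cmt_elt_sm:
  assumes "\<zeta> \<in> pos_roots I_sm" "\<eta> \<in> pos_roots I_sm" "i \<le> ht I_sm \<zeta>" "j \<le> ht I_sm \<eta>"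
  shows "cmt (elt False \<zeta> i t) (elt False \<eta> j u) =
    sum_list (map (\<lambda>(m, n). elt False (m \<bullet> \<zeta> + n \<bullet> \<eta>) (m * i + n * j)
      (of_int (struct_const \<zeta> \<eta> m n) * (t ^ m * u ^ n))) (idx \<zeta> \<eta>))"
  using assms unfolding pos_roots_sm insert_iff empty_iff
  by (elim disjE FalseE; hypsubst) (simp_all add: elt_eval table_sm)

lemma comm_idx_Iof: "\<zeta> \<in> pos_roots (Iof b) \<Longrightarrow> \<eta> \<in> pos_roots (Iof b) \<Longrightarrow> comm_idx \<zeta> \<eta> = idx \<zeta> \<eta>"
  by (cases b) (simp_all add: comm_idx_lg comm_idx_sm)

lemma cmt_elt:
  assumes "\<zeta> \<in> pos_roots (Iof b)" "\<eta> \<in> pos_roots (Iof b)" "i \<le> ht (Iof b) \<zeta>" "j \<le> ht (Iof b) \<eta>"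
  shows "cmt (elt b \<zeta> i t) (elt b \<eta> j u) =
    sum_list (map (\<lambda>(m, n). elt b (m \<bullet> \<zeta> + n \<bullet> \<eta>) (m * i + n * j)
      (of_int (struct_const \<zeta> \<eta> m n) * (t ^ m * u ^ n))) (comm_idx \<zeta> \<eta>))"
  unfolding comm_idx_Iof[OF assms(1,2)] using assms cmt_elt_lg cmt_elt_sm by (cases b) simp_all

section \<open>Steinberg words with generic coefficients\<close>

lemma word_gam_exw_neg: "okw b (exw b \<zeta> t i) \<Longrightarrow> word_gam b (fneg (exw b \<zeta> t i)) = - elt b \<zeta> i t"
  by (simp add: elt_def word_gam_fneg)

lemma word_gam_concat:
  assumes "\<And>w. w \<in> set ws \<Longrightarrow> okw b w"
  shows "okw b (concat ws) \<and> word_gam b (concat ws) = sum_list (map (word_gam b) ws)"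
  using assms by (induction ws) (auto simp: okw_append word_gam_append)

lemma projw_concat: "projw x (concat ws) = concat (map (projw x) ws)"
  by (induction ws) simp_all

text \<open>The k-th entry of the parameter sequence as a ring element; \<open>prm 0\<close> and
  \<open>prm 1\<close> serve as generic coefficients t and u.\<close>

definition prm :: "nat \<Rightarrow> 'a sc"
  where "prm k = mk 0 (\<lambda>(K, F, f, v). v k)"

lemma proj_prm: "good K \<Longrightarrow> v k \<in> carrier K \<Longrightarrow> proj (K, F, f, v) (prm k) = v k"
  by (simp add: prm_def proj_mk)

definition add_word :: "bool \<Rightarrow> root \<Rightarrow> nat \<Rightarrow> 'a fword"
  where "add_word b \<zeta> i = exw b \<zeta> (prm 0) i @ exw b \<zeta> (prm 1) i @ fneg (exw b \<zeta> (prm 0 + prm 1) i)"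

definition commutator_word :: "bool \<Rightarrow> root \<Rightarrow> nat \<Rightarrow> root \<Rightarrow> nat \<Rightarrow> 'a fword"
  where "commutator_word b \<zeta> i \<eta> j =
    exw b \<zeta> (prm 0) i @ exw b \<eta> (prm 1) j @ fneg (exw b \<zeta> (prm 0) i) @ fneg (exw b \<eta> (prm 1) j)
    @ fneg (concat (map (\<lambda>(m, n). exw b (m \<bullet> \<zeta> + n \<bullet> \<eta>)
        (of_int (struct_const \<zeta> \<eta> m n) * (prm 0 ^ m * prm 1 ^ n)) (m * i + n * j)) (comm_idx \<zeta> \<eta>)))"

lemma add_word:
  assumes "\<zeta> \<in> pos_roots (Iof b)" "i \<le> ht (Iof b) \<zeta>"
  shows "okw b (add_word b \<zeta> i :: 'a fword)" "word_gam b (add_word b \<zeta> i :: 'a fword) = 0"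
proof -
  note ok = okw_exw[OF assms]
  show "okw b (add_word b \<zeta> i :: 'a fword)"
    by (simp add: add_word_def okw_append ok)
  show "word_gam b (add_word b \<zeta> i :: 'a fword) = 0"
    unfolding add_word_def
    by (simp add: okw_append word_gam_append ok word_gam_exw_neg elt_add[OF assms] flip: elt_def)
      (simp add: diff_conv_add_uminus add.assoc minus_add del: add_uminus_conv_diff)
qed

lemma commutator_word:
  assumes "\<zeta> \<in> pos_roots (Iof b)" "\<eta> \<in> pos_roots (Iof b)" "i \<le> ht (Iof b) \<zeta>" "j \<le> ht (Iof b) \<eta>"
  shows "okw b (commutator_word b \<zeta> i \<eta> j :: 'a fword)" "word_gam b (commutator_word b \<zeta> i \<eta> j :: 'a fword) = 0"
proof -
  let ?r = "\<lambda>(m, n). exw b (m \<bullet> \<zeta> + n \<bullet> \<eta>)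
        (of_int (struct_const \<zeta> \<eta> m n) * (prm 0 ^ m * prm 1 ^ n :: 'a sc)) (m * i + n * j)"
  let ?rhs = "concat (map ?r (comm_idx \<zeta> \<eta>))"
  have "okw b (?r (m, n))" if "(m, n) \<in> set (comm_idx \<zeta> \<eta>)" for m n
  proof -
    have "m \<bullet> \<zeta> + n \<bullet> \<eta> \<in> pos_roots (Iof b)" "ht (Iof b) (m \<bullet> \<zeta> + n \<bullet> \<eta>) = m * ht (Iof b) \<zeta> + n * ht (Iof b) \<eta>"
      using idx_pos_roots[OF assms(1,2)] that unfolding comm_idx_Iof[OF assms(1,2)] by blast+
    then show ?thesis
      using assms(3,4) by (simp add: okw_exw add_mono mult_le_mono2)
  qed
  then have "okw b w" if "w \<in> set (map ?r (comm_idx \<zeta> \<eta>))" for w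
    using that unfolding set_map by (elim imageE) (simp only: split_paired_all)
  then have r: "okw b ?rhs" "word_gam b ?rhs = sum_list (map (word_gam b) (map ?r (comm_idx \<zeta> \<eta>)))"
    using word_gam_concat[of "map ?r (comm_idx \<zeta> \<eta>)" b] by blast+
  then have g: "word_gam b ?rhs = cmt (elt b \<zeta> i (prm 0)) (elt b \<eta> j (prm 1))"
    unfolding cmt_elt[OF assms] r(2) map_map
    by (intro arg_cong[where f = sum_list] map_cong refl) (auto simp: elt_def)
  note ok = okw_exw[OF assms(1,3)] okw_exw[OF assms(2,4)]
  show "okw b (commutator_word b \<zeta> i \<eta> j :: 'a fword)"
    by (simp only: commutator_word_def okw_append okw_fneg ok r simp_thms)
  show "word_gam b (commutator_word b \<zeta> i \<eta> j :: 'a fword) = 0"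
    unfolding commutator_word_def
    by (simp only: okw_append word_gam_append okw_fneg ok r(1) simp_thms word_gam_exw_neg word_gam_fneg g)
      (simp add: cmt_def diff_conv_add_uminus add.assoc minus_add flip: elt_def del: add_uminus_conv_diff)
qed

lemma derivable_within_mono: "derivable_within I K R N w \<Longrightarrow> N \<le> N' \<Longrightarrow> derivable_within I K R N' w"
  unfolding derivable_within_def using le_trans by blast

lemma uniform_bound:
  assumes "finite A" "\<And>p. p \<in> A \<Longrightarrow> \<exists>N::nat. P p N" "\<And>p N N'. P p N \<Longrightarrow> N \<le> N' \<Longrightarrow> P p N'"
  shows "\<exists>N. \<forall>p\<in>A. P p N"
  using assms(1,2)
proof induction
  case (insert p A)
  then obtain N N' where "P p N" "\<forall>p\<in>A. P p N'" by blast
  then have "\<forall>q\<in>insert p A. P q (max N N')"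
    by (auto intro: assms(3)[OF _ max.cobounded1] assms(3)[OF _ max.cobounded2])
  then show ?case by blast
qed simp

text \<open>For fixed roots and degrees one generic word represents the relation for all K, F, f, t,
  u, and its vanishing in the group gives one bound. The choices of roots and degrees are finite in
  number.\<close>

lemma steinberg_bound:
  "\<exists>N. \<forall>K F f v. valid (K, F, f, v :: nat \<Rightarrow> 'a) \<longrightarrow> (\<forall>w \<in> pure_degree_steinberg (Iof b) K (alias_of K b).
    derivable_within (Iof b) K (in_subgroup_rels (Iof b) K f 20 \<union> lifted_rels (Iof b) K F 20) N w)"
proof -
  define E where "E = Sigma (pos_roots (Iof b)) (\<lambda>\<zeta>. {..ht (Iof b) \<zeta>})"
  have "finite (pos_roots (Iof b))"
    by (cases b) (simp_all add: pos_roots_lg pos_roots_sm)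
  then have E: "finite E" "finite (E \<times> E)"
    unfolding E_def by (intro finite_SigmaI finite_atMost finite_cartesian_product; assumption)+
  define Q where "Q w N \<longleftrightarrow> (\<forall>x. valid x \<longrightarrow> derivable_within (Iof b) (fst x) (rels b x) N (projw x w))"
    for w :: "'a fword" and N
  have mono: "Q w N \<Longrightarrow> N \<le> N' \<Longrightarrow> Q w N'" for w N N'
    unfolding Q_def using derivable_within_mono by blast
  have "\<exists>N. Q (add_word b (fst p) (snd p)) N" if "p \<in> E" for p
    unfolding Q_def using that by (intro word_gam_eq_0D add_word) (auto simp: E_def)
  then have "\<exists>N. \<forall>p\<in>E. Q (add_word b (fst p) (snd p)) N"
    using mono by (intro uniform_bound[OF E(1)])
  then obtain N1 where N1: "\<forall>p\<in>E. Q (add_word b (fst p) (snd p)) N1" ..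
  have "\<exists>N. Q (commutator_word b (fst (fst p)) (snd (fst p)) (fst (snd p)) (snd (snd p))) N" if "p \<in> E \<times> E" for p
    unfolding Q_def using that by (intro word_gam_eq_0D commutator_word) (auto simp: E_def)
  then have "\<exists>N. \<forall>p\<in>E \<times> E. Q (commutator_word b (fst (fst p)) (snd (fst p)) (fst (snd p)) (snd (snd p))) N"
    using mono by (intro uniform_bound[OF E(2)])
  then obtain N2 where N2: "\<forall>p\<in>E \<times> E. Q (commutator_word b (fst (fst p)) (snd (fst p)) (fst (snd p)) (snd (snd
      p))) N2" ..
  have "derivable_within (Iof b) K (in_subgroup_rels (Iof b) K f 20 \<union> lifted_rels (Iof b) K F 20) (max N1 N2) w"
    if v: "valid (K, F, f, v)" and w: "w \<in> pure_degree_steinberg (Iof b) K (alias_of K b)"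
    for K :: "'a ring" and F f v w
  proof -
    have K: "good K" using valid_good(1)[OF v] by simp
    \<comment> \<open>At this index the generic coefficients become the given t and u.\<close>
    define x where "x t u = (K, F, f, \<lambda>n :: nat. if n = 0 then t else u)" for t u :: 'a
    have x: "valid (x t u)" "fst (x t u) = K" "good (fst (x t u))"
      "rels b (x t u) = in_subgroup_rels (Iof b) K f 20 \<union> lifted_rels (Iof b) K F 20" for t u
      using v K by (simp_all add: x_def valid.simps)
    have p: "proj (x t u) (prm 0) = t" "proj (x t u) (prm 1) = u" if "t \<in> carrier K" "u \<in> carrier K" for t u
      unfolding x_def using that K by (simp_all add: proj_prm)
    have c: "proj (x t u) (of_int n * (prm 0 ^ l * prm 1 ^ m)) = [n] \<cdot>\<^bsub>K\<^esub> (t [^]\<^bsub>K\<^esub> l \<otimes>\<^bsub>K\<^esub> u [^]\<^bsub>K\<^esub> m)"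
      if "t \<in> carrier K" "u \<in> carrier K" for t u n l m
      unfolding proj_of_int_mult[OF x(3)] using that by (simp add: proj_simps(6)[OF x(3)] proj_power[OF x(3)] p x(2))
    note s = projw_exw[OF x(1)] projw_fneg[OF x(1)] projw_concat proj_simps(3)[OF x(3)] c p x(2)
    from w consider (add) "w \<in> steinberg_add (Iof b) K (alias_of K b)"
      | (comm) "w \<in> steinberg_comm (Iof b) K (alias_of K b)"
      unfolding pure_degree_steinberg_def by blast
    then show ?thesis
    proof cases
      case add
      then obtain \<zeta> t u i where *: "\<zeta> \<in> pos_roots (Iof b)" "i \<le> ht (Iof b) \<zeta>" "t \<in> carrier K" "u \<in> carrier K"
        "w = expand (Iof b) (alias_of K b) (\<zeta>, t, i) @ expand (Iof b) (alias_of K b) (\<zeta>, u, i)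
          @ word_inv K (expand (Iof b) (alias_of K b) (\<zeta>, t \<oplus>\<^bsub>K\<^esub> u, i))"
        unfolding steinberg_add_def by blast
      have "projw (x t u) (add_word b \<zeta> i) = w"
        unfolding add_word_def *(5) using *(3,4) by (simp add: s)
      moreover have "Q (add_word b \<zeta> i) N1"
        using N1 *(1,2) by (force simp: E_def)
      ultimately have "derivable_within (Iof b) K (in_subgroup_rels (Iof b) K f 20 \<union> lifted_rels (Iof b) K F 20) N1 w"
        unfolding Q_def using x by metis
      then show ?thesis by (rule derivable_within_mono) simp
    next
      case comm
      then obtain \<zeta> \<eta> t u i j where *: "\<zeta> \<in> pos_roots (Iof b)" "\<eta> \<in> pos_roots (Iof b)" "i \<le> ht (Iof b) \<zeta>"
        "j \<le> ht (Iof b) \<eta>" "t \<in> carrier K" "u \<in> carrier K"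
        "w = expand (Iof b) (alias_of K b) (\<zeta>, t, i) @ expand (Iof b) (alias_of K b) (\<eta>, u, j)
       @ word_inv K (expand (Iof b) (alias_of K b) (\<zeta>, t, i)) @ word_inv K (expand (Iof b) (alias_of K b) (\<eta>, u, j))
       @ word_inv K (concat (map
           (\<lambda>(m, n). expand (Iof b) (alias_of K b)
              (m \<bullet> \<zeta> + n \<bullet> \<eta>, [struct_const \<zeta> \<eta> m n] \<cdot>\<^bsub>K\<^esub> (t [^]\<^bsub>K\<^esub> m \<otimes>\<^bsub>K\<^esub> u [^]\<^bsub>K\<^esub> n), m * i + n * j))
           (comm_idx \<zeta> \<eta>)))"
        unfolding steinberg_comm_def by blast
      have "projw (x t u) (commutator_word b \<zeta> i \<eta> j) = w"
        unfolding commutator_word_def *(7) using *(5,6) by (simp add: s comp_def case_prod_unfold)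
      moreover have "Q (commutator_word b \<zeta> i \<eta> j) N2"
        using N2 *(1-4) by (force simp: E_def)
      ultimately have "derivable_within (Iof b) K (in_subgroup_rels (Iof b) K f 20 \<union> lifted_rels (Iof b) K F 20) N2 w"
        unfolding Q_def using x by metis
      then show ?thesis by (rule derivable_within_mono) simp
    qed
  qed
  then show ?thesis by blast
qed

lemma list_all2_cw:
  assumes "valid x" "corr x (t, i) T" "corr x (u, j) U"
  shows "list_all2 (corr_letter x) (cw uminus (r, t, i) (r', u, j)) (comm_word (r, T) (r', U))"
  using assms by (simp add: cw_def comm_word_def neg_word_def corr_uminus)

lemma is_alias_alias_of:
  assumes v: "valid (K, F, f, v)"
  shows "is_alias (Iof b) K f (alias_of K b)"
  unfolding is_alias_def
proof (intro ballI allI impI)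
  fix \<zeta> t i assume \<zeta>: "\<zeta> \<in> pos_roots (Iof b) - rank2_roots (Iof b)" and t: "t \<in> carrier K" and i: "i \<le> ht (Iof b) \<zeta>"
  have K: "good K" using valid_good(1)[OF v] by simp
  define x where "x = (K, F, f, \<lambda>_ :: nat. t)"
  have x: "valid x" "fst x = K" "fst (snd (snd x)) = f"
    using v by (simp_all add: x_def valid.simps)
  have p: "proj x (prm 0) = t"
    unfolding x_def using t K by (simp add: proj_prm)
  have w: "alias_of K b (\<zeta>, t, i) = projw x (alg 1 uminus b \<zeta> (prm 0) i)"
    using projw_alg[OF x(1), of b \<zeta> "prm 0" i] by (simp add: x p)
  have ok: "okw b (alg 1 uminus b \<zeta> (prm 0) i :: 'a fword)"
    using \<zeta> i by (intro okw_alg) auto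
  \<comment> \<open>These are the classes of t and of x, so a symbol of degree n carries the factor
    \<open>\<chi> ^ n\<close>, and the degree disappears into the coefficient.\<close>
  define \<tau> \<chi> where "\<tau> = cls x (prm 0, 0)" and "\<chi> = cls x (1, 1)"
  have X: "corr x (1, n) (\<chi> ^ n)" for n
    using corr_power[OF x(1) corr_cls[OF x(1), of "(1, 1)"], of n] by (simp add: \<chi>_def)
  have X': "corr x (- 1, n) (- (\<chi> ^ n))" for n
    using corr_uminus[OF x(1) X] .
  have T: "corr x (prm 0, n) (\<tau> * \<chi> ^ n)" for n
    using corr_mult[OF x(1) corr_cls[OF x(1), of "(prm 0, 0)"] X, of n] by (simp add: \<tau>_def)
  have val: "word_val (Iof b) K f (projw x (alg 1 uminus b \<zeta> (prm 0) i)) = x_deg K f \<zeta> t i"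
    if "list_all2 (corr_letter x) (alg 1 uminus b \<zeta> (prm 0) i) w'"
      "\<And>v. wact w' v = act \<zeta> (\<tau> * \<chi> ^ i) v" for w'
    using word_val_alias[OF x(1) that T, of "Iof b"] by (simp only: x p)
  have pow: "\<tau> * \<chi> ^ (i - n) * \<chi> ^ min i n = \<tau> * \<chi> ^ i" "\<tau> * \<chi> ^ min i n * \<chi> ^ (i - n) = \<tau> * \<chi> ^ i" for n i
  proof -
    have "i - n + min i n = i" "min i n + (i - n) = i" by linarith+
    then show "\<tau> * \<chi> ^ (i - n) * \<chi> ^ min i n = \<tau> * \<chi> ^ i" "\<tau> * \<chi> ^ min i n * \<chi> ^ (i - n) = \<tau> * \<chi> ^ i"
      by (simp_all only: mult.assoc flip: power_add)
  qed
  from pos_not_rank2[of \<zeta> b] \<zeta> consider (abc) "b" "\<zeta> = (1,0,0)" | (abcc) "b" "\<zeta> = (1,0,1)"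
    | (abbcc) "b" "\<zeta> = (1,1,0)" | (bpq) "\<not> b" "\<zeta> = (-1,1,0)"
    by blast
  then have "word_val (Iof b) K f (projw x (alg 1 uminus b \<zeta> (prm 0) i)) = x_deg K f \<zeta> t i"
  proof cases
    case abc
    let ?k = "min i 2 + 2 * (i - 2)"
    \<comment> \<open>This is the condition t' u' = t u^2 of \<open>wact_alias_lg'\<close>, with u
      the power of x placed at \<psi>.\<close>
    have "\<tau> * \<chi> ^ (?k - 3) * \<chi> ^ min ?k 3 = \<tau> * \<chi> ^ min i 2 * (\<chi> ^ (i - 2))\<^sup>2"
      unfolding pow by (simp add: power_add mult.assoc mult.commute flip: power_mult)
    note a = wact_alias_lg'[OF this]
    show ?thesis
      by (rule val[where w' = "comm_word ((1,0,-1), \<tau> * \<chi> ^ min i 2) ((0,0,1), \<chi> ^ (i - 2))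
          @ comm_word ((1,-1,0), \<tau> * \<chi> ^ (?k - 3)) ((0,1,1), \<chi> ^ min ?k 3)"])
        (simp_all add: abc alg_def list_all2_appendI list_all2_cw[OF x(1)] X T a pow del: wact_simps(3))
  next
    case abcc
    show ?thesis
      by (rule val[where w' = "comm_word ((1,-1,0), \<tau> * \<chi> ^ (i - 3)) ((0,1,1), \<chi> ^ min i 3)"])
        (simp_all add: abcc alg_def list_all2_cw[OF x(1)] X T wact_alias_lg pow)
  next
    case abbcc
    show ?thesis
      by (rule val[where w' = "comm_word ((1,0,-1), \<tau> * \<chi> ^ (i - 3)) ((0,1,1), - (\<chi> ^ min i 3))"])
        (simp_all add: abbcc alg_def list_all2_cw[OF x(1)] X' T wact_alias_lg pow)
  next
    case bpq
    show ?thesis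
      by (rule val[where w' = "comm_word ((0,1,-1), \<tau> * \<chi> ^ (i - 2)) ((-1,0,1), \<chi> ^ min i 2)"])
        (simp_all add: bpq alg_def list_all2_cw[OF x(1)] X T wact_alias_sm pow)
  qed
  then show "alias_of K b (\<zeta>, t, i) \<in> lists (gens (Iof b) K) \<and>
      word_val (Iof b) K f (alias_of K b (\<zeta>, t, i)) = x_deg K f \<zeta> t i"
    using projw_genw[OF x(1) ok] unfolding w x(2) by blast
qed

text \<open>If 1 + 1 were 0, then 0 and 1 would form an additive subgroup of order 2, against the
  theorem of Lagrange.\<close>

lemma good_odd_field:
  assumes "field K" "odd (card (carrier K))"
  shows "good K"
proof -
  interpret field K by fact
  have "\<one>\<^bsub>K\<^esub> \<oplus>\<^bsub>K\<^esub> \<one>\<^bsub>K\<^esub> \<noteq> \<zero>\<^bsub>K\<^esub>"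
  proof
    assume two: "\<one>\<^bsub>K\<^esub> \<oplus>\<^bsub>K\<^esub> \<one>\<^bsub>K\<^esub> = \<zero>\<^bsub>K\<^esub>"
    then have "\<ominus>\<^bsub>K\<^esub> \<one>\<^bsub>K\<^esub> = \<one>\<^bsub>K\<^esub>" "\<ominus>\<^bsub>K\<^esub> \<zero>\<^bsub>K\<^esub> = \<zero>\<^bsub>K\<^esub>"
      by (simp_all add: minus_equality)
    then have "subgroup {\<zero>\<^bsub>K\<^esub>, \<one>\<^bsub>K\<^esub>} (add_monoid K)"
      using two by (intro add.subgroupI) (auto simp flip: a_inv_def)
    then have "card {\<zero>\<^bsub>K\<^esub>, \<one>\<^bsub>K\<^esub>} dvd card (carrier K)"
      using add.lagrange[of "{\<zero>\<^bsub>K\<^esub>, \<one>\<^bsub>K\<^esub>}"] by (metis dvd_triv_right order_def partial_object.select_convs(1))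
    then show False using assms(2) zero_not_one by simp
  qed
  then show ?thesis
    by (simp add: good_def is_cring field_Units)
qed

theorem theorem5p3:
  "\<exists>N M :: nat. \<forall>p k :: nat. primepow p \<and> odd p \<and> k \<ge> 1 \<longrightarrow>
    (\<forall>(K :: 'a ring) F f.
      field K \<and> card (carrier K) = p ^ k \<and> subfield F K \<and> card F = p \<and>
      f \<in> carrier (UP K) \<and> ring_irreducible\<^bsub>UP K\<^esub> f \<and> deg K f \<ge> 6 \<longrightarrow>
      (\<exists>A. is_alias I_sm K f A \<and>
        (\<forall>w \<in> pure_degree_steinberg I_sm K A.
          derivable_within I_sm K (in_subgroup_rels I_sm K f M \<union> lifted_rels I_sm K F M) N w)) \<and>
      (\<exists>A. is_alias I_lg K f A \<and>
        (\<forall>w \<in> pure_degree_steinberg I_lg K A.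
          derivable_within I_lg K (in_subgroup_rels I_lg K f M \<union> lifted_rels I_lg K F M) N w)))"
proof -
  let ?S = "\<lambda>b N (K :: 'a ring) F f. \<forall>w \<in> pure_degree_steinberg (Iof b) K (alias_of K b).
    derivable_within (Iof b) K (in_subgroup_rels (Iof b) K f 20 \<union> lifted_rels (Iof b) K F 20) N w"
  obtain N1 N2 where N1: "\<And>K F f v. valid (K, F, f, v) \<Longrightarrow> ?S False N1 K F f"
    and N2: "\<And>K F f v. valid (K, F, f, v) \<Longrightarrow> ?S True N2 K F f"
    using steinberg_bound[of False] steinberg_bound[of True] by blast
  have *: "(\<exists>A. is_alias I_sm K f A \<and> (\<forall>w \<in> pure_degree_steinberg I_sm K A.
          derivable_within I_sm K (in_subgroup_rels I_sm K f 20 \<union> lifted_rels I_sm K F 20) (max N1 N2) w)) \<and>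
      (\<exists>A. is_alias I_lg K f A \<and> (\<forall>w \<in> pure_degree_steinberg I_lg K A.
          derivable_within I_lg K (in_subgroup_rels I_lg K f 20 \<union> lifted_rels I_lg K F 20) (max N1 N2) w))"
    if "odd p" "field K" "card (carrier K) = p ^ k" "subfield F K" "f \<in> carrier (UP K)"
    for p k :: nat and K :: "'a ring" and F f
  proof -
    have v: "valid (K, F, f, undefined)"
      using that by (simp add: valid.simps good_odd_field)
    have "?S False (max N1 N2) K F f" "?S True (max N1 N2) K F f"
      using N1[OF v] N2[OF v] derivable_within_mono by (meson max.cobounded1 max.cobounded2)+
    then show ?thesis
      using is_alias_alias_of[OF v, of False] is_alias_alias_of[OF v, of True]
      unfolding Iof_simps by blast
  qed
  show ?thesis
    by (intro exI[of _ "max N1 N2"] exI[of _ 20] allI impI, elim conjE) (rule *; assumption)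
qed

end
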